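(* Let $m\ge2$ be an integer, let $(\omega_0,\rho_0)\in H_0^m\times H_0^{m+1}$, let $0<T\le\infty$, and let $(\omega,\rho)\in C([0,T);H_0^m\times H_0^{m+1})$ be the unique classical solution with initial data $(\omega_0,\rho_0)$ of the system $$\begin{cases}\partial_t\rho(t,x)+u(t,x)\,\partial_x\rho(t,x)=0,\\ \partial_t\omega(t,x)+u(t,x)\,\partial_x\omega(t,x)=\partial_x\rho(t,x),\\ u(t,x)=-x\,\Omega(t,x),\quad \Omega(t,x)=\int_x^1\frac{\omega(t,y)}{y}\,dy,\\ \omega(0,x)=\omega_0(x),\quad \rho(0,x)=\rho_0(x).\end{cases}$$ Then for any finite $T^*$ with $0<T^*\le T$, the following are equivalent: (1) $\sup_{t\in[0,T^* )}\big(\|\omega(t)\|_{H^m}+\|\rho(t)\|_{H^{m+1}}\big)<\infty$. (2) $\int_0^{T^*}\|\partial_xu(t)\|_{L^\infty}\,dt<\infty$. (3) $\int_0^{T^*}\|\omega(t)\|_{L^\infty}\,dt<\infty$. (4) $\int_0^{T^*}\|\partial_x\rho(t)\|_{L^\infty}\,dt<\infty$.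
   Context: The system is posed for $x\in[0,1]$ with Dirichlet boundary conditions $\omega=\rho=0$ at $x=0$ and $x=1$. All norms are over the interval $(0,1)$. $H^m=H^m((0,1))$ is the usual $L^2$-based Sobolev space, and $H_0^m=H_0^m((0,1))$ is the completion of $C_0^\infty((0,1))\cap H^m((0,1))$ in the $H^m((0,1))$ topology, where $C_0^\infty((0,1))$ denotes smooth functions compactly supported in $(0,1)$. A classical solution is one for which the equations hold pointwise with all terms continuous. *)

theory Defs
  imports "HOL-Analysis.Analysis" "HOL-Probability.Essential_Supremum"
begin

section \<open>Sobolev spaces on the interval (0,1)\<close>

text \<open>Elements of the function spaces are represented by functions on the real line; only their
  values on (0,1), up to null sets, are relevant.\<close>

abbreviation unit_measure :: "real measure" where
  "unit_measure \<equiv> lebesgue_on {0<..<1}"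

definition test_function :: "(real \<Rightarrow> real) \<Rightarrow> bool" where
  "test_function \<phi> \<longleftrightarrow>
     (\<forall>k x. (deriv ^^ k) \<phi> field_differentiable at x) \<and>
     (\<exists>K. compact K \<and> K \<subseteq> {0<..<1} \<and> (\<forall>x. x \<notin> K \<longrightarrow> \<phi> x = 0))"

definition L2_space :: "(real \<Rightarrow> real) set" where
  "L2_space = {f \<in> borel_measurable unit_measure. integrable unit_measure (\<lambda>x. (f x)\<^sup>2)}"

definition has_weak_deriv :: "nat \<Rightarrow> (real \<Rightarrow> real) \<Rightarrow> (real \<Rightarrow> real) \<Rightarrow> bool" where
  "has_weak_deriv k f g \<longleftrightarrow>
     (\<forall>\<phi>. test_function \<phi> \<longrightarrow>
        (LINT x|unit_measure. f x * (deriv ^^ k) \<phi> x) = (-1) ^ k * (LINT x|unit_measure. g x * \<phi> x))"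

definition sobolev :: "nat \<Rightarrow> (real \<Rightarrow> real) set" where
  "sobolev m = {f \<in> L2_space. \<forall>k\<le>m. \<exists>g\<in>L2_space. has_weak_deriv k f g}"

text \<open>The choice below is unique up to a null set of (0,1), so that the norm does not depend
  on it.\<close>

definition weak_deriv :: "nat \<Rightarrow> (real \<Rightarrow> real) \<Rightarrow> real \<Rightarrow> real" where
  "weak_deriv k f = (SOME g. g \<in> L2_space \<and> has_weak_deriv k f g)"

definition sobolev_norm :: "nat \<Rightarrow> (real \<Rightarrow> real) \<Rightarrow> real" where
  "sobolev_norm m f = sqrt (\<Sum>k\<le>m. LINT x|unit_measure. (weak_deriv k f x)\<^sup>2)"

text \<open>Since the Sobolev space is complete, the completion of the test functions is their closure
  in it.\<close>

definition sobolev0 :: "nat \<Rightarrow> (real \<Rightarrow> real) set" where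
  "sobolev0 m = {f \<in> sobolev m.
     \<forall>\<epsilon>>0. \<exists>\<phi>. test_function \<phi> \<and> sobolev_norm m (\<lambda>x. f x - \<phi> x) < \<epsilon>}"

definition Linf_norm :: "(real \<Rightarrow> real) \<Rightarrow> ennreal" where
  "Linf_norm f = esssup unit_measure (\<lambda>x. ennreal \<bar>f x\<bar>)"


section \<open>The system\<close>

definition time_interval :: "ereal \<Rightarrow> real set" where
  "time_interval T = {t. 0 \<le> t \<and> ereal t < T}"

definition continuous_into_sobolev0 :: "ereal \<Rightarrow> nat \<Rightarrow> (real \<Rightarrow> real \<Rightarrow> real) \<Rightarrow> bool" where
  "continuous_into_sobolev0 T m f \<longleftrightarrow>
     (\<forall>t\<in>time_interval T. f t \<in> sobolev0 m \<and>
        ((\<lambda>s. sobolev_norm m (\<lambda>x. f s x - f t x)) \<longlongrightarrow> 0) (at t within time_interval T))"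

text \<open>The integrand below is integrable for functions in \<open>sobolev0 1\<close>, which are
  \<open>O(y powr (1/2))\<close> at 0.\<close>

definition Omega :: "(real \<Rightarrow> real) \<Rightarrow> real \<Rightarrow> real" where
  "Omega w x = (LINT y:{x..1}|lebesgue. w y / y)"

definition velocity :: "(real \<Rightarrow> real) \<Rightarrow> real \<Rightarrow> real" where
  "velocity w x = - x * Omega w x"

text \<open>Derivatives at the endpoints of the space and time intervals are one-sided.\<close>

definition classical_solution ::
  "ereal \<Rightarrow> (real \<Rightarrow> real) \<Rightarrow> (real \<Rightarrow> real) \<Rightarrow> (real \<Rightarrow> real \<Rightarrow> real) \<Rightarrow> (real \<Rightarrow> real \<Rightarrow> real) \<Rightarrow> bool"
where
  "classical_solution T \<omega>0 \<rho>0 \<omega> \<rho> \<longleftrightarrow>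
     (\<exists>\<omega>t \<omega>x \<rho>t \<rho>x.
        (\<forall>t\<in>time_interval T. \<forall>x\<in>{0..1}.
           ((\<lambda>s. \<omega> s x) has_real_derivative \<omega>t t x) (at t within time_interval T) \<and>
           (\<omega> t has_real_derivative \<omega>x t x) (at x within {0..1}) \<and>
           ((\<lambda>s. \<rho> s x) has_real_derivative \<rho>t t x) (at t within time_interval T) \<and>
           (\<rho> t has_real_derivative \<rho>x t x) (at x within {0..1}) \<and>
           \<rho>t t x + velocity (\<omega> t) x * \<rho>x t x = 0 \<and>
           \<omega>t t x + velocity (\<omega> t) x * \<omega>x t x = \<rho>x t x) \<and>
        (\<forall>f\<in>{\<omega>, \<rho>, \<omega>t, \<omega>x, \<rho>t, \<rho>x, \<lambda>t. velocity (\<omega> t)}.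
           continuous_on (time_interval T \<times> {0..1}) (\<lambda>(t, x). f t x))) \<and>
     (\<forall>t\<in>time_interval T. \<omega> t 0 = 0 \<and> \<omega> t 1 = 0 \<and> \<rho> t 0 = 0 \<and> \<rho> t 1 = 0) \<and>
     (\<forall>x\<in>{0..1}. \<omega> 0 x = \<omega>0 x \<and> \<rho> 0 x = \<rho>0 x)"

end

theory Submission
  imports Defs
begin

text \<open>An integrable bound for \<open>u\<^sub>x\<close> controls \<open>\<rho>\<^sub>x\<close>, and an integrable bound for \<open>\<rho>\<^sub>x\<close> controls \<open>\<omega>\<close>, by the
  maximum principle for the transport equations of \<open>\<rho>\<^sub>x\<close> and \<open>\<omega>\<close>. An integrable bound for \<open>\<omega>\<close> in turn
  controls \<open>\<omega> / x\<close> and \<open>\<rho>\<^sub>x / x\<close>: the coefficients of their transport equations involve only \<open>\<omega>\<close> and \<open>\<Omega>\<close>,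
  and \<open>\<bar>\<Omega>\<bar>\<close> is at most \<open>1 + \<parallel>\<omega>\<parallel> log (sup \<bar>\<omega> / x\<bar>)\<close>, so that Gronwall applies to the logarithm. With
  \<open>\<omega> / x\<close> and \<open>\<rho>\<^sub>x / x\<close>, all of \<open>\<omega>\<close>, \<open>\<Omega>\<close>, \<open>u\<^sub>x\<close> and \<open>\<rho>\<^sub>x\<close> are bounded, and the norms of \<open>\<omega>\<close> in \<open>H\<^sup>k\<close> and of
  \<open>\<rho>\<close> in \<open>H\<^sup>k\<^sup>+\<^sup>1\<close> are bounded by induction on \<open>k\<close>. The energy estimate for this would lose a derivative;
  it is therefore carried out for \<open>k\<close>-fold difference quotients, uniformly in the step \<open>h\<close>, which needs only
  the classical derivatives in time, and \<open>h\<close> tends to 0 at the end. The loss of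
  one derivative in \<open>u'' = \<omega> / x + \<omega>\<^sub>x\<close> is absorbed by Hardy's inequality.\<close>

section \<open>Square integrable functions\<close>

text \<open>Membership in the closure of the test functions is stronger than the Dirichlet
  condition, and this shapes the proof: all derivatives below the top order vanish at 0 and 1. Hence
  the extensions by zero keep these derivatives continuous, differences can be taken across the
  endpoints without boundary terms, and both quotients by x vanish at both ends. Sup bounds come
  from barriers instead of characteristics: at the first contact with a barrier the space derivative
  vanishes, and with it the transport term. For the quotients by x, the quotient rule at a critical
  point turns the transport term into \<Omega> times the quotient. The growth rate of the discrete
  energy is bounded by the full norms, not by the discrete energy itself. The estimate therefore
  closes only after h has gone to 0, and Gronwall is applied in integral form to norms that are
  merely known to be continuous in time. Embedding, Hardy's inequality and the bounds for
  differences are proved for test functions, where all derivatives exist, and carried over by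
  limits; difference quotients reach the top order, at which no classical derivative is
  available.\<close>

definition l2 :: "'a measure \<Rightarrow> ('a \<Rightarrow> real) \<Rightarrow> real" where
  "l2 M f = sqrt (LINT x|M. (f x)\<^sup>2)"

text \<open>The integral of a non-integrable function is 0, so \<open>l2\<close> carries information
  only together with this predicate.\<close>

definition sqint :: "'a measure \<Rightarrow> ('a \<Rightarrow> real) \<Rightarrow> bool" where
  "sqint M f \<longleftrightarrow> f \<in> borel_measurable M \<and> integrable M (\<lambda>x. (f x)\<^sup>2)"

lemma l2_nonneg [simp]: "0 \<le> l2 M f"
  by (simp add: l2_def)

lemma l2_square: "(l2 M f)\<^sup>2 = (LINT x|M. (f x)\<^sup>2)"
  by (simp add: l2_def)

lemma sqint_mult_integrable:
  assumes "sqint M f" "sqint M g"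
  shows "integrable M (\<lambda>x. f x * g x)"
proof (rule Bochner_Integration.integrable_bound)
  show "integrable M (\<lambda>x. (f x)\<^sup>2 + (g x)\<^sup>2)"
    using assms by (simp add: sqint_def)
  show "(\<lambda>x. f x * g x) \<in> borel_measurable M"
    using assms by (auto simp: sqint_def)
  have "\<bar>a * b\<bar> \<le> a\<^sup>2 + b\<^sup>2" for a b :: real
  proof -
    have "0 \<le> (\<bar>a\<bar> - \<bar>b\<bar>)\<^sup>2" by simp
    then have "2 * \<bar>a * b\<bar> \<le> a\<^sup>2 + b\<^sup>2"
      by (simp add: power2_diff abs_mult)
    then show ?thesis by linarith
  qed
  then show "AE x in M. norm (f x * g x) \<le> norm ((f x)\<^sup>2 + (g x)\<^sup>2)"
    by simp
qed

lemma sqint_add: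
  assumes "sqint M f" "sqint M g"
  shows "sqint M (\<lambda>x. f x + g x)"
proof -
  have "integrable M (\<lambda>x. (f x)\<^sup>2 + (g x)\<^sup>2 + 2 * (f x * g x))"
    using assms sqint_mult_integrable[OF assms] by (auto simp: sqint_def)
  then show ?thesis using assms by (auto simp: sqint_def power2_sum mult.assoc)
qed

lemma sqint_cmult: "sqint M f \<Longrightarrow> sqint M (\<lambda>x. c * f x)"
  by (auto simp: sqint_def power_mult_distrib)

lemma sqint_diff:
  assumes "sqint M f" "sqint M g"
  shows "sqint M (\<lambda>x. f x - g x)"
  using sqint_add[OF assms(1) sqint_cmult[OF assms(2), of "-1"]] by simp

lemma l2_minus_commute: "l2 M (\<lambda>x. f x - g x) = l2 M (\<lambda>x. g x - f x)"
  by (simp add: l2_def power2_commute)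

lemma l2_Cauchy_Schwarz:
  assumes "sqint M f" "sqint M g"
  shows "\<bar>LINT x|M. f x * g x\<bar> \<le> l2 M f * l2 M g"
proof -
  let ?a = "LINT x|M. (f x)\<^sup>2" and ?b = "LINT x|M. f x * g x" and ?c = "LINT x|M. (g x)\<^sup>2"
  have i: "integrable M (\<lambda>x. (f x)\<^sup>2)" "integrable M (\<lambda>x. (g x)\<^sup>2)" "integrable M (\<lambda>x. f x * g x)"
    using assms sqint_mult_integrable by (auto simp: sqint_def)
  have q: "0 \<le> s\<^sup>2 * ?a + 2 * s * t * ?b + t\<^sup>2 * ?c" for s t
  proof -
    have "0 \<le> (LINT x|M. (s * f x + t * g x)\<^sup>2)" by simp
    also have "\<dots> = (LINT x|M. s\<^sup>2 * (f x)\<^sup>2 + 2 * s * t * (f x * g x) + t\<^sup>2 * (g x)\<^sup>2)"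
      by (simp add: power2_sum power_mult_distrib algebra_simps)
    also have "\<dots> = s\<^sup>2 * ?a + 2 * s * t * ?b + t\<^sup>2 * ?c"
      using i by simp
    finally show ?thesis .
  qed
  have nn: "0 \<le> ?a" "0 \<le> ?c" by auto
  have "?b\<^sup>2 \<le> ?a * ?c"
  proof (cases "?a = 0")
    case True
    have "?b = 0"
    proof (rule ccontr)
      assume "?b \<noteq> 0"
      \<comment> \<open>With \<open>?a = 0\<close> and t = 1, this value of s makes the nonnegative
        quadratic form equal to -1.\<close>
      have "0 \<le> 2 * (- (?c + 1) / (2 * ?b)) * ?b + ?c"
        using q[of "- (?c + 1) / (2 * ?b)" 1] True by simp
      with \<open>?b \<noteq> 0\<close> show False by (simp add: field_simps)
    qed
    then show ?thesis using True by simp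
  next
    case False
    then have "0 < ?a" using nn by linarith
    \<comment> \<open>The minimizing direction s = \<open>?b\<close>, t = - \<open>?a\<close> gives
      \<open>?a\<close> times the defect of the inequality.\<close>
    have "0 \<le> ?b\<^sup>2 * ?a + 2 * ?b * (-?a) * ?b + (-?a)\<^sup>2 * ?c" by (rule q)
    then have "0 \<le> ?a * (?a * ?c - ?b\<^sup>2)"
      by (simp add: power2_eq_square algebra_simps)
    with \<open>0 < ?a\<close> show ?thesis
      by (simp add: zero_le_mult_iff)
  qed
  then have "sqrt (?b\<^sup>2) \<le> sqrt (?a * ?c)" by (rule real_sqrt_le_mono)
  then show ?thesis by (simp add: l2_def real_sqrt_mult)
qed

lemma l2_triangle:
  assumes "sqint M f" "sqint M g"
  shows "l2 M (\<lambda>x. f x + g x) \<le> l2 M f + l2 M g"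
proof -
  have i: "integrable M (\<lambda>x. (f x)\<^sup>2)" "integrable M (\<lambda>x. (g x)\<^sup>2)" "integrable M (\<lambda>x. f x * g x)"
    using assms sqint_mult_integrable by (auto simp: sqint_def)
  have "(l2 M (\<lambda>x. f x + g x))\<^sup>2 = (LINT x|M. (f x)\<^sup>2 + (g x)\<^sup>2 + 2 * (f x * g x))"
    by (simp add: l2_square power2_sum algebra_simps)
  also have "\<dots> = (l2 M f)\<^sup>2 + (l2 M g)\<^sup>2 + 2 * (LINT x|M. f x * g x)"
    using i by (simp add: l2_square)
  also have "\<dots> \<le> (l2 M f)\<^sup>2 + (l2 M g)\<^sup>2 + 2 * (l2 M f * l2 M g)"
    using l2_Cauchy_Schwarz[OF assms] by simp
  also have "\<dots> = (l2 M f + l2 M g)\<^sup>2"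
    by (simp add: power2_sum algebra_simps)
  finally show ?thesis by (rule power2_le_imp_le) simp
qed

lemma l2_cong_AE:
  assumes "f \<in> borel_measurable M" "g \<in> borel_measurable M" "AE x in M. f x = g x"
  shows "l2 M f = l2 M g"
proof -
  have "(LINT x|M. (f x)\<^sup>2) = (LINT x|M. (g x)\<^sup>2)"
    using assms by (intro integral_cong_AE) auto
  then show ?thesis by (simp add: l2_def)
qed

lemma l2_diff_triangle:
  assumes "sqint M f" "sqint M g"
  shows "l2 M f \<le> l2 M g + l2 M (\<lambda>x. f x - g x)"
  using l2_triangle[OF assms(2) sqint_diff[OF assms]] by simp


section \<open>Continuous functions of compact support\<close>

text \<open>A class stable under shifts, differences and multiplication by any continuous function,
  in which integrability is automatic and integration by parts leaves no boundary terms.\<close>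

definition Cc :: "(real \<Rightarrow> real) \<Rightarrow> bool" where
  "Cc f \<longleftrightarrow> continuous_on UNIV f \<and> (\<exists>R. \<forall>x. R < \<bar>x\<bar> \<longrightarrow> f x = 0)"

lemma CcI: "continuous_on UNIV f \<Longrightarrow> (\<And>x. R < \<bar>x\<bar> \<Longrightarrow> f x = 0) \<Longrightarrow> Cc f"
  unfolding Cc_def by blast

lemma Cc_cont: "Cc f \<Longrightarrow> continuous_on UNIV f"
  by (simp add: Cc_def)

lemma Cc_measurable: "Cc f \<Longrightarrow> f \<in> borel_measurable borel"
  by (simp add: Cc_def borel_measurable_continuous_onI)

lemma Cc_integrable: "Cc f \<Longrightarrow> integrable lborel f"
proof -
  assume "Cc f"
  then obtain R where c: "continuous_on UNIV f" and R: "\<And>x. R < \<bar>x\<bar> \<Longrightarrow> f x = 0"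
    unfolding Cc_def by blast
  have "integrable lborel (\<lambda>x. indicator {-R..R} x *\<^sub>R f x)"
    using c by (intro borel_integrable_compact) (auto intro: continuous_on_subset)
  also have "(\<lambda>x. indicator {-R..R} x *\<^sub>R f x) = f"
  proof
    show "indicator {-R..R} x *\<^sub>R f x = f x" for x
      using R[of x] by (cases "R < \<bar>x\<bar>") (auto simp: indicator_def)
  qed
  finally show ?thesis .
qed

lemma Cc_mult: 
  assumes "Cc f" "continuous_on UNIV g"
  shows "Cc (\<lambda>x. f x * g x)"
proof -
  from assms(1) obtain R where "continuous_on UNIV f" "\<And>x. R < \<bar>x\<bar> \<Longrightarrow> f x = 0"
    unfolding Cc_def by blast
  with assms(2) show ?thesis by (intro CcI[of _ R] continuous_intros) auto
qed

lemma Cc_mult2: "Cc f \<Longrightarrow> continuous_on UNIV g \<Longrightarrow> Cc (\<lambda>x. g x * f x)"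
  using Cc_mult[of f g] by (simp add: mult.commute)

lemma Cc_cmult: "Cc f \<Longrightarrow> Cc (\<lambda>x. c * f x)"
  by (rule Cc_mult2) auto

lemma Cc_power2: "Cc f \<Longrightarrow> Cc (\<lambda>x. (f x)\<^sup>2)"
  unfolding power2_eq_square by (intro Cc_mult Cc_cont)

lemma Cc_add: 
  assumes "Cc f" "Cc g"
  shows "Cc (\<lambda>x. f x + g x)"
proof -
  from assms(1) obtain R where 1: "continuous_on UNIV f" "\<And>x. R < \<bar>x\<bar> \<Longrightarrow> f x = 0"
    unfolding Cc_def by blast
  from assms(2) obtain S where 2: "continuous_on UNIV g" "\<And>x. S < \<bar>x\<bar> \<Longrightarrow> g x = 0"
    unfolding Cc_def by blast
  show ?thesis by (rule CcI[of _ "max R S"]) (use 1 2 in \<open>auto intro!: continuous_intros\<close>)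
qed

lemma Cc_diff: "Cc f \<Longrightarrow> Cc g \<Longrightarrow> Cc (\<lambda>x. f x - g x)"
  using Cc_add[of f "\<lambda>x. -1 * g x"] Cc_cmult[of g "-1"] by simp

lemma Cc_shift: 
  assumes "Cc f"
  shows "Cc (\<lambda>x. f (x + c))"
proof -
  from assms obtain R where 1: "continuous_on UNIV f" "\<And>x. R < \<bar>x\<bar> \<Longrightarrow> f x = 0"
    unfolding Cc_def by blast
  show ?thesis
    by (rule CcI[of _ "R + \<bar>c\<bar>"])
       (use 1 in \<open>auto intro!: continuous_intros continuous_on_compose2[OF 1(1)]\<close>)
qed

lemma Cc_sqint: "Cc f \<Longrightarrow> sqint lborel f"
  by (simp add: sqint_def Cc_measurable Cc_integrable Cc_power2)

lemma Cc_deriv: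
  assumes "\<And>x. (f has_real_derivative f' x) (at x)" "continuous_on UNIV f'" "Cc f"
  shows "Cc f'"
proof -
  from assms(3) obtain R where R: "\<And>x. R < \<bar>x\<bar> \<Longrightarrow> f x = 0"
    unfolding Cc_def by blast
  have "f' x = 0" if "R < \<bar>x\<bar>" for x
  proof -
    have "open {y. R < \<bar>y\<bar>}" by (intro open_Collect_less continuous_intros)
    then have "((\<lambda>x. 0) has_real_derivative f' x) (at x)"
      by (rule has_field_derivative_transform_within_open[OF assms(1)]) (use R that in auto)
    then show ?thesis using DERIV_unique DERIV_const by blast
  qed
  with assms(2) show ?thesis by (intro CcI[of _ R])
qed

lemma differentiable_imp_continuous_UNIV:
  assumes "\<And>x. (f has_real_derivative f' x) (at x)"
  shows "continuous_on UNIV f"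
  by (meson assms DERIV_isCont continuous_at_imp_continuous_on)

lemma integral_deriv_Cc:
  assumes d: "\<And>x. (f has_real_derivative f' x) (at x)" and "continuous_on UNIV f'" and Cc: "Cc f"
  shows "(LINT x|lborel. f' x) = 0"
proof -
  have Cc': "Cc f'" by (rule Cc_deriv[OF assms])
  from Cc Cc' obtain R S where R: "\<And>x. R < \<bar>x\<bar> \<Longrightarrow> f x = 0" and S: "\<And>x. S < \<bar>x\<bar> \<Longrightarrow> f' x = 0"
    unfolding Cc_def by blast
  define a where "a = \<bar>R\<bar> + \<bar>S\<bar> + 1"
  have "(LINT x|lborel. f' x) = (LINT x|lborel. f' x * indicator {-a..a} x)"
    by (rule Bochner_Integration.integral_cong)
       (auto simp: indicator_def a_def intro!: S)
  also have "\<dots> = f a - f (-a)"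
    by (rule integral_FTC_Icc_real)
       (use d in \<open>auto simp: a_def intro!: DERIV_subset continuous_on_interior
          continuous_on_subset[OF assms(2)] simp: continuous_on_eq_continuous_at[symmetric] has_real_derivative_iff_has_vector_derivative
          intro: continuous_on_interior[OF assms(2)]\<close>)
  also have "\<dots> = 0" using R[of a] R[of "-a"] by (simp add: a_def)
  finally show ?thesis .
qed

lemma integral_by_parts_Cc:
  assumes f: "\<And>x. (f has_real_derivative f' x) (at x)" and cf: "continuous_on UNIV f'"
    and g: "\<And>x. (g has_real_derivative g' x) (at x)" and cg: "continuous_on UNIV g'" and Cc: "Cc f"
  shows "(LINT x|lborel. f' x * g x) = - (LINT x|lborel. f x * g' x)"
proof -
  have c: "continuous_on UNIV f" "continuous_on UNIV g"
    using f g differentiable_imp_continuous_UNIV by blast+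
  have "(LINT x|lborel. f' x * g x + f x * g' x) = 0"
    by (rule integral_deriv_Cc[where f = "\<lambda>x. f x * g x"])
       (use c cf cg Cc f g in \<open>auto intro!: derivative_eq_intros continuous_intros Cc_mult\<close>)
  moreover have "integrable lborel (\<lambda>x. f' x * g x)" "integrable lborel (\<lambda>x. f x * g' x)"
    using c cg Cc Cc_deriv[OF f cf Cc] by (auto intro!: Cc_integrable Cc_mult)
  ultimately show ?thesis by simp
qed

lemma integral_shift_lborel: "(LINT x|lborel. f (x + c)) = (LINT x|lborel. f x)" for f :: "real \<Rightarrow> real"
  using lborel_integral_real_affine[of 1 f c] by (simp add: add.commute)

lemma l2_shift: "l2 lborel (\<lambda>x. f (x + c)) = l2 lborel f" for f :: "real \<Rightarrow> real"
  using integral_shift_lborel[of "\<lambda>x. (f x)\<^sup>2"] by (simp add: l2_def)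


section \<open>Test functions\<close>

text \<open>Beware of the index: \<open>differentiable_upto k f\<close> says that \<open>f\<close> is \<open>k + 1\<close> times differentiable.\<close>

primrec differentiable_upto :: "nat \<Rightarrow> (real \<Rightarrow> real) \<Rightarrow> bool" where
  "differentiable_upto 0 f = (\<forall>x. f field_differentiable at x)"
| "differentiable_upto (Suc k) f = ((\<forall>x. f field_differentiable at x) \<and> differentiable_upto k (deriv f))"

lemma differentiable_upto_iff: "differentiable_upto k f \<longleftrightarrow> (\<forall>j\<le>k. \<forall>x. (deriv ^^ j) f field_differentiable at x)"
proof (induction k arbitrary: f)
  case (Suc k)
  have "differentiable_upto (Suc k) f \<longleftrightarrow> (\<forall>x. f field_differentiable at x) \<and> (\<forall>j\<le>k. \<forall>x. (deriv ^^ Suc j) f field_differentiable at x)"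
    by (simp add: Suc funpow_Suc_right del: funpow.simps)
  also have "\<dots> \<longleftrightarrow> (\<forall>j\<le>Suc k. \<forall>x. (deriv ^^ j) f field_differentiable at x)"
    unfolding less_Suc_eq_le[symmetric] All_less_Suc2[of "Suc k"] by simp
  finally show ?case .
qed auto

abbreviation D :: "nat \<Rightarrow> (real \<Rightarrow> real) \<Rightarrow> real \<Rightarrow> real" where "D k \<equiv> deriv ^^ k"

lemma test_function_differentiable_upto: "test_function \<phi> \<longleftrightarrow> (\<forall>k. differentiable_upto k \<phi>) \<and>
     (\<exists>K. compact K \<and> K \<subseteq> {0<..<1} \<and> (\<forall>x. x \<notin> K \<longrightarrow> \<phi> x = 0))"
  unfolding test_function_def differentiable_upto_iff by auto

lemma test_D_has_derivative: "test_function \<phi> \<Longrightarrow> (D k \<phi> has_real_derivative D (Suc k) \<phi> x) (at x)"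
  unfolding test_function_def by (auto simp: DERIV_deriv_iff_field_differentiable)

lemma test_D_zero_compact:
  assumes "test_function \<phi>"
  shows "\<exists>K. compact K \<and> K \<subseteq> {0<..<1} \<and> (\<forall>x k. x \<notin> K \<longrightarrow> D k \<phi> x = 0)"
proof -
  from assms obtain K where K: "compact K" "K \<subseteq> {0<..<1}" "\<And>x. x \<notin> K \<Longrightarrow> \<phi> x = 0"
    unfolding test_function_def by blast
  have "D k \<phi> x = 0" if "x \<notin> K" for x k
    using that
  proof (induction k arbitrary: x)
    case (Suc k)
    have "((\<lambda>x. 0) has_real_derivative D (Suc k) \<phi> x) (at x)"
      by (rule has_field_derivative_transform_within_open[OF test_D_has_derivative[OF assms], where S = "-K"])
         (use Suc compact_imp_closed[OF K(1)] in auto)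
    then show ?case using DERIV_unique DERIV_const by blast
  qed (use K in auto)
  with K show ?thesis by blast
qed

lemma test_D_zero: "test_function \<phi> \<Longrightarrow> x \<notin> {0<..<1} \<Longrightarrow> D k \<phi> x = 0"
  using test_D_zero_compact by blast

lemma test_D_continuous: "test_function \<phi> \<Longrightarrow> continuous_on UNIV (D k \<phi>)"
  using test_D_has_derivative differentiable_imp_continuous_UNIV by blast

lemma test_D_Cc: "test_function \<phi> \<Longrightarrow> Cc (D k \<phi>)"
  by (rule CcI[of _ 1]) (auto intro: test_D_continuous test_D_zero)

lemma test_D_test:
  assumes "test_function \<phi>"
  shows "test_function (D k \<phi>)"
proof -
  have "D j (D k \<phi>) = D (j + k) \<phi>" for j by (simp add: funpow_add)
  with assms test_D_zero_compact[OF assms] show ?thesis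
    unfolding test_function_def by metis
qed

lemma D_diff:
  assumes "\<And>k x. D k f field_differentiable at x" "\<And>k x. D k g field_differentiable at x"
  shows "D k (\<lambda>x. f x - g x) = (\<lambda>x. D k f x - D k g x)"
proof (induction k)
  case (Suc k)
  have "deriv (D k (\<lambda>x. f x - g x)) x = deriv (D k f) x - deriv (D k g) x" for x
    unfolding Suc using assms by (intro deriv_diff)
  then show ?case by (simp add: fun_eq_iff)
qed simp

lemma test_D_diff: "test_function f \<Longrightarrow> test_function g \<Longrightarrow> D k (\<lambda>x. f x - g x) = (\<lambda>x. D k f x - D k g x)"
  by (rule D_diff) (auto simp: test_function_def)

lemma test_diff:
  assumes "test_function f" "test_function g"
  shows "test_function (\<lambda>x. f x - g x)"
proof -
  from assms obtain K L where K: "compact K" "K \<subseteq> {0<..<1}" "\<forall>x. x \<notin> K \<longrightarrow> f x = 0"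
      and L: "compact L" "L \<subseteq> {0<..<1}" "\<forall>x. x \<notin> L \<longrightarrow> g x = 0"
    unfolding test_function_def by blast
  then have "compact (K \<union> L)" "K \<union> L \<subseteq> {0<..<1}" "\<forall>x. x \<notin> K \<union> L \<longrightarrow> f x - g x = 0"
    by auto
  moreover have "D k (\<lambda>x. f x - g x) field_differentiable at x" for k x
    using assms unfolding test_D_diff[OF assms]
    by (intro field_differentiable_diff) (auto simp: test_function_def)
  ultimately show ?thesis unfolding test_function_def by blast
qed

lemma test_zero: "test_function (\<lambda>x. 0)"
proof -
  have "D k (\<lambda>x. 0) = (\<lambda>x. 0)" for k by (induction k) auto
  then show ?thesis unfolding test_function_def by auto
qed

lemma differentiable_upto_sum2:
  assumes "differentiable_upto k f" "differentiable_upto k g"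
  shows "differentiable_upto k (\<lambda>x. a * f x + b * g x)"
  using assms
proof (induction k arbitrary: f g)
  case (Suc k)
  have "deriv (\<lambda>x. a * f x + b * g x) = (\<lambda>x. a * deriv f x + b * deriv g x)"
    using Suc.prems
    by (intro ext DERIV_imp_deriv DERIV_add DERIV_cmult) (auto simp: field_differentiable_derivI)
  moreover have "(\<lambda>x. a * f x + b * g x) field_differentiable at x" for x
    using Suc.prems by (intro field_differentiable_add field_differentiable_mult) auto
  ultimately show ?case using Suc by simp
qed (auto intro!: field_differentiable_add field_differentiable_mult)

text \<open>The support stays away from 0, so near 0 the quotient is identically 0, also at 0 itself
  by the convention for division. The power n is general because differentiation yields a summand
  with n + 1, and the induction on the order has to absorb it.\<close>

lemma test_div_power:
  assumes "test_function \<phi>"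
  shows "test_function (\<lambda>x. \<phi> x / x ^ n)"
proof -
  have "differentiable_upto k (\<lambda>x. \<psi> x / x ^ n)" 
    and "test_function \<psi> \<Longrightarrow> ((\<lambda>x. \<psi> x / x ^ n) has_real_derivative deriv \<psi> x / x ^ n - real n * (\<psi> x / x ^ Suc n)) (at x)"
    if "test_function \<psi>" for k n \<psi> x
  proof -
    show d: "((\<lambda>x. \<psi> x / x ^ n) has_real_derivative deriv \<psi> x / x ^ n - real n * (\<psi> x / x ^ Suc n)) (at x)"
      if t: "test_function \<psi>" for \<psi> n x
    proof (cases "x \<in> {0<..<1}")
      case True
      have "(\<psi> has_real_derivative deriv \<psi> x) (at x)"
        using test_D_has_derivative[OF t, of 0] by simp
      then show ?thesis using True
        apply (auto intro!: derivative_eq_intros)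
        apply (cases n; simp add: field_simps power2_eq_square)
        done
    next
      case False
      from t obtain K where K: "compact K" "K \<subseteq> {0<..<1}" "\<And>x. x \<notin> K \<Longrightarrow> \<psi> x = 0"
        unfolding test_function_def by blast
      have "((\<lambda>x. \<psi> x / x ^ n) has_real_derivative 0) (at x)"
        by (rule has_field_derivative_transform_within_open[OF DERIV_const[of 0], where S = "-K"])
           (use False compact_imp_closed[OF K(1)] K in auto)
      then show ?thesis using test_D_zero[OF t False, of 0] test_D_zero[OF t False, of 1] by simp
    qed
    show "differentiable_upto k (\<lambda>x. \<psi> x / x ^ n)" using that
    proof (induction k arbitrary: \<psi> n)
      case 0
      then show ?case using d[OF 0] by (auto simp: field_differentiable_def)
    next
      case (Suc k)
      have "deriv (\<lambda>x. \<psi> x / x ^ n) = (\<lambda>x. 1 * (D 1 \<psi> x / x ^ n) + (- real n) * (\<psi> x / x ^ Suc n))"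
        using DERIV_imp_deriv[OF d[OF Suc.prems]] by (auto simp: fun_eq_iff)
      moreover have "differentiable_upto k (\<lambda>x. 1 * (D 1 \<psi> x / x ^ n) + (- real n) * (\<psi> x / x ^ Suc n))"
        by (intro differentiable_upto_sum2 Suc.IH test_D_test Suc.prems)
      ultimately show ?case using d[OF Suc.prems] by (auto simp: field_differentiable_def)
    qed
  qed
  moreover from assms obtain K where "compact K" "K \<subseteq> {0<..<1}" "\<And>x. x \<notin> K \<Longrightarrow> \<phi> x = 0"
    unfolding test_function_def by blast
  ultimately show ?thesis using assms unfolding test_function_differentiable_upto[of "\<lambda>x. \<phi> x / x ^ n"]
    by (metis div_0)
qed

section \<open>Smooth bumps approximating indicators of intervals\<close>

lemma power_exp_bound:
  fixes y :: real assumes "0 < y"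
  shows "exp (- 1 / y) / y ^ n \<le> real n ^ n"
proof (cases "n = 0")
  case False
  \<comment> \<open>This is z \<le> exp z at z = 1 / (n y), raised to the n-th power; hence the
    constant n ^ n.\<close>
  have "(1 / y / real n) ^ n \<le> exp (1 / y / real n) ^ n"
  proof (rule power_mono)
    have "1 / y / real n \<le> 1 + 1 / y / real n" by simp
    also have "\<dots> \<le> exp (1 / y / real n)" by (rule exp_ge_add_one_self)
    finally show "1 / y / real n \<le> exp (1 / y / real n)" .
  qed (use assms in simp)
  also have "\<dots> = exp (1 / y)"
    using False by (simp flip: exp_of_nat_mult)
  finally have "real n ^ n * (1 / y / real n) ^ n \<le> real n ^ n * exp (1 / y)"
    by (intro mult_left_mono) auto
  then have "(1 / y) ^ n \<le> real n ^ n * exp (1 / y)"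
    using False by (simp flip: power_mult_distrib)
  then have "(1 / y) ^ n * exp (- 1 / y) \<le> real n ^ n * exp (1 / y) * exp (- 1 / y)"
    by (intro mult_right_mono) auto
  then show ?thesis by (simp add: power_divide field_simps flip: exp_add)
qed (use assms in auto)

text \<open>The smooth bump functions are the case \<open>p = 1\<close>, \<open>k = 0\<close>; this larger family is closed under
  differentiation.\<close>

definition bump :: "real poly \<Rightarrow> real poly \<Rightarrow> nat \<Rightarrow> real \<Rightarrow> real" where
  "bump q p k x = (if 0 < poly q x then poly p x / poly q x ^ k * exp (- 1 / poly q x) else 0)"

text \<open>Where q is positive this is the quotient rule over the common denominator
  \<open>q ^ (k + 2)\<close>, and where q is negative everything is 0. Only the zeros of q need an
  estimate, because the exponential has to beat the denominator there.\<close>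

lemma bump_has_derivative:
  "(bump q p k has_real_derivative
      bump q (pderiv p * q\<^sup>2 - smult (real k) (p * pderiv q * q) + p * pderiv q) (k + 2) x) (at x)"
proof -
  consider "0 < poly q x" | "poly q x < 0" | "poly q x = 0" by linarith
  then show ?thesis
  proof cases
    case 1
    have "((\<lambda>x. poly p x / poly q x ^ k * exp (- 1 / poly q x)) has_real_derivative
       bump q (pderiv p * q\<^sup>2 - smult (real k) (p * pderiv q * q) + p * pderiv q) (k + 2) x) (at x)"
      using 1 unfolding bump_def
      apply (auto intro!: derivative_eq_intros)
      apply (cases k; simp add: field_simps power2_eq_square)
      done
    then show ?thesis
      by (rule has_field_derivative_transform_within_open[of _ _ _ "{x. 0 < poly q x}"])
         (use 1 in \<open>auto simp: bump_def intro!: open_Collect_less continuous_intros\<close>)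
  next
    case 2
    have "((\<lambda>x. 0) has_real_derivative
       bump q (pderiv p * q\<^sup>2 - smult (real k) (p * pderiv q * q) + p * pderiv q) (k + 2) x) (at x)"
      using 2 unfolding bump_def by auto
    then show ?thesis
      by (rule has_field_derivative_transform_within_open[of _ _ _ "{x. poly q x < 0}"])
         (use 2 in \<open>auto simp: bump_def intro!: open_Collect_less continuous_intros\<close>)
  next
    case 3
    \<comment> \<open>The bound for the exponential is used with two powers more than the
      denominator has. The surplus factor \<open>q\<^sup>2\<close> has derivative 0 at a zero of q
      and forces the same on the bump.\<close>
    let ?C = "real (k + 2) ^ (k + 2)"
    have b: "\<bar>bump q p k y\<bar> \<le> \<bar>poly p y * ?C * (poly q y)\<^sup>2\<bar>" for y
    proof (cases "0 < poly q y")
      case True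
      have "exp (- 1 / poly q y) / poly q y ^ k = exp (- 1 / poly q y) / poly q y ^ (k + 2) * (poly q y)\<^sup>2"
        using True by (simp add: field_simps power_add power2_eq_square)
      also have "\<dots> \<le> ?C * (poly q y)\<^sup>2"
        by (intro mult_right_mono power_exp_bound True) auto
      finally have "\<bar>poly p y\<bar> * (exp (- 1 / poly q y) / poly q y ^ k) \<le> \<bar>poly p y\<bar> * (?C * (poly q y)\<^sup>2)"
        by (intro mult_left_mono) auto
      then show ?thesis using True by (simp add: bump_def abs_mult mult_ac)
    qed (auto simp: bump_def)
    have "((\<lambda>y. poly p y * ?C * (poly q y)\<^sup>2) has_real_derivative 0) (at x)"
      using 3 by (auto intro!: derivative_eq_intros)
    then have lim: "((\<lambda>y. poly p y * ?C * (poly q y)\<^sup>2 / (y - x)) \<longlongrightarrow> 0) (at x)"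
      using 3 by (simp add: has_field_derivative_iff)
    have "((\<lambda>y. bump q p k y / (y - x)) \<longlongrightarrow> 0) (at x)"
    proof (rule Lim_null_comparison[OF always_eventually tendsto_rabs_zero[OF lim]], intro allI)
      show "norm (bump q p k y / (y - x)) \<le> \<bar>poly p y * ?C * (poly q y)\<^sup>2 / (y - x)\<bar>" for y
        using divide_right_mono[OF b, of "\<bar>y - x\<bar>" y] by (simp add: abs_divide)
    qed
    then have "(bump q p k has_real_derivative 0) (at x)"
      using 3 by (simp add: has_field_derivative_iff bump_def)
    then show ?thesis using 3 by (simp add: bump_def)
  qed
qed

lemma differentiable_upto_bump: "differentiable_upto n (bump q p k)"
proof (induction n arbitrary: p k)
  case 0
  show ?case unfolding differentiable_upto.simps field_differentiable_def using bump_has_derivative by blast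
next
  case (Suc n)
  have "deriv (bump q p k) = bump q (pderiv p * q\<^sup>2 - smult (real k) (p * pderiv q * q) + p * pderiv q) (k + 2)"
    using DERIV_imp_deriv[OF bump_has_derivative] by blast
  then show ?case
    unfolding differentiable_upto.simps field_differentiable_def using Suc bump_has_derivative by metis
qed

text \<open>The bump exp (-1 / q) tends to 1 wherever q tends to infinity, so q is n times a
  parabola that is positive on a slightly shrunken interval. The margin \<open>e n\<close> tends to
  0 and keeps the support a compact subset of (0,1) even for a = 0 or b = 1.\<close>

lemma test_functions_to_indicator:
  fixes a b :: real
  assumes "0 \<le> a" "a < b" "b \<le> 1"
  shows "\<exists>\<phi>. (\<forall>n::nat. test_function (\<phi> n)) \<and> (\<forall>n x. \<bar>\<phi> n x\<bar> \<le> 1) \<and>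
           (\<forall>x. (\<lambda>n. \<phi> n x) \<longlonglongrightarrow> indicator {a<..<b} x)"
proof -
  obtain N :: nat where N: "2 / (b - a) < real N" using reals_Archimedean2 by blast
  then have "0 < real N" using assms by (smt (verit) divide_nonneg_pos)
  define e where "e n = 1 / real (n + N)" for n
  have e: "0 < e n" for n using \<open>0 < real N\<close> by (simp add: e_def)
  have e2: "2 * e n < b - a" for n
  proof -
    have "2 < (b - a) * real N" using N assms by (simp add: field_simps)
    also have "\<dots> \<le> (b - a) * real (n + N)" using assms by (intro mult_left_mono) auto
    finally show ?thesis using \<open>0 < real N\<close> assms by (simp add: e_def field_simps)
  qed
  define q where "q n = smult (real n) ([:- (a + e n), 1:] * [:b - e n, -1:])" for n
  have q: "poly (q n) x = real n * (x - (a + e n)) * (b - e n - x)" for n x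
    by (simp add: q_def algebra_simps)
  define \<phi> where "\<phi> n = bump (q n) 1 0" for n
  have zero: "\<phi> n x = 0" if "x \<notin> {a + e n..b - e n}" for n x
  proof -
    have "(x - (a + e n)) * (b - e n - x) \<le> 0"
      using that e2[of n] by (auto simp: mult_le_0_iff)
    then have "\<not> 0 < poly (q n) x" unfolding q mult.assoc
      using mult_nonneg_nonpos[of "real n"] by (meson not_less of_nat_0_le_iff)
    then show ?thesis by (simp add: \<phi>_def bump_def)
  qed
  have "test_function (\<phi> n)" for n
    unfolding test_function_differentiable_upto
    by (intro conjI allI exI[of _ "{a + e n..b - e n}"])
       (use zero e[of n] assms in \<open>auto simp: \<phi>_def differentiable_upto_bump\<close>)
  moreover have "\<bar>\<phi> n x\<bar> \<le> 1" for n x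
    by (auto simp: \<phi>_def bump_def)
  moreover have "(\<lambda>n. \<phi> n x) \<longlonglongrightarrow> indicator {a<..<b} x" for x
  proof (cases "x \<in> {a<..<b}")
    case True
    have e0: "e \<longlonglongrightarrow> 0"
      unfolding e_def using LIMSEQ_ignore_initial_segment[OF lim_1_over_n] by simp
    have "(\<lambda>n. (x - (a + e n)) * (b - e n - x)) \<longlonglongrightarrow> (x - (a + 0)) * (b - 0 - x)"
      by (intro tendsto_intros e0)
    then have "filterlim (\<lambda>n. (x - (a + e n)) * (b - e n - x) * real n) at_top sequentially"
      by (rule filterlim_tendsto_pos_mult_at_top)
         (use True in \<open>auto intro: filterlim_real_sequentially\<close>)
    then have t: "filterlim (\<lambda>n. poly (q n) x) at_top sequentially"
      by (simp add: q mult_ac)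
    then have "(\<lambda>n. exp (- inverse (poly (q n) x))) \<longlonglongrightarrow> exp (- 0)"
      by (intro tendsto_intros tendsto_inverse_0_at_top)
    moreover have "\<forall>\<^sub>F n in sequentially. 0 < poly (q n) x"
      using t by (simp add: filterlim_at_top_dense)
    then have "\<forall>\<^sub>F n in sequentially. exp (- inverse (poly (q n) x)) = \<phi> n x"
      by eventually_elim (simp add: \<phi>_def bump_def divide_inverse)
    ultimately show ?thesis using True by (auto intro: Lim_transform_eventually)
  next
    case False
    then have "\<phi> n x = 0" for n by (intro zero) (use e[of n] in auto)
    then show ?thesis using False by simp
  qed
  ultimately show ?thesis by blast
qed

section \<open>Sobolev functions\<close>

lemma L2_space_iff: "f \<in> L2_space \<longleftrightarrow> sqint unit_measure f"
  by (auto simp: L2_space_def sqint_def)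

lemma unit_measure_total: "emeasure unit_measure {0<..<1} = 1"
  by (simp add: emeasure_restrict_space)

lemma finite_unit_measure: "finite_measure unit_measure"
  by (rule finite_measureI) (simp add: unit_measure_total)

lemma measure_unit_measure: "measure unit_measure {0<..<1} = 1"
  by (simp add: measure_def unit_measure_total)

lemma measurable_unit_measure: "f \<in> borel_measurable borel \<Longrightarrow> f \<in> borel_measurable unit_measure"
  for f :: "real \<Rightarrow> real"
  by (intro measurable_restrict_space1 measurable_completion) simp

lemma sqint_unit_bounded:
  assumes "f \<in> borel_measurable unit_measure" "\<And>x. x \<in> {0<..<1} \<Longrightarrow> \<bar>f x\<bar> \<le> B"
  shows "sqint unit_measure f"
proof -
  interpret finite_measure unit_measure by (rule finite_unit_measure)
  have "(f x)\<^sup>2 \<le> B\<^sup>2" if "x \<in> {0<..<1}" for x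
    using power_mono[OF assms(2)[OF that], of 2] by simp
  then have "integrable unit_measure (\<lambda>x. (f x)\<^sup>2)"
    using assms(1) by (intro integrable_const_bound[of _ "B\<^sup>2"]) auto
  with assms(1) show ?thesis by (simp add: sqint_def)
qed

lemma l2_unit_bounded:
  assumes "f \<in> borel_measurable unit_measure" "\<And>x. x \<in> {0<..<1} \<Longrightarrow> \<bar>f x\<bar> \<le> B" "0 \<le> B"
  shows "l2 unit_measure f \<le> B"
proof -
  interpret finite_measure unit_measure by (rule finite_unit_measure)
  have "(f x)\<^sup>2 \<le> B\<^sup>2" if "x \<in> {0<..<1}" for x
    using power_mono[OF assms(2)[OF that], of 2] by simp
  then have "(LINT x|unit_measure. (f x)\<^sup>2) \<le> (LINT x|unit_measure. B\<^sup>2)"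
    using sqint_unit_bounded[OF assms(1,2)] unfolding sqint_def
    by (intro integral_mono) auto
  also have "\<dots> = B\<^sup>2" by (simp add: measure_unit_measure)
  finally show ?thesis using assms(3) unfolding l2_def by (intro real_le_lsqrt)
qed

lemma integral_unit_measure:
  fixes f :: "real \<Rightarrow> real"
  assumes "f \<in> borel_measurable borel" "\<And>x. x \<notin> {0<..<1} \<Longrightarrow> f x = 0"
  shows "(LINT x|unit_measure. f x) = (LINT x|lborel. f x)"
proof -
  have "(LINT x|unit_measure. f x) = (LINT x|lebesgue. indicator {0<..<1} x *\<^sub>R f x)"
    by (rule integral_restrict_space) simp
  also have "(\<lambda>x. indicator {0<..<1} x *\<^sub>R f x) = f"
    using assms(2) by (force simp: indicator_def)
  also have "(LINT x|lebesgue. f x) = (LINT x|lborel. f x)"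
    using assms(1) by (intro integral_completion) simp
  finally show ?thesis .
qed

text \<open>Half-lines are closed under intersection and generate the Borel sets, so the vanishing
  of the integral spreads to all Borel sets by Dynkin's argument. Complements need the total
  integral, which is the limit over growing half-lines.\<close>

lemma AE_zero_if_tail_integrals_zero:
  fixes g :: "real \<Rightarrow> real"
  assumes g: "integrable lborel g" and z: "\<And>a. (LINT x:{a<..}|lborel. g x) = 0"
  shows "AE x in lborel. g x = 0"
proof (rule sigma_finite_measure.density_zero[OF sigma_finite_lborel g])
  have int: "set_integrable lborel A g" if "A \<in> sets borel" for A
    using that g integrable_mult_indicator[of A lborel g] by (simp add: set_integrable_def)
  have "(\<lambda>n. LINT x:{- real n<..}|lborel. g x) \<longlonglongrightarrow> (LINT x|lborel. g x)"
    unfolding set_lebesgue_integral_def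
  proof (rule integral_dominated_convergence[where w = "\<lambda>x. \<bar>g x\<bar>"])
    show "AE x in lborel. (\<lambda>n. indicat_real {- real n<..} x *\<^sub>R g x) \<longlonglongrightarrow> g x"
    proof (rule AE_I2)
      fix x
      obtain N :: nat where "- x < real N" using reals_Archimedean2 by blast
      then have "\<forall>\<^sub>F n in sequentially. indicat_real {- real n<..} x *\<^sub>R g x = g x"
        by (intro eventually_sequentiallyI[of N]) (auto simp: indicator_def)
      then show "(\<lambda>n. indicat_real {- real n<..} x *\<^sub>R g x) \<longlonglongrightarrow> g x"
        by (rule tendsto_eventually)
    qed
  qed (use g in \<open>auto simp: indicator_def\<close>)
  then have total: "(LINT x|lborel. g x) = 0"
    unfolding z using LIMSEQ_unique tendsto_const by metis
  have sets: "sets (borel :: real measure) = sigma_sets UNIV (range greaterThan)"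
    by (subst borel_Ioi) simp
  fix A :: "real set" assume "A \<in> sets lborel"
  then have "A \<in> sigma_sets UNIV (range greaterThan)"
    by (simp add: sets)
  then show "(LINT x:A|lborel. g x) = 0"
  proof (induction rule: sigma_sets_induct_disjoint[rotated 2, consumes 1, case_names basic empty compl union stable Pow])
    case (compl A)
    then have A: "A \<in> sets borel" by (simp add: sets)
    have "(LINT x:UNIV - A|lborel. g x) = (LINT x|lborel. g x - indicator A x *\<^sub>R g x)"
      unfolding set_lebesgue_integral_def
      by (rule Bochner_Integration.integral_cong) (auto simp: indicator_def)
    also have "\<dots> = 0"
      using int[OF A] g total compl by (simp add: set_integrable_def set_lebesgue_integral_def)
    finally show ?case .
  next
    case (union A)
    then have A: "A i \<in> sets borel" for i by (auto simp: sets)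
    have "(LINT x:(\<Union>i. A i)|lborel. g x) = (\<Sum>i. LINT x:(A i)|lborel. g x)"
      using A union(1) by (intro lebesgue_integral_countable_add int) (auto simp: disjoint_family_on_def)
    then show ?case using union by simp
  next
    case stable
    have "{a<..} \<inter> {b<..} = {max a b<..}" for a b :: real by auto
    then show ?case by (auto simp: Int_stable_def)
  qed (use z in \<open>auto simp: set_lebesgue_integral_def\<close>)
qed

text \<open>Bounded convergence of test functions to indicators makes every tail integral of g
  vanish. Since that criterion lives on the Borel measure, g is first extended by zero and replaced
  by a Borel function h that agrees with it almost everywhere.\<close>

lemma fundamental_lemma:
  assumes g: "sqint unit_measure g"
    and z: "\<And>\<phi>. test_function \<phi> \<Longrightarrow> (LINT x|unit_measure. g x * \<phi> x) = 0"
  shows "AE x in unit_measure. g x = 0"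
proof -
  let ?g = "\<lambda>x. indicat_real {0<..<1} x *\<^sub>R g x"
  interpret finite_measure unit_measure by (rule finite_unit_measure)
  have "integrable unit_measure (\<lambda>x. g x * 1)"
    by (rule sqint_mult_integrable[OF g]) (simp add: sqint_def)
  then have gi: "integrable unit_measure g" by simp
  then have "integrable lebesgue ?g"
    by (subst (asm) integrable_restrict_space) auto
  moreover obtain h where h: "h \<in> borel_measurable lborel" "AE x in lborel. ?g x = h x"
    using completion_ex_borel_measurable_real[OF borel_measurable_integrable[OF \<open>integrable lebesgue ?g\<close>]] by blast
  then have h': "AE x in lebesgue. ?g x = h x" by (intro AE_completion)
  have hm: "h \<in> borel_measurable lebesgue" using h by (intro measurable_completion)
  ultimately have "integrable lebesgue h"
    using integrable_cong_AE[OF borel_measurable_integrable hm h'] by blast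
  then have hi: "integrable lborel h" using h by (simp add: integrable_completion)
  have tail: "(LINT x:A|lborel. h x) = (LINT x|unit_measure. g x * indicator A x)" if A: "A \<in> sets borel" for A
  proof -
    have "(LINT x:A|lborel. h x) = (LINT x|lebesgue. indicator A x *\<^sub>R h x)"
      unfolding set_lebesgue_integral_def using h A
      by (intro integral_completion[symmetric]) simp
    also have "\<dots> = (LINT x|lebesgue. indicator A x *\<^sub>R ?g x)"
    proof (rule integral_cong_AE)
      show "AE x in lebesgue. indicat_real A x *\<^sub>R h x = indicator A x *\<^sub>R ?g x"
        using h' by eventually_elim simp
      show "(\<lambda>x. indicat_real A x *\<^sub>R h x) \<in> borel_measurable lebesgue"
        using hm A by (intro borel_measurable_scaleR borel_measurable_indicator) auto
      show "(\<lambda>x. indicat_real A x *\<^sub>R ?g x) \<in> borel_measurable lebesgue"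
        by (intro borel_measurable_scaleR borel_measurable_indicator
              borel_measurable_integrable[OF \<open>integrable lebesgue ?g\<close>]) (use A in simp)
    qed
    also have "\<dots> = (LINT x|lebesgue. indicator {0<..<1} x *\<^sub>R (g x * indicator A x))"
      by (intro Bochner_Integration.integral_cong) auto
    also have "\<dots> = (LINT x|unit_measure. g x * indicator A x)"
      by (rule integral_restrict_space[symmetric]) simp
    finally show ?thesis .
  qed
  have "AE x in lborel. h x = 0"
  proof (rule AE_zero_if_tail_integrals_zero[OF hi])
    fix a :: real
    show "(LINT x:{a<..}|lborel. h x) = 0"
    proof (cases "a < 1")
      case True
      obtain \<phi> :: "nat \<Rightarrow> real \<Rightarrow> real" where \<phi>: "\<And>n. test_function (\<phi> n)" "\<And>n x. \<bar>\<phi> n x\<bar> \<le> 1"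
          "\<And>x. (\<lambda>n. \<phi> n x) \<longlonglongrightarrow> indicator {max a 0<..<1} x"
        using test_functions_to_indicator[of "max a 0" 1] True by auto
      have "(\<lambda>n. LINT x|unit_measure. g x * \<phi> n x) \<longlonglongrightarrow> (LINT x|unit_measure. g x * indicator {max a 0<..<1} x)"
      proof (rule integral_dominated_convergence[where w = "\<lambda>x. \<bar>g x\<bar>"])
        show "AE x in unit_measure. (\<lambda>n. g x * \<phi> n x) \<longlonglongrightarrow> g x * indicator {max a 0<..<1} x"
          using \<phi>(3) by (intro AE_I2 tendsto_intros)
        show "(\<lambda>x. g x * \<phi> n x) \<in> borel_measurable unit_measure" for n
          using measurable_unit_measure[OF Cc_measurable[OF test_D_Cc[OF \<phi>(1), of 0]]]
          by (intro borel_measurable_times borel_measurable_integrable[OF gi]) simp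
        show "(\<lambda>x. g x * indicator {max a 0<..<1} x) \<in> borel_measurable unit_measure"
          by (intro borel_measurable_times borel_measurable_integrable[OF gi] measurable_unit_measure borel_measurable_indicator) auto
        show "AE x in unit_measure. norm (g x * \<phi> n x) \<le> \<bar>g x\<bar>" for n
          using \<phi>(2) by (auto simp: abs_mult intro!: mult_left_le)
      qed (use gi in auto)
      then have "(\<lambda>n. 0) \<longlonglongrightarrow> (LINT x|unit_measure. g x * indicator {max a 0<..<1} x)"
        by (simp only: z[OF \<phi>(1)])
      then have "(LINT x|unit_measure. g x * indicator {max a 0<..<1} x) = 0"
        by (simp only: tendsto_const_iff[OF sequentially_bot])
      also have "(LINT x|unit_measure. g x * indicator {max a 0<..<1} x) = (LINT x|unit_measure. g x * indicator {a<..} x)"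
        by (rule Bochner_Integration.integral_cong) (auto simp: indicator_def)
      finally show ?thesis by (simp add: tail)
    next
      case False
      then have "(LINT x|unit_measure. g x * indicator {a<..} x) = (LINT x|unit_measure. 0)"
        by (intro Bochner_Integration.integral_cong) (auto simp: indicator_def)
      then show ?thesis by (simp add: tail)
    qed
  qed
  with h have "AE x in lborel. ?g x = 0" by auto
  then have "AE x in lebesgue. ?g x = 0" by (rule AE_completion)
  then have "AE x in lebesgue. x \<in> {0<..<1} \<longrightarrow> g x = 0"
    by (rule eventually_mono) (simp add: indicator_def split: if_splits)
  then show ?thesis by (subst AE_restrict_space_iff) auto
qed

lemma sqint_unit_test: "test_function \<phi> \<Longrightarrow> sqint unit_measure (D k \<phi>)"
proof -
  assume t: "test_function \<phi>"
  have "bounded (D k \<phi> ` {0..1})"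
    by (intro compact_imp_bounded compact_continuous_image continuous_on_subset[OF test_D_continuous[OF t]]) auto
  then obtain B where B: "\<forall>y\<in>D k \<phi> ` {0..1}. norm y \<le> B" unfolding bounded_iff by blast
  have "\<bar>D k \<phi> x\<bar> \<le> B" if "x \<in> {0<..<1}" for x
    using B that by force
  then show ?thesis
    by (intro sqint_unit_bounded[of _ B] measurable_unit_measure Cc_measurable test_D_Cc t) auto
qed

lemma l2_unit_test: "test_function \<phi> \<Longrightarrow> l2 unit_measure (D k \<phi>) = l2 lborel (D k \<phi>)"
  unfolding l2_def
  by (subst integral_unit_measure) (auto simp: test_D_zero intro!: Cc_measurable Cc_power2 test_D_Cc)

lemma weak_deriv_unique:
  assumes g: "sqint unit_measure g" "sqint unit_measure h" 
    and w: "has_weak_deriv k f g" "has_weak_deriv k f h"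
  shows "AE x in unit_measure. g x = h x"
proof -
  have "AE x in unit_measure. g x - h x = 0"
  proof (rule fundamental_lemma)
    fix \<phi> assume t: "test_function \<phi>"
    have i: "integrable unit_measure (\<lambda>x. g x * \<phi> x)" "integrable unit_measure (\<lambda>x. h x * \<phi> x)"
      using g sqint_unit_test[OF t, of 0] by (auto intro!: sqint_mult_integrable)
    have "(-1) ^ k * (LINT x|unit_measure. g x * \<phi> x) = (-1::real) ^ k * (LINT x|unit_measure. h x * \<phi> x)"
      using w[unfolded has_weak_deriv_def, rule_format, OF t] by (simp only:)
    then have "(LINT x|unit_measure. g x * \<phi> x) = (LINT x|unit_measure. h x * \<phi> x)"
      by simp
    then show "(LINT x|unit_measure. (g x - h x) * \<phi> x) = 0"
      unfolding left_diff_distrib Bochner_Integration.integral_diff[OF i] by simp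
  qed (use g in \<open>auto intro: sqint_diff\<close>)
  then show ?thesis by simp
qed

lemma has_weak_deriv_diff:
  assumes "sqint unit_measure f" "sqint unit_measure f'" "sqint unit_measure g" "sqint unit_measure g'"
    and "has_weak_deriv k f g" "has_weak_deriv k f' g'"
  shows "has_weak_deriv k (\<lambda>x. f x - f' x) (\<lambda>x. g x - g' x)"
  unfolding has_weak_deriv_def
proof (intro allI impI)
  fix \<phi> assume t: "test_function \<phi>"
  have lin: "(LINT x|unit_measure. (u x - v x) * D j \<phi> x)
      = (LINT x|unit_measure. u x * D j \<phi> x) - (LINT x|unit_measure. v x * D j \<phi> x)"
    if "sqint unit_measure u" "sqint unit_measure v" for u v j
    unfolding left_diff_distrib
    by (intro Bochner_Integration.integral_diff sqint_mult_integrable sqint_unit_test t that)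
  have "(LINT x|unit_measure. (f x - f' x) * D k \<phi> x)
      = (LINT x|unit_measure. f x * D k \<phi> x) - (LINT x|unit_measure. f' x * D k \<phi> x)"
    by (intro lin assms)
  also have "\<dots> = (-1) ^ k * (LINT x|unit_measure. g x * \<phi> x) - (-1) ^ k * (LINT x|unit_measure. g' x * \<phi> x)"
    using assms(5,6)[unfolded has_weak_deriv_def, rule_format, OF t] by (simp only:)
  also have "\<dots> = (-1) ^ k * ((LINT x|unit_measure. g x * \<phi> x) - (LINT x|unit_measure. g' x * \<phi> x))"
    by (simp only: right_diff_distrib)
  also have "\<dots> = (-1) ^ k * (LINT x|unit_measure. (g x - g' x) * \<phi> x)"
    using lin[of g g' 0] assms by simp
  finally show "(LINT x|unit_measure. (f x - f' x) * D k \<phi> x) = (-1) ^ k * (LINT x|unit_measure. (g x - g' x) * \<phi> x)" .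
qed

lemma test_integral_by_parts:
  "test_function \<phi> \<Longrightarrow> test_function \<psi> \<Longrightarrow>
    (LINT x|lborel. \<phi> x * D k \<psi> x) = (-1) ^ k * (LINT x|lborel. D k \<phi> x * \<psi> x)"
proof (induction k arbitrary: \<phi>)
  case (Suc k)
  have "(LINT x|lborel. \<phi> x * D (Suc k) \<psi> x) = - (LINT x|lborel. D 1 \<phi> x * D k \<psi> x)"
    using integral_by_parts_Cc[where f = \<phi> and g = "D k \<psi>" and f' = "D 1 \<phi>" and g' = "D (Suc k) \<psi>"]
      test_D_has_derivative[OF Suc.prems(1), of 0] test_D_has_derivative[OF Suc.prems(2)]
      test_D_continuous[OF Suc.prems(1), of 1] test_D_continuous[OF Suc.prems(2), of "Suc k"]
      test_D_Cc[OF Suc.prems(1), of 0] by simp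
  also have "\<dots> = - ((-1) ^ k * (LINT x|lborel. D k (D 1 \<phi>) x * \<psi> x))"
    by (subst Suc.IH) (auto intro!: test_D_test[of _ 1, simplified] Suc.prems)
  also have "D k (D 1 \<phi>) = D (Suc k) \<phi>" by (simp add: funpow_swap1)
  finally show ?case by simp
qed simp

lemma has_weak_deriv_test:
  assumes "test_function \<phi>"
  shows "has_weak_deriv k \<phi> (D k \<phi>)"
  unfolding has_weak_deriv_def
proof (intro allI impI)
  fix \<psi> assume t: "test_function \<psi>"
  have m: "(\<lambda>x. D i \<phi> x * D j \<psi> x) \<in> borel_measurable borel" for i j
    using Cc_measurable[OF test_D_Cc[OF assms]] Cc_measurable[OF test_D_Cc[OF t]] by auto
  have "(LINT x|unit_measure. D i \<phi> x * D j \<psi> x) = (LINT x|lborel. D i \<phi> x * D j \<psi> x)" for i j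
    by (rule integral_unit_measure[OF m]) (simp add: test_D_zero[OF assms])
  from this[of 0 k] this[of k 0] show "(LINT x|unit_measure. \<phi> x * D k \<psi> x) = (-1) ^ k * (LINT x|unit_measure. D k \<phi> x * \<psi> x)"
    using test_integral_by_parts[OF assms t] by simp
qed

section \<open>The norms of the individual weak derivatives\<close>

lemma weak_deriv_properties:
  assumes "f \<in> sobolev m" "k \<le> m"
  shows "sqint unit_measure (weak_deriv k f)" "has_weak_deriv k f (weak_deriv k f)"
proof -
  have "\<exists>g. g \<in> L2_space \<and> has_weak_deriv k f g"
    using assms unfolding sobolev_def by blast
  then have "weak_deriv k f \<in> L2_space \<and> has_weak_deriv k f (weak_deriv k f)"
    unfolding weak_deriv_def by (rule someI_ex)
  then show "sqint unit_measure (weak_deriv k f)" "has_weak_deriv k f (weak_deriv k f)"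
    by (auto simp: L2_space_iff)
qed

lemma weak_deriv_eq_AE:
  assumes "sqint unit_measure g" "has_weak_deriv k f g"
  shows "AE x in unit_measure. weak_deriv k f x = g x" "sqint unit_measure (weak_deriv k f)"
proof -
  have "\<exists>g. g \<in> L2_space \<and> has_weak_deriv k f g"
    using assms by (auto simp: L2_space_iff)
  then have *: "weak_deriv k f \<in> L2_space \<and> has_weak_deriv k f (weak_deriv k f)"
    unfolding weak_deriv_def by (rule someI_ex)
  then show "AE x in unit_measure. weak_deriv k f x = g x"
    using assms by (intro weak_deriv_unique[of _ _ k f]) (auto simp: L2_space_iff)
  show "sqint unit_measure (weak_deriv k f)" using * by (simp add: L2_space_iff)
qed

text \<open>The energy estimate treats the orders one at a time. For continuous representatives in
  the closure of the test functions these norms increase with k, so the top one controls the Sobolev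
  norm.\<close>

definition weak_norm :: "nat \<Rightarrow> (real \<Rightarrow> real) \<Rightarrow> real" where
  "weak_norm k f = l2 unit_measure (weak_deriv k f)"

lemma weak_norm_nonneg [simp]: "0 \<le> weak_norm k f"
  by (simp add: weak_norm_def)

lemma weak_norm_eqI:
  assumes "sqint unit_measure g" "has_weak_deriv k f g"
  shows "weak_norm k f = l2 unit_measure g"
  unfolding weak_norm_def using assms weak_deriv_eq_AE[OF assms]
  by (intro l2_cong_AE) (auto simp: sqint_def)

lemma sobolev_norm_weak_norm: "sobolev_norm m f = sqrt (\<Sum>k\<le>m. (weak_norm k f)\<^sup>2)"
  by (simp add: sobolev_norm_def weak_norm_def l2_square)

lemma weak_norm_le_sobolev_norm:
  assumes "k \<le> m"
  shows "weak_norm k f \<le> sobolev_norm m f"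
proof -
  have "(weak_norm k f)\<^sup>2 \<le> (\<Sum>k\<le>m. (weak_norm k f)\<^sup>2)"
    by (rule member_le_sum) (use assms in auto)
  then show ?thesis unfolding sobolev_norm_weak_norm by (rule real_le_rsqrt)
qed

lemma sobolev_norm_le_sum: "sobolev_norm m f \<le> (\<Sum>k\<le>m. weak_norm k f)"
  unfolding sobolev_norm_weak_norm
  using L2_set_le_sum[of "{..m}" "\<lambda>k. weak_norm k f"] by (simp add: L2_set_def)

lemma sobolev_diff:
  assumes f: "f \<in> sobolev m" and g: "g \<in> sobolev m"
  shows "(\<lambda>x. f x - g x) \<in> sobolev m"
    and "k \<le> m \<Longrightarrow> weak_norm k (\<lambda>x. f x - g x) = l2 unit_measure (\<lambda>x. weak_deriv k f x - weak_deriv k g x)"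
proof -
  have L: "sqint unit_measure f" "sqint unit_measure g"
    using f g by (auto simp: sobolev_def L2_space_iff)
  have w: "sqint unit_measure (\<lambda>x. weak_deriv k f x - weak_deriv k g x)"
    "has_weak_deriv k (\<lambda>x. f x - g x) (\<lambda>x. weak_deriv k f x - weak_deriv k g x)" if "k \<le> m" for k
    using weak_deriv_properties[OF f that] weak_deriv_properties[OF g that] L
    by (auto intro: sqint_diff has_weak_deriv_diff)
  show "(\<lambda>x. f x - g x) \<in> sobolev m"
    unfolding sobolev_def using w[unfolded L2_space_iff[symmetric]] sqint_diff[OF L] L2_space_iff by blast
  show "weak_norm k (\<lambda>x. f x - g x) = l2 unit_measure (\<lambda>x. weak_deriv k f x - weak_deriv k g x)" if "k \<le> m"
    using w[OF that] by (rule weak_norm_eqI)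
qed

lemma weak_norm_minus_commute:
  assumes "f \<in> sobolev m" "g \<in> sobolev m" "k \<le> m"
  shows "weak_norm k (\<lambda>x. f x - g x) = weak_norm k (\<lambda>x. g x - f x)"
  using sobolev_diff(2)[OF assms] sobolev_diff(2)[OF assms(2,1,3)] l2_minus_commute by metis

lemma weak_norm_triangle:
  assumes "f \<in> sobolev m" "g \<in> sobolev m" "k \<le> m"
  shows "weak_norm k f \<le> weak_norm k g + weak_norm k (\<lambda>x. f x - g x)"
  unfolding sobolev_diff(2)[OF assms]
  unfolding weak_norm_def by (intro l2_diff_triangle weak_deriv_properties assms; fact assms)

lemma weak_norm_diff_triangle:
  assumes f: "f \<in> sobolev m" and g: "g \<in> sobolev m" and h: "h \<in> sobolev m" and k: "k \<le> m"
  shows "weak_norm k (\<lambda>x. f x - h x) \<le> weak_norm k (\<lambda>x. f x - g x) + weak_norm k (\<lambda>x. g x - h x)"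
proof -
  have s: "sqint unit_measure (weak_deriv k f)" "sqint unit_measure (weak_deriv k g)" "sqint unit_measure (weak_deriv k h)"
    using weak_deriv_properties assms by blast+
  have "l2 unit_measure (\<lambda>x. weak_deriv k f x - weak_deriv k h x)
      = l2 unit_measure (\<lambda>x. (weak_deriv k f x - weak_deriv k g x) + (weak_deriv k g x - weak_deriv k h x))"
    by simp
  also have "\<dots> \<le> l2 unit_measure (\<lambda>x. weak_deriv k f x - weak_deriv k g x)
       + l2 unit_measure (\<lambda>x. weak_deriv k g x - weak_deriv k h x)"
    by (intro l2_triangle sqint_diff s)
  finally show ?thesis
    by (simp add: sobolev_diff(2)[OF f h k] sobolev_diff(2)[OF f g k] sobolev_diff(2)[OF g h k])
qed

lemma weak_norm_test: "test_function \<phi> \<Longrightarrow> weak_norm k \<phi> = l2 lborel (D k \<phi>)"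
  using weak_norm_eqI[OF sqint_unit_test has_weak_deriv_test] l2_unit_test by metis

lemma test_sobolev: "test_function \<phi> \<Longrightarrow> \<phi> \<in> sobolev m"
  unfolding sobolev_def
  using sqint_unit_test[of \<phi> 0] sqint_unit_test[of \<phi>] has_weak_deriv_test[of \<phi>]
  by (simp add: L2_space_iff Bex_def) blast

lemma sobolev0_weak_norm:
  "f \<in> sobolev0 m \<longleftrightarrow> f \<in> sobolev m \<and>
     (\<forall>\<epsilon>>0. \<exists>\<phi>. test_function \<phi> \<and> (\<forall>k\<le>m. weak_norm k (\<lambda>x. f x - \<phi> x) < \<epsilon>))"
proof (intro iffI conjI allI impI)
  assume f: "f \<in> sobolev0 m"
  then show "f \<in> sobolev m" by (simp add: sobolev0_def)
  fix \<epsilon> :: real assume "0 < \<epsilon>"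
  with f obtain \<phi> where "test_function \<phi>" "sobolev_norm m (\<lambda>x. f x - \<phi> x) < \<epsilon>"
    unfolding sobolev0_def by blast
  then show "\<exists>\<phi>. test_function \<phi> \<and> (\<forall>k\<le>m. weak_norm k (\<lambda>x. f x - \<phi> x) < \<epsilon>)"
    using weak_norm_le_sobolev_norm by (meson le_less_trans)
next
  assume f: "f \<in> sobolev m \<and> (\<forall>\<epsilon>>0. \<exists>\<phi>. test_function \<phi> \<and> (\<forall>k\<le>m. weak_norm k (\<lambda>x. f x - \<phi> x) < \<epsilon>))"
  have "\<exists>\<phi>. test_function \<phi> \<and> sobolev_norm m (\<lambda>x. f x - \<phi> x) < \<epsilon>" if "0 < \<epsilon>" for \<epsilon>
  proof -
    have "0 < \<epsilon> / (real m + 1)" using that by simp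
    then obtain \<phi> where t: "test_function \<phi>" and \<phi>: "\<forall>k\<le>m. weak_norm k (\<lambda>x. f x - \<phi> x) < \<epsilon> / (real m + 1)"
      using f by blast
    have "sobolev_norm m (\<lambda>x. f x - \<phi> x) \<le> (\<Sum>k\<le>m. weak_norm k (\<lambda>x. f x - \<phi> x))"
      by (rule sobolev_norm_le_sum)
    also have "\<dots> < (\<Sum>k\<le>m. \<epsilon> / (real m + 1))"
      using \<phi> by (intro sum_strict_mono) auto
    also have "\<dots> = \<epsilon>" by (simp add: field_simps)
    finally show ?thesis using t by blast
  qed
  with f show "f \<in> sobolev0 m" by (simp add: sobolev0_def)
qed

lemma sobolev0_sobolev: "f \<in> sobolev0 m \<Longrightarrow> f \<in> sobolev m"
  by (simp add: sobolev0_def)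

lemma sobolev0_diff:
  assumes f: "f \<in> sobolev0 m" and g: "g \<in> sobolev0 m"
  shows "(\<lambda>x. f x - g x) \<in> sobolev0 m"
  unfolding sobolev0_weak_norm
proof (intro conjI allI impI)
  have s: "f \<in> sobolev m" "g \<in> sobolev m" using f g by (auto intro: sobolev0_sobolev)
  then show "(\<lambda>x. f x - g x) \<in> sobolev m" by (rule sobolev_diff)
  fix \<epsilon> :: real assume "0 < \<epsilon>"
  then have "0 < \<epsilon> / 2" by simp
  then obtain \<phi> \<psi> where t: "test_function \<phi>" "test_function \<psi>"
      and \<phi>: "\<forall>k\<le>m. weak_norm k (\<lambda>x. f x - \<phi> x) < \<epsilon> / 2" and \<psi>: "\<forall>k\<le>m. weak_norm k (\<lambda>x. g x - \<psi> x) < \<epsilon> / 2"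
    using f g unfolding sobolev0_weak_norm by meson
  have "weak_norm k (\<lambda>x. (f x - g x) - (\<phi> x - \<psi> x)) < \<epsilon>" if "k \<le> m" for k
  proof -
    have s': "(\<lambda>x. f x - \<phi> x) \<in> sobolev m" "(\<lambda>x. g x - \<psi> x) \<in> sobolev m"
      using s t by (auto intro: sobolev_diff test_sobolev)
    \<comment> \<open>The zero function serves as the middle point of the triangle inequality, which
      is available for differences only.\<close>
    have s0: "(\<lambda>x. 0) \<in> sobolev m" by (intro test_sobolev test_zero)
    have "(\<lambda>x. (f x - g x) - (\<phi> x - \<psi> x)) = (\<lambda>x. (f x - \<phi> x) - (g x - \<psi> x))"
      by (simp add: fun_eq_iff)
    then have "weak_norm k (\<lambda>x. (f x - g x) - (\<phi> x - \<psi> x)) \<le> weak_norm k (\<lambda>x. (f x - \<phi> x) - 0) + weak_norm k (\<lambda>x. 0 - (g x - \<psi> x))"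
      using weak_norm_diff_triangle[OF s'(1) s0 s'(2) that] by simp
    also have "weak_norm k (\<lambda>x. 0 - (g x - \<psi> x)) = weak_norm k (\<lambda>x. (g x - \<psi> x) - 0)"
      by (rule weak_norm_minus_commute[OF s0 s'(2) that])
    also have "weak_norm k (\<lambda>x. (f x - \<phi> x) - 0) + weak_norm k (\<lambda>x. (g x - \<psi> x) - 0) < \<epsilon> / 2 + \<epsilon> / 2"
      using \<phi> \<psi> that by (intro add_strict_mono) auto
    finally show ?thesis by simp
  qed
  with test_diff[OF t] show "\<exists>\<phi>. test_function \<phi> \<and> (\<forall>k\<le>m. weak_norm k (\<lambda>x. f x - g x - \<phi> x) < \<epsilon>)"
    by blast
qed

lemma sobolev0_sequence:
  assumes "f \<in> sobolev0 m"
  obtains \<phi> :: "nat \<Rightarrow> real \<Rightarrow> real" where "\<And>n. test_function (\<phi> n)"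
    "\<And>k. k \<le> m \<Longrightarrow> (\<lambda>n. weak_norm k (\<lambda>x. f x - \<phi> n x)) \<longlonglongrightarrow> 0"
proof -
  have "\<forall>n::nat. \<exists>\<phi>. test_function \<phi> \<and> (\<forall>k\<le>m. weak_norm k (\<lambda>x. f x - \<phi> x) < 1 / (real n + 1))"
    using assms unfolding sobolev0_weak_norm by simp
  then obtain \<phi> where \<phi>: "\<And>n. test_function (\<phi> n)" "\<And>n k. k \<le> m \<Longrightarrow> weak_norm k (\<lambda>x. f x - \<phi> n x) < 1 / (real n + 1)"
    by metis
  have "(\<lambda>n. 1 / (real n + 1)) \<longlonglongrightarrow> 0"
    using LIMSEQ_inverse_real_of_nat by (simp add: inverse_eq_divide add.commute)
  then have "(\<lambda>n. weak_norm k (\<lambda>x. f x - \<phi> n x)) \<longlonglongrightarrow> 0" if "k \<le> m" for k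
    by (rule tendsto_sandwich[OF _ _ tendsto_const, rotated 2])
       (use less_imp_le[OF \<phi>(2)[OF that]] in auto)
  with \<phi>(1) show ?thesis by (rule that)
qed

lemma weak_norm_tendsto:
  assumes "f \<in> sobolev m" "\<And>n. \<phi> n \<in> sobolev m" "k \<le> m" "(\<lambda>n. weak_norm k (\<lambda>x. f x - \<phi> n x)) \<longlonglongrightarrow> 0"
  shows "(\<lambda>n. weak_norm k (\<phi> n)) \<longlonglongrightarrow> weak_norm k f"
proof (rule LIM_zero_cancel, rule Lim_null_comparison[OF always_eventually assms(4)], intro allI)
  fix n
  show "norm (weak_norm k (\<phi> n) - weak_norm k f) \<le> weak_norm k (\<lambda>x. f x - \<phi> n x)"
    using weak_norm_triangle[OF assms(1,2,3), of n] weak_norm_triangle[OF assms(2,1,3), of n]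
      weak_norm_minus_commute[OF assms(1,2,3), of n] by (auto simp: abs_le_iff)
qed


section \<open>Inequalities for test functions\<close>

text \<open>The derivative vanishes at 0, so it is the integral of the next one over an interval of
  length at most 1; then Cauchy-Schwarz against the indicator of that interval.\<close>

lemma test_abs_le_l2:
  assumes "test_function \<phi>"
  shows "\<bar>D k \<phi> x\<bar> \<le> l2 lborel (D (Suc k) \<phi>)"
proof (cases "x \<in> {0<..<1}")
  case True
  let ?i = "indicat_real {0..x}"
  have "(\<integral>y. D (Suc k) \<phi> y * ?i y \<partial>lborel) = D k \<phi> x - D k \<phi> 0"
    by (rule integral_FTC_Icc_real)
       (use True test_D_has_derivative[OF assms] test_D_continuous[OF assms] in
         \<open>auto simp: continuous_on_eq_continuous_at simp del: funpow.simps\<close>)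
  also have "D k \<phi> 0 = 0" by (rule test_D_zero[OF assms]) simp
  finally have eq: "D k \<phi> x = (\<integral>y. D (Suc k) \<phi> y * ?i y \<partial>lborel)" by simp
  have sq: "(\<lambda>y. (?i y)\<^sup>2) = ?i" by (auto simp: indicator_def)
  have "integrable lborel ?i" using True by (intro integrable_real_indicator) auto
  then have "sqint lborel ?i" unfolding sqint_def sq by simp
  then have "\<bar>D k \<phi> x\<bar> \<le> l2 lborel (D (Suc k) \<phi>) * l2 lborel ?i"
    unfolding eq by (intro l2_Cauchy_Schwarz Cc_sqint[OF test_D_Cc] assms)
  also have "\<dots> \<le> l2 lborel (D (Suc k) \<phi>) * 1"
    using True by (intro mult_left_mono) (auto simp: l2_def sq)
  finally show ?thesis by simp
qed (simp add: test_D_zero[OF assms])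

lemma l2_le_sup_interval:
  assumes "Cc f" "\<And>x. \<bar>f x\<bar> \<le> B" "\<And>x. x \<notin> {a..b} \<Longrightarrow> f x = 0" "0 \<le> B" "a \<le> b"
  shows "l2 lborel f \<le> B * sqrt (b - a)"
proof -
  have i: "integrable lborel (\<lambda>x::real. B\<^sup>2 * indicat_real {a..b} x)"
    using assms(5) by (intro integrable_mult_right integrable_real_indicator) auto
  have "(f x)\<^sup>2 \<le> B\<^sup>2 * indicat_real {a..b} x" for x
  proof (cases "x \<in> {a..b}")
    case True
    then show ?thesis using abs_le_square_iff[of "f x" B] assms(2)[of x] assms(4) by simp
  qed (use assms(3) in simp)
  then have "(LINT x|lborel. (f x)\<^sup>2) \<le> (LINT x|lborel. B\<^sup>2 * indicat_real {a..b} x)"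
    by (rule Bochner_Integration.integral_mono[OF Cc_integrable[OF Cc_power2[OF assms(1)]] i])
  also have "\<dots> = (B * sqrt (b - a))\<^sup>2" using assms(5) by (simp add: power_mult_distrib)
  finally show ?thesis unfolding l2_def using assms(4,5) by (intro real_le_lsqrt) auto
qed

lemma l2_le_sup:
  assumes "Cc f" "\<And>x. \<bar>f x\<bar> \<le> B" "\<And>x. x \<notin> {0<..<1} \<Longrightarrow> f x = 0" "0 \<le> B"
  shows "l2 lborel f \<le> B"
  using l2_le_sup_interval[of f B 0 1] assms by force

lemma test_l2_mono:
  assumes "test_function \<phi>"
  shows "l2 lborel (D k \<phi>) \<le> l2 lborel (D (Suc k) \<phi>)"
  by (intro l2_le_sup test_D_Cc assms test_abs_le_l2 test_D_zero) auto

text \<open>With \<open>\<phi> = x \<psi>\<close>, Leibniz' rule gives \<open>D (k + 1) \<phi> = x D (k + 1) \<psi> + (k + 1) D k \<psi>\<close>; pairing this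
  with \<open>D k \<psi>\<close> and integrating by parts leaves \<open>k + 1/2\<close> times the squared norm of \<open>D k \<psi>\<close>.\<close>

lemma test_Hardy:
  assumes "test_function \<phi>"
  shows "l2 lborel (D k (\<lambda>x. \<phi> x / x)) \<le> 2 * l2 lborel (D (Suc k) \<phi>)"
proof -
  define \<psi> where "\<psi> = (\<lambda>x. \<phi> x / x)"
  have t: "test_function \<psi>" using test_div_power[OF assms, of 1] by (simp add: \<psi>_def)
  have "\<phi> x = x * \<psi> x" for x
    using test_D_zero[OF assms, of 0 0] by (simp add: \<psi>_def)
  then have \<phi>: "\<phi> = (\<lambda>x. x * \<psi> x)" by blast
  have Dj: "D (Suc j) \<phi> = (\<lambda>x. x * D (Suc j) \<psi> x + real (Suc j) * D j \<psi> x)" for j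
  proof (induction j)
    case 0
    have "(\<phi> has_real_derivative x * D (Suc 0) \<psi> x + real (Suc 0) * D 0 \<psi> x) (at x)" for x
      unfolding \<phi> using test_D_has_derivative[OF t, of 0 x] by (auto intro!: derivative_eq_intros)
    then show ?case using DERIV_imp_deriv by (fastforce simp: fun_eq_iff)
  next
    case (Suc j)
    have "(D (Suc j) \<phi> has_real_derivative x * D (Suc (Suc j)) \<psi> x + real (Suc (Suc j)) * D (Suc j) \<psi> x) (at x)" for x
      unfolding Suc using test_D_has_derivative[OF t, of j x] test_D_has_derivative[OF t, of "Suc j" x]
      by (auto intro!: derivative_eq_intros simp: algebra_simps simp del: funpow.simps)
    then have "deriv (D (Suc j) \<phi>) x = x * D (Suc (Suc j)) \<psi> x + real (Suc (Suc j)) * D (Suc j) \<psi> x" for x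
      by (rule DERIV_imp_deriv)
    then show ?case by (simp add: fun_eq_iff)
  qed
  let ?a = "LINT x|lborel. (D k \<psi> x)\<^sup>2" and ?b = "LINT x|lborel. x * (D (Suc k) \<psi> x * D k \<psi> x)"
  have c: "Cc (\<lambda>x. (D k \<psi> x)\<^sup>2)" "Cc (\<lambda>x. x * (D (Suc k) \<psi> x * D k \<psi> x))"
    by (intro Cc_power2 Cc_mult2 Cc_mult test_D_Cc t test_D_continuous continuous_on_id)+
  have "(LINT x|lborel. (D k \<psi> x)\<^sup>2 + 2 * (x * (D (Suc k) \<psi> x * D k \<psi> x))) = 0"
  proof (rule integral_deriv_Cc)
    show "((\<lambda>x. x * (D k \<psi> x)\<^sup>2) has_real_derivative (D k \<psi> x)\<^sup>2 + 2 * (x * (D (Suc k) \<psi> x * D k \<psi> x))) (at x)" for x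
      using test_D_has_derivative[OF t, of k x]
      by (auto intro!: derivative_eq_intros simp: power2_eq_square algebra_simps simp del: funpow.simps)
    show "continuous_on UNIV (\<lambda>x. (D k \<psi> x)\<^sup>2 + 2 * (x * (D (Suc k) \<psi> x * D k \<psi> x)))"
      by (intro continuous_intros test_D_continuous t)
    show "Cc (\<lambda>x. x * (D k \<psi> x)\<^sup>2)"
      by (intro Cc_mult2 c continuous_on_id)
  qed
  then have "?a + 2 * ?b = 0" using c Cc_integrable by simp
  moreover have "(LINT x|lborel. D (Suc k) \<phi> x * D k \<psi> x) = (LINT x|lborel. x * (D (Suc k) \<psi> x * D k \<psi> x) + real (Suc k) * (D k \<psi> x)\<^sup>2)"
    unfolding Dj by (intro Bochner_Integration.integral_cong) (auto simp: algebra_simps power2_eq_square simp del: funpow.simps)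
  then have "(LINT x|lborel. D (Suc k) \<phi> x * D k \<psi> x) = ?b + real (Suc k) * ?a"
    using c Cc_integrable by simp
  ultimately have eq: "(LINT x|lborel. D (Suc k) \<phi> x * D k \<psi> x) = (real k + 1 / 2) * ?a"
    by (simp add: algebra_simps)
  have "1 / 2 * ?a \<le> (real k + 1 / 2) * ?a" by (intro mult_right_mono) auto
  also have "\<dots> \<le> l2 lborel (D (Suc k) \<phi>) * l2 lborel (D k \<psi>)"
    unfolding eq[symmetric] using l2_Cauchy_Schwarz[OF Cc_sqint Cc_sqint, OF test_D_Cc test_D_Cc, OF assms t, of "Suc k" k] by linarith
  finally have "1 / 2 * (l2 lborel (D k \<psi>))\<^sup>2 \<le> l2 lborel (D (Suc k) \<phi>) * l2 lborel (D k \<psi>)"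
    unfolding l2_square .
  then have *: "l2 lborel (D k \<psi>) * l2 lborel (D k \<psi>) \<le> (2 * l2 lborel (D (Suc k) \<phi>)) * l2 lborel (D k \<psi>)"
    unfolding power2_eq_square by linarith
  have "l2 lborel (D k \<psi>) \<le> 2 * l2 lborel (D (Suc k) \<phi>)"
  proof (cases "l2 lborel (D k \<psi>) = 0")
    case True
    show ?thesis unfolding True by (intro mult_nonneg_nonneg) (auto simp del: funpow.simps)
  next
    case False
    then have "0 < l2 lborel (D k \<psi>)" using l2_nonneg[of lborel "D k \<psi>"] by linarith
    then show ?thesis using * by (rule mult_right_le_imp_le[rotated])
  qed
  then show ?thesis unfolding \<psi>_def .
qed

section \<open>The extension by zero of a function in the closure of the test functions\<close>

definition clamp :: "real \<Rightarrow> real" where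
  "clamp x = max 0 (min 1 x)"

text \<open>Composition with the projection onto [0,1] carries continuity to the line without any
  boundary condition. It is an extension by zero exactly when f vanishes at 0 and 1, as the
  continuous functions treated below do.\<close>

definition ext :: "(real \<Rightarrow> real) \<Rightarrow> real \<Rightarrow> real" where
  "ext f x = f (clamp x)"

lemma clamp_unit [simp]: "0 \<le> clamp x" "clamp x \<le> 1" "x \<in> {0..1} \<Longrightarrow> clamp x = x"
  by (auto simp: clamp_def)

lemma ext_eq: "x \<in> {0..1} \<Longrightarrow> ext f x = f x"
  by (simp add: ext_def)

lemma continuous_clamp [continuous_intros]:
  "continuous_on S g \<Longrightarrow> continuous_on S (\<lambda>x. clamp (g x))"
  unfolding clamp_def by (intro continuous_intros)

lemma continuous_ext:
  assumes "continuous_on {0..1} f"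
  shows "continuous_on UNIV (ext f)"
  unfolding ext_def by (rule continuous_on_compose2[OF assms]) (auto intro!: continuous_intros)

lemma ext_test: "test_function \<phi> \<Longrightarrow> ext \<phi> = \<phi>"
proof
  fix x assume "test_function \<phi>"
  note z = test_D_zero[OF this, of _ 0, simplified]
  show "ext \<phi> x = \<phi> x"
    using z[of 0] z[of 1] z[of x] by (cases "x < 0"; cases "1 < x") (auto simp: ext_def clamp_def max_def min_def)
qed

lemma ext_diff: "ext (\<lambda>x. f x - g x) = (\<lambda>x. ext f x - ext g x)"
  by (simp add: ext_def[abs_def])

lemma uniform_limit_deriv:
  fixes f :: "nat \<Rightarrow> real \<Rightarrow> real"
  assumes d: "\<And>n x. (f n has_real_derivative f' n x) (at x)"
    and l: "uniform_limit UNIV f g sequentially" and l': "uniform_limit UNIV f' g' sequentially"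
  shows "(g has_real_derivative g' x) (at x)"
proof -
  have "\<exists>G. \<forall>x\<in>UNIV. (\<lambda>n. f n x) \<longlonglongrightarrow> G x \<and> (G has_derivative (\<lambda>h. g' x * h)) (at x within UNIV)"
  proof (rule has_derivative_sequence)
    show "(f n has_derivative (\<lambda>h. f' n x * h)) (at x within UNIV)" for n x
      using d by (simp add: has_field_derivative_def)
    show "\<forall>\<^sub>F n in sequentially. \<forall>x\<in>UNIV. \<forall>h. norm (f' n x * h - g' x * h) \<le> e * norm h" if "0 < e" for e
      using uniform_limitD[OF l' that]
    proof eventually_elim
      case (elim n)
      show ?case
      proof (intro ballI allI)
        fix x h
        have "norm (f' n x * h - g' x * h) = \<bar>f' n x - g' x\<bar> * \<bar>h\<bar>"
          by (simp add: left_diff_distrib[symmetric] abs_mult)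
        also have "\<dots> \<le> e * \<bar>h\<bar>"
          using elim by (intro mult_right_mono) (auto simp: dist_real_def less_imp_le)
        finally show "norm (f' n x * h - g' x * h) \<le> e * norm h" by simp
      qed
    qed
    show "(\<lambda>n. f n 0) \<longlonglongrightarrow> g 0" by (rule tendsto_uniform_limitI[OF l]) simp
  qed auto
  then obtain G where G: "\<And>x. (\<lambda>n. f n x) \<longlonglongrightarrow> G x" "(G has_derivative (\<lambda>h. g' x * h)) (at x)"
    by auto
  have "G = g"
    using LIMSEQ_unique[OF G(1) tendsto_uniform_limitI[OF l]] by auto
  with G(2) show ?thesis by (simp add: has_field_derivative_def)
qed

text \<open>The top order converges only in the L2 sense, through weak derivatives. Below it the
  convergence is uniform, since \<open>test_abs_le_l2\<close> pays for a sup norm with one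
  derivative.\<close>

definition approximates :: "nat \<Rightarrow> (real \<Rightarrow> real) \<Rightarrow> (nat \<Rightarrow> real \<Rightarrow> real) \<Rightarrow> bool" where
  "approximates m f \<phi> \<longleftrightarrow> (\<forall>n. test_function (\<phi> n)) \<and>
     (\<forall>k\<le>m. (\<lambda>n. weak_norm k (\<lambda>x. f x - \<phi> n x)) \<longlonglongrightarrow> 0) \<and>
     (\<forall>k<m. uniform_limit UNIV (\<lambda>n. D k (\<phi> n)) (D k (ext f)) sequentially)"

text \<open>A sequence of test functions converging in H^m is uniformly Cauchy in every order below
  m, and uniform limits of derivatives are derivatives. The limit of order 0 equals f almost
  everywhere; the continuity of f upgrades this to equality on [0,1], so that the given
  representative itself has these derivatives.\<close>

lemma sobolev0_approximation:
  assumes f: "f \<in> sobolev0 m" and m: "1 \<le> m" and c: "continuous_on {0..1} f"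
  shows "(\<exists>\<phi>. approximates m f \<phi>) \<and>
    (\<forall>k x. Suc k < m \<longrightarrow> (D k (ext f) has_real_derivative D (Suc k) (ext f) x) (at x))"
proof -
  obtain \<phi> :: "nat \<Rightarrow> real \<Rightarrow> real" where t: "\<And>n. test_function (\<phi> n)"
    and N0: "\<And>k. k \<le> m \<Longrightarrow> (\<lambda>n. weak_norm k (\<lambda>x. f x - \<phi> n x)) \<longlonglongrightarrow> 0"
    using sobolev0_sequence[OF f] by blast
  have fs: "f \<in> sobolev m" and ts: "\<phi> n \<in> sobolev m" for n
    using f t by (auto intro: sobolev0_sobolev test_sobolev)
  have "uniformly_convergent_on UNIV (\<lambda>n. D k (\<phi> n))" if "k < m" for k
  proof (rule Cauchy_uniformly_convergent, unfold uniformly_Cauchy_on_def, intro allI impI)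
    fix e :: real assume "0 < e"
    have k: "Suc k \<le> m" using that by simp
    have "\<forall>\<^sub>F n in sequentially. weak_norm (Suc k) (\<lambda>x. f x - \<phi> n x) < e / 2"
      using N0[OF k] \<open>0 < e\<close> by (intro order_tendstoD) auto
    then obtain M where M: "\<And>n. M \<le> n \<Longrightarrow> weak_norm (Suc k) (\<lambda>x. f x - \<phi> n x) < e / 2"
      unfolding eventually_sequentially by blast
    have "dist (D k (\<phi> p) x) (D k (\<phi> n) x) < e" if "M \<le> n" "M \<le> p" for x p n
    proof -
      have "\<bar>D k (\<phi> p) x - D k (\<phi> n) x\<bar> = \<bar>D k (\<lambda>x. \<phi> p x - \<phi> n x) x\<bar>"
        by (simp add: test_D_diff t)
      also have "\<dots> \<le> weak_norm (Suc k) (\<lambda>x. \<phi> p x - \<phi> n x)"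
        using test_abs_le_l2[OF test_diff[OF t t], of k] weak_norm_test[OF test_diff[OF t t]] by metis
      also have "\<dots> \<le> weak_norm (Suc k) (\<lambda>x. \<phi> p x - f x) + weak_norm (Suc k) (\<lambda>x. f x - \<phi> n x)"
        by (rule weak_norm_diff_triangle[OF ts fs ts k])
      also have "\<dots> < e / 2 + e / 2"
        using M[OF that(1)] M[OF that(2)] weak_norm_minus_commute[OF ts fs k] by (intro add_strict_mono) auto
      finally show ?thesis by (simp add: dist_real_def)
    qed
    then show "\<exists>M. \<forall>x\<in>UNIV. \<forall>p\<ge>M. \<forall>n\<ge>M. dist (D k (\<phi> p) x) (D k (\<phi> n) x) < e" by blast
  qed
  then have "\<forall>k. \<exists>w. k < m \<longrightarrow> uniform_limit UNIV (\<lambda>n. D k (\<phi> n)) w sequentially"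
    unfolding uniformly_convergent_on_def by blast
  then obtain W where W: "\<And>k. k < m \<Longrightarrow> uniform_limit UNIV (\<lambda>n. D k (\<phi> n)) (W k) sequentially"
    by metis
  have Wc: "continuous_on UNIV (W k)" if "k < m" for k
    by (rule uniform_limit_theorem[OF always_eventually W[OF that]]) (auto intro: test_D_continuous t)
  have Wd: "(W k has_real_derivative W (Suc k) x) (at x)" if "Suc k < m" for k x
    using that by (intro uniform_limit_deriv[OF test_D_has_derivative[OF t] W W]) auto
  have m0: "0 < m" using m by simp
  have Wz: "W 0 x = 0" if "x \<notin> {0<..<1}" for x
  proof -
    have "(\<lambda>n. D 0 (\<phi> n) x) \<longlonglongrightarrow> W 0 x" by (rule tendsto_uniform_limitI[OF W[OF m0]]) simp
    then have "(\<lambda>n. 0) \<longlonglongrightarrow> W 0 x" by (simp only: test_D_zero[OF t that])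
    then show ?thesis by (simp only: tendsto_const_iff[OF sequentially_bot])
  qed
  have fm: "sqint unit_measure f" using fs by (auto simp: sobolev_def L2_space_iff)
  have tm: "sqint unit_measure (\<phi> n)" for n using sqint_unit_test[OF t, of 0] by simp
  have W0m: "W 0 \<in> borel_measurable unit_measure"
    by (intro measurable_unit_measure borel_measurable_continuous_onI Wc m0)
  have "bounded (W 0 ` {0..1})"
    by (intro compact_imp_bounded compact_continuous_image continuous_on_subset[OF Wc[OF m0]]) auto
  then obtain B where B: "\<forall>y\<in>W 0 ` {0..1}. norm y \<le> B" unfolding bounded_iff by blast
  have W0: "sqint unit_measure (W 0)"
    by (rule sqint_unit_bounded[OF W0m, of B]) (use B in force)
  have lim0: "(\<lambda>n. weak_norm 0 (\<lambda>x. f x - \<phi> n x)) \<longlonglongrightarrow> 0" using N0 by simp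
  have "l2 unit_measure (\<lambda>x. f x - W 0 x) \<le> e" if "0 < e" for e
  proof -
    have "0 < e / 2" using that by simp
    have "\<forall>\<^sub>F n in sequentially. weak_norm 0 (\<lambda>x. f x - \<phi> n x) < e / 2 \<and> (\<forall>x\<in>UNIV. dist (D 0 (\<phi> n) x) (W 0 x) < e / 2)"
      using order_tendstoD(2)[OF lim0 \<open>0 < e / 2\<close>] uniform_limitD[OF W[OF m0] \<open>0 < e / 2\<close>]
      by eventually_elim auto
    then obtain n where n: "weak_norm 0 (\<lambda>x. f x - \<phi> n x) < e / 2" "\<And>x. \<bar>\<phi> n x - W 0 x\<bar> < e / 2"
      by (auto simp: eventually_sequentially dist_real_def)
    have 1: "weak_norm 0 (\<lambda>x. f x - \<phi> n x) = l2 unit_measure (\<lambda>x. f x - \<phi> n x)"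
      by (rule weak_norm_eqI) (auto intro: sqint_diff fm tm simp: has_weak_deriv_def)
    have 2: "l2 unit_measure (\<lambda>x. \<phi> n x - W 0 x) \<le> e / 2"
      using n(2) \<open>0 < e / 2\<close> tm[of n] W0 by (intro l2_unit_bounded) (auto simp: sqint_def less_imp_le)
    have "l2 unit_measure (\<lambda>x. f x - W 0 x) = l2 unit_measure (\<lambda>x. (f x - \<phi> n x) + (\<phi> n x - W 0 x))" by simp
    also have "\<dots> \<le> l2 unit_measure (\<lambda>x. f x - \<phi> n x) + l2 unit_measure (\<lambda>x. \<phi> n x - W 0 x)"
      by (intro l2_triangle sqint_diff fm tm W0)
    also have "\<dots> \<le> e" using 1 2 n(1) by simp
    finally show ?thesis .
  qed
  then have "l2 unit_measure (\<lambda>x. f x - W 0 x) \<le> 0" by (rule field_le_epsilon[of _ 0, simplified])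
  then have "(LINT x|unit_measure. (f x - W 0 x)\<^sup>2) = 0"
    using l2_square[of unit_measure "\<lambda>x. f x - W 0 x"] l2_nonneg[of unit_measure "\<lambda>x. f x - W 0 x"] by simp
  then have "AE x in unit_measure. (f x - W 0 x)\<^sup>2 = 0"
    using sqint_diff[OF fm W0] by (subst (asm) integral_nonneg_eq_0_iff_AE) (auto simp: sqint_def)
  then have ae: "AE x\<in>{0<..<1} in lebesgue. x \<in> {x. ext f x - W 0 x = 0}"
    by (subst (asm) AE_restrict_space_iff) (auto simp: ext_eq elim!: eventually_mono)
  have cd: "continuous_on UNIV (\<lambda>x. ext f x - W 0 x)"
    by (intro continuous_intros continuous_ext c Wc m0)
  have cl: "closed {x. ext f x - W 0 x = 0}"
    using continuous_closed_vimage[of "{0}" "\<lambda>x. ext f x - W 0 x"] cd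
    by (simp add: vimage_def continuous_on_eq_continuous_at)
  \<comment> \<open>A closed set that contains almost every point of an open set contains all of it;
    taking closures then adds the endpoints.\<close>
  have "{0<..<1} \<subseteq> {x. ext f x - W 0 x = 0}"
    using mem_closed_if_AE_lebesgue_open[OF open_greaterThanLessThan cl ae] by blast
  then have "closure {0<..<1} \<subseteq> {x. ext f x - W 0 x = 0}" using cl by (rule closure_minimal)
  then have e01: "ext f x = W 0 x" if "x \<in> {0..1}" for x using that by auto
  have W0_eq: "W 0 = ext f"
  proof
    fix x
    show "W 0 x = ext f x"
    proof (cases "x \<in> {0..1}")
      case False
      then have "clamp x = 0 \<or> clamp x = 1" by (auto simp: clamp_def max_def min_def)
      then have "ext f x = ext f 0 \<or> ext f x = ext f 1" by (auto simp: ext_def)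
      then show ?thesis using e01[of 0] e01[of 1] Wz[of 0] Wz[of 1] Wz[of x] False by auto
    qed (simp add: e01)
  qed
  have WD: "k < m \<Longrightarrow> W k = D k (ext f)" for k
  proof (induction k)
    case (Suc k)
    have "deriv (W k) = W (Suc k)"
      using DERIV_imp_deriv[OF Wd[OF Suc.prems]] by blast
    then show ?case using Suc by simp
  qed (simp add: W0_eq)
  have "approximates m f \<phi>"
    unfolding approximates_def
  proof (intro conjI allI impI)
    show "uniform_limit UNIV (\<lambda>n. D k (\<phi> n)) (D k (ext f)) sequentially" if "k < m" for k
      using W[OF that] by (simp only: WD[OF that])
  qed (fact t, rule N0)
  moreover have "(D k (ext f) has_real_derivative D (Suc k) (ext f) x) (at x)" if "Suc k < m" for k x
    using Wd[OF that, of x] by (simp only: WD[OF that] WD[OF Suc_lessD[OF that]])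
  ultimately show ?thesis by blast
qed

section \<open>Properties inherited from the approximating test functions\<close>

lemma ext_has_derivative:
  assumes "f \<in> sobolev0 m" "continuous_on {0..1} f" "Suc k < m"
  shows "(D k (ext f) has_real_derivative D (Suc k) (ext f) x) (at x)"
  using sobolev0_approximation[OF assms(1) _ assms(2)] assms(3) by simp

lemma approximates_test: "approximates m f \<phi> \<Longrightarrow> test_function (\<phi> n)"
  by (simp add: approximates_def)

lemma approximates_tendsto: "approximates m f \<phi> \<Longrightarrow> k < m \<Longrightarrow> (\<lambda>n. D k (\<phi> n) x) \<longlonglongrightarrow> D k (ext f) x"
proof -
  assume "approximates m f \<phi>" "k < m"
  then have "uniform_limit UNIV (\<lambda>n. D k (\<phi> n)) (D k (ext f)) sequentially"
    unfolding approximates_def by blast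
  then show ?thesis by (rule tendsto_uniform_limitI) simp
qed

lemma approximates_l2:
  assumes "approximates m f \<phi>" "f \<in> sobolev0 m" "k \<le> m"
  shows "(\<lambda>n. l2 lborel (D k (\<phi> n))) \<longlonglongrightarrow> weak_norm k f"
proof -
  have "(\<lambda>n. weak_norm k (\<lambda>x. f x - \<phi> n x)) \<longlonglongrightarrow> 0"
    using assms unfolding approximates_def by blast
  then show ?thesis
    using weak_norm_tendsto[OF sobolev0_sobolev[OF assms(2)] test_sobolev[OF approximates_test[OF assms(1)]] assms(3)]
    by (simp add: weak_norm_test[OF approximates_test[OF assms(1)]])
qed

lemma ext_approximates:
  assumes "f \<in> sobolev0 m" "continuous_on {0..1} f" "k < m"
  shows "\<exists>\<phi>. approximates m f \<phi>"
  using sobolev0_approximation[OF assms(1) _ assms(2)] assms(3) by simp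

lemma ext_continuous:
  assumes "f \<in> sobolev0 m" "continuous_on {0..1} f" "k < m"
  shows "continuous_on UNIV (D k (ext f))"
proof -
  obtain \<phi> where \<phi>: "approximates m f \<phi>" using ext_approximates[OF assms(1-3)] by blast
  then have u: "uniform_limit UNIV (\<lambda>n. D k (\<phi> n)) (D k (ext f)) sequentially"
    unfolding approximates_def using assms(3) by blast
  show ?thesis
    by (rule uniform_limit_theorem[OF always_eventually u])
       (use test_D_continuous[OF approximates_test[OF \<phi>]] in auto)
qed

lemma ext_zero:
  assumes "f \<in> sobolev0 m" "continuous_on {0..1} f" "k < m" "x \<notin> {0<..<1}"
  shows "D k (ext f) x = 0"
proof -
  obtain \<phi> where \<phi>: "approximates m f \<phi>" using ext_approximates[OF assms(1-3)] by blast
  have "(\<lambda>n. 0) \<longlonglongrightarrow> D k (ext f) x"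
    using approximates_tendsto[OF \<phi> assms(3), of x]
    by (simp only: test_D_zero[OF approximates_test[OF \<phi>] assms(4)])
  then show ?thesis by (simp only: tendsto_const_iff[OF sequentially_bot])
qed

lemma ext_Cc: "f \<in> sobolev0 m \<Longrightarrow> continuous_on {0..1} f \<Longrightarrow> k < m \<Longrightarrow> Cc (D k (ext f))"
  by (rule CcI[of _ 1]) (auto intro: ext_continuous ext_zero)

lemma ext_abs_le_weak_norm:
  assumes "f \<in> sobolev0 m" "continuous_on {0..1} f" "k < m"
  shows "\<bar>D k (ext f) x\<bar> \<le> weak_norm (Suc k) f"
proof -
  obtain \<phi> where \<phi>: "approximates m f \<phi>" using ext_approximates[OF assms(1-3)] by blast
  show ?thesis
    by (rule LIMSEQ_le[OF tendsto_rabs[OF approximates_tendsto[OF \<phi> assms(3)]] approximates_l2[OF \<phi> assms(1)]])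
       (use assms test_abs_le_l2[OF approximates_test[OF \<phi>]] in auto)
qed

lemma weak_norm_mono:
  assumes "f \<in> sobolev0 m" "continuous_on {0..1} f" "k < m"
  shows "weak_norm k f \<le> weak_norm (Suc k) f"
proof -
  obtain \<phi> where \<phi>: "approximates m f \<phi>" using ext_approximates[OF assms(1-3)] by blast
  show ?thesis
    by (rule LIMSEQ_le[OF approximates_l2[OF \<phi> assms(1)] approximates_l2[OF \<phi> assms(1)]])
       (use assms test_l2_mono[OF approximates_test[OF \<phi>]] in auto)
qed

lemma weak_norm_mono_le:
  assumes "f \<in> sobolev0 m" "continuous_on {0..1} f" "j \<le> k" "k \<le> m"
  shows "weak_norm j f \<le> weak_norm k f"
  using assms(3,4)
proof (induction k rule: dec_induct)
  case (step n)
  then show ?case using weak_norm_mono[OF assms(1,2), of n] by simp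
qed simp


section \<open>Finite differences\<close>

definition dquot :: "real \<Rightarrow> (real \<Rightarrow> real) \<Rightarrow> real \<Rightarrow> real" where
  "dquot h f x = (f (x + h) - f x) / h"

abbreviation Dh :: "real \<Rightarrow> nat \<Rightarrow> (real \<Rightarrow> real) \<Rightarrow> real \<Rightarrow> real" where
  "Dh h k \<equiv> dquot h ^^ k"

lemma dquot_Cc: "Cc f \<Longrightarrow> Cc (dquot h f)"
  using Cc_cmult[OF Cc_diff[OF Cc_shift[of f h]], of f "1 / h"] by (simp add: dquot_def[abs_def])

lemma Dh_Cc: "Cc f \<Longrightarrow> Cc (Dh h k f)"
  by (induction k) (auto intro: dquot_Cc)

lemma Dh_continuous: "continuous_on UNIV f \<Longrightarrow> continuous_on UNIV (Dh h k f)"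
proof (induction k)
  case (Suc k)
  then have c: "continuous_on UNIV (Dh h k f)" by blast
  have "continuous_on UNIV (\<lambda>x. (Dh h k f (x + h) - Dh h k f x) * (1 / h))"
    by (intro continuous_intros continuous_on_compose2[OF c] c) auto
  then show ?case by (simp add: dquot_def[abs_def])
qed simp

lemma dquot_has_derivative:
  assumes "\<And>x. (f has_real_derivative f' x) (at x)"
  shows "(dquot h f has_real_derivative dquot h f' x) (at x)"
proof -
  have "((\<lambda>x. f (x + h)) has_real_derivative f' (x + h)) (at x)"
    using assms by (subst DERIV_shift[symmetric])
  then show ?thesis unfolding dquot_def[abs_def]
    by (intro DERIV_cdivide DERIV_diff assms)
qed

lemma Dh_has_derivative:
  assumes "\<And>x. (f has_real_derivative f' x) (at x)"
  shows "(Dh h k f has_real_derivative Dh h k f' x) (at x)"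
  using assms by (induction k arbitrary: x) (auto intro: dquot_has_derivative)

lemma dquot_mvt:
  assumes "\<And>x. (f has_real_derivative f' x) (at x)" "0 < h"
  obtains z where "x < z" "z < x + h" "dquot h f x = f' z"
proof -
  have "\<exists>z>x. z < x + h \<and> f (x + h) - f x = (x + h - x) * f' z"
    by (rule MVT2) (use assms in auto)
  then show ?thesis using assms(2) that by (auto simp: dquot_def)
qed

lemma dquot_abs_le:
  assumes "\<And>x. (f has_real_derivative f' x) (at x)" "0 < h" "\<And>x. \<bar>f' x\<bar> \<le> B"
  shows "\<bar>dquot h f x\<bar> \<le> B"
  using dquot_mvt[OF assms(1,2)] assms(3) by metis

text \<open>Only the derivative is assumed to have compact support: far out f is constant and its
  differences vanish. This serves the velocity, which becomes compactly supported only after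
  differences have been taken.\<close>

lemma dquot_Cc_of_deriv:
  assumes d: "\<And>x. (f has_real_derivative f' x) (at x)" and "0 < h" "Cc f'"
  shows "Cc (dquot h f)"
proof -
  from assms(3) obtain R where R: "\<And>x. R < \<bar>x\<bar> \<Longrightarrow> f' x = 0" unfolding Cc_def by blast
  have "dquot h f x = 0" if x: "\<bar>R\<bar> + h < \<bar>x\<bar>" for x
  proof -
    obtain z where "x < z" "z < x + h" "dquot h f x = f' z" using dquot_mvt[OF d assms(2)] by blast
    then show ?thesis using R[of z] x by auto
  qed
  moreover have "continuous_on UNIV (dquot h f)"
    using Dh_continuous[OF differentiable_imp_continuous_UNIV[OF d], where h = h and k = 1] by simp
  ultimately show ?thesis by (intro CcI)
qed

text \<open>A difference quotient is an average of the derivative over an interval of length \<open>h\<close>, so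
  Cauchy-Schwarz and Fubini apply.\<close>

lemma l2_dquot_le:
  assumes d: "\<And>x. (f has_real_derivative f' x) (at x)" and h: "0 < h" and Cc: "Cc f'"
  shows "l2 lborel (dquot h f) \<le> l2 lborel f'"
proof -
  have c': "continuous_on UNIV f'" by (rule Cc_cont[OF Cc])
  have m[measurable]: "f' \<in> borel_measurable borel" by (rule Cc_measurable[OF Cc])
  let ?i = "indicat_real {0..h}"
  have sq: "(\<lambda>y. (?i y)\<^sup>2) = ?i" by (auto simp: indicator_def)
  have "integrable lborel ?i" using h by (intro integrable_real_indicator) auto
  then have si: "sqint lborel ?i" unfolding sqint_def sq by simp
  have l2i: "l2 lborel ?i = sqrt h" using h by (simp add: l2_def sq)
  have int: "integrable lborel (\<lambda>s. (f' (s + x))\<^sup>2 * ?i s)" for x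
    by (rule integrable_real_mult_indicator) (use Cc_integrable[OF Cc_power2[OF Cc_shift[OF Cc]]] in auto)
  have pt: "(dquot h f x)\<^sup>2 \<le> (LINT s|lborel. (f' (s + x))\<^sup>2 * ?i s) / h" for x
  proof -
    have "(\<integral>s. f' (s + x) * ?i s \<partial>lborel) = f (h + x) - f (0 + x)"
    proof (rule integral_FTC_Icc_real[where F = "\<lambda>s. f (s + x)"])
      show "((\<lambda>s. f (s + x)) has_real_derivative f' (s + x)) (at s)" for s
        using d by (subst DERIV_shift[symmetric])
      show "isCont (\<lambda>s. f' (s + x)) s" for s
        using continuous_on_compose2[OF c', of UNIV "\<lambda>s. s + x"]
        by (auto simp: continuous_on_eq_continuous_at continuous_intros)
    qed (use h in auto)
    then have eq: "dquot h f x = (\<integral>s. (f' (s + x) * ?i s) * ?i s \<partial>lborel) / h"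
      by (simp add: dquot_def add.commute mult.assoc indicator_inter_arith[symmetric])
    have sq2: "(\<lambda>s. (f' (s + x) * ?i s)\<^sup>2) = (\<lambda>s. (f' (s + x))\<^sup>2 * ?i s)"
      by (auto simp: indicator_def)
    have "sqint lborel (\<lambda>s. f' (s + x) * ?i s)"
      unfolding sqint_def sq2 using int by simp
    then have "\<bar>\<integral>s. (f' (s + x) * ?i s) * ?i s \<partial>lborel\<bar> \<le> l2 lborel (\<lambda>s. f' (s + x) * ?i s) * sqrt h"
      using l2_Cauchy_Schwarz[OF _ si] l2i by metis
    then have "\<bar>\<integral>s. (f' (s + x) * ?i s) * ?i s \<partial>lborel\<bar>\<^sup>2 \<le> (l2 lborel (\<lambda>s. f' (s + x) * ?i s) * sqrt h)\<^sup>2"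
      by (intro power_mono) auto
    also have "\<dots> = (LINT s|lborel. (f' (s + x))\<^sup>2 * ?i s) * h"
      unfolding power_mult_distrib[of "l2 lborel (\<lambda>s. f' (s + x) * ?i s)" "sqrt h"] l2_square sq2
      using h by simp
    finally show ?thesis
      using h by (simp add: eq power_divide divide_simps power2_eq_square)
  qed
  have "ennreal (LINT x|lborel. (dquot h f x)\<^sup>2) = (\<integral>\<^sup>+x. ennreal ((dquot h f x)\<^sup>2) \<partial>lborel)"
    by (rule nn_integral_eq_integral[symmetric]) (auto intro!: Cc_integrable Cc_power2 dquot_Cc_of_deriv[OF d h Cc])
  also have "\<dots> \<le> (\<integral>\<^sup>+x. ennreal ((LINT s|lborel. (f' (s + x))\<^sup>2 * ?i s) / h) \<partial>lborel)"
    by (intro nn_integral_mono ennreal_leI pt)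
  also have "\<dots> = (\<integral>\<^sup>+x. (\<integral>\<^sup>+s. ennreal ((f' (s + x))\<^sup>2 * ?i s / h) \<partial>lborel) \<partial>lborel)"
    using int h by (intro nn_integral_cong) (subst nn_integral_eq_integral, auto)
  also have "\<dots> = (\<integral>\<^sup>+s. (\<integral>\<^sup>+x. ennreal ((f' (s + x))\<^sup>2 * ?i s / h) \<partial>lborel) \<partial>lborel)"
    by (rule lborel_pair.Fubini') simp
  also have "\<dots> = (\<integral>\<^sup>+s. ennreal (?i s / h) * ennreal ((l2 lborel f')\<^sup>2) \<partial>lborel)"
  proof (intro nn_integral_cong)
    fix s
    have "(\<integral>\<^sup>+x. ennreal ((f' (s + x))\<^sup>2 * ?i s / h) \<partial>lborel) = (\<integral>\<^sup>+x. ennreal (?i s / h) * ennreal ((f' (x + s))\<^sup>2) \<partial>lborel)"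
      using h by (intro nn_integral_cong) (simp add: ennreal_mult[symmetric] add.commute mult.commute)
    also have "\<dots> = ennreal (?i s / h) * (\<integral>\<^sup>+x. ennreal ((f' (x + s))\<^sup>2) \<partial>lborel)"
      by (rule nn_integral_cmult) simp
    also have "(\<integral>\<^sup>+x. ennreal ((f' (x + s))\<^sup>2) \<partial>lborel) = ennreal ((l2 lborel f')\<^sup>2)"
      using l2_shift[of f' s] Cc_integrable[OF Cc_power2[OF Cc_shift[OF Cc]]]
      by (subst nn_integral_eq_integral) (auto simp flip: l2_square)
    finally show "(\<integral>\<^sup>+x. ennreal ((f' (s + x))\<^sup>2 * ?i s / h) \<partial>lborel) = ennreal (?i s / h) * ennreal ((l2 lborel f')\<^sup>2)" .
  qed
  also have "\<dots> = (\<integral>\<^sup>+s. ennreal (?i s / h) \<partial>lborel) * ennreal ((l2 lborel f')\<^sup>2)"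
    by (rule nn_integral_multc) simp
  also have "(\<integral>\<^sup>+s. ennreal (?i s / h) \<partial>lborel) = 1"
    using \<open>integrable lborel ?i\<close> h by (subst nn_integral_eq_integral) auto
  finally have "(LINT x|lborel. (dquot h f x)\<^sup>2) \<le> (l2 lborel f')\<^sup>2"
    by (simp add: ennreal_le_iff)
  then show ?thesis unfolding l2_square[symmetric] by (rule power2_le_imp_le) simp
qed

section \<open>Algebra of iterated differences\<close>

lemma Dh_tendsto:
  assumes "\<And>x. (\<lambda>n. f n x) \<longlonglongrightarrow> g x"
  shows "(\<lambda>n. Dh h k (f n) x) \<longlonglongrightarrow> Dh h k g x"
proof (induction k arbitrary: x)
  case (Suc k)
  have "(\<lambda>n. (Dh h k (f n) (x + h) - Dh h k (f n) x) * (1 / h)) \<longlonglongrightarrow> (Dh h k g (x + h) - Dh h k g x) * (1 / h)"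
    by (intro tendsto_intros Suc)
  then show ?case by (simp add: dquot_def[of h "Dh h k _"])
qed (simp add: assms)

lemma Dh_add: "Dh h k (\<lambda>x. f x + g x) = (\<lambda>x. Dh h k f x + Dh h k g x)"
  by (induction k) (auto simp: dquot_def fun_eq_iff add_divide_distrib diff_divide_distrib)

lemma Dh_diff: "Dh h k (\<lambda>x. f x - g x) = (\<lambda>x. Dh h k f x - Dh h k g x)"
  by (induction k) (auto simp: dquot_def fun_eq_iff add_divide_distrib diff_divide_distrib)

lemma Dh_shift: "Dh h k (\<lambda>x. f (x + c)) = (\<lambda>x. Dh h k f (x + c))"
  by (induction k) (auto simp: dquot_def fun_eq_iff add_ac)

lemma dquot_mult: "dquot h (\<lambda>x. f x * g x) x = f x * dquot h g x + dquot h f x * g (x + h)"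
  by (simp add: dquot_def field_simps flip: add_divide_distrib) 

lemma Dh_Suc: "Dh h (Suc k) f = Dh h k (dquot h f)"
  by (simp add: funpow_swap1)

text \<open>The discrete Leibniz rule. Each difference that falls on f leaves g at the far end of
  the step, as in \<open>dquot_mult\<close>, whence the shift by j h; it is harmless because sup and
  L2 norms on the line are translation invariant.\<close>

lemma Dh_mult:
  "Dh h n (\<lambda>x. f x * g x) x = (\<Sum>j\<le>n. real (n choose j) * Dh h j f x * Dh h (n - j) g (x + real j * h))"
proof (induction n arbitrary: f g x)
  case (Suc n)
  let ?a = "\<lambda>j. Dh h j f x * Dh h (Suc n - j) g (x + real j * h)"
  have e: "dquot h (\<lambda>x. f x * g x) = (\<lambda>x. f x * dquot h g x + dquot h f x * g (x + h))"
    by (rule HOL.ext) (rule dquot_mult)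
  have "Dh h (Suc n) (\<lambda>x. f x * g x) x = (\<Sum>j\<le>n. real (n choose j) * Dh h j f x * Dh h (n - j) (dquot h g) (x + real j * h))
      + (\<Sum>j\<le>n. real (n choose j) * Dh h j (dquot h f) x * Dh h (n - j) (\<lambda>x. g (x + h)) (x + real j * h))"
    unfolding Dh_Suc e Dh_add Suc by simp
  also have "(\<Sum>j\<le>n. real (n choose j) * Dh h j f x * Dh h (n - j) (dquot h g) (x + real j * h)) = (\<Sum>j\<le>n. real (n choose j) * ?a j)"
    by (intro sum.cong) (auto simp: Suc_diff_le Dh_Suc[symmetric] simp del: funpow.simps)
  also have "(\<Sum>j\<le>n. real (n choose j) * Dh h j (dquot h f) x * Dh h (n - j) (\<lambda>x. g (x + h)) (x + real j * h)) = (\<Sum>j\<le>n. real (n choose j) * ?a (Suc j))"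
    by (intro sum.cong) (auto simp: Dh_shift Dh_Suc[symmetric] algebra_simps simp del: funpow.simps)
  also have "(\<Sum>j\<le>n. real (n choose j) * ?a j) = ?a 0 + (\<Sum>j\<le>n. real (n choose Suc j) * ?a (Suc j))"
  proof -
    have "(\<Sum>j\<le>n. real (n choose j) * ?a j) = (\<Sum>j\<le>Suc n. real (n choose j) * ?a j)"
      by (simp del: funpow.simps)
    also have "\<dots> = ?a 0 + (\<Sum>j\<le>n. real (n choose Suc j) * ?a (Suc j))"
      by (subst sum.atMost_Suc_shift) (simp del: funpow.simps)
    finally show ?thesis .
  qed
  also have "?a 0 + (\<Sum>j\<le>n. real (n choose Suc j) * ?a (Suc j)) + (\<Sum>j\<le>n. real (n choose j) * ?a (Suc j))
      = ?a 0 + (\<Sum>j\<le>n. real (Suc n choose Suc j) * ?a (Suc j))"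
    by (simp add: sum.distrib[symmetric] distrib_right del: funpow.simps) (simp add: algebra_simps del: funpow.simps)
  also have "\<dots> = (\<Sum>j\<le>Suc n. real (Suc n choose j) * ?a j)"
    by (subst sum.atMost_Suc_shift) (simp del: funpow.simps)
  finally show ?case by (simp add: mult.assoc del: funpow.simps binomial_Suc_Suc)
qed simp

text \<open>Each difference looks a step h \<le> 1 to the right, so the support spreads to the left
  by at most 1. The resulting interval is the same for all h.\<close>

lemma Dh_zero:
  assumes "\<And>x. x \<notin> {a..b} \<Longrightarrow> f x = 0" "0 < h" "h \<le> 1" "x \<notin> {a - real k..b}"
  shows "Dh h k f x = 0"
  using assms(4)
proof (induction k arbitrary: x)
  case (Suc k)
  then have "x \<notin> {a - real k..b}" "x + h \<notin> {a - real k..b}" using assms(2,3) by auto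
  then show ?case using Suc.IH by (simp add: dquot_def)
qed (use assms(1) in simp)

lemma Dh_test_l2:
  assumes t: "test_function \<phi>" and h: "0 < h"
  shows "l2 lborel (Dh h k (D i \<phi>)) \<le> l2 lborel (D (i + k) \<phi>)"
proof (induction k arbitrary: i)
  case (Suc k)
  have "l2 lborel (dquot h (Dh h k (D i \<phi>))) \<le> l2 lborel (Dh h k (D (Suc i) \<phi>))"
    by (rule l2_dquot_le[OF Dh_has_derivative[OF test_D_has_derivative[OF t]] h Dh_Cc[OF test_D_Cc[OF t]]])
  also have "\<dots> \<le> l2 lborel (D (Suc i + k) \<phi>)" by (rule Suc)
  finally show ?case by simp
qed simp

lemma Dh_abs_le:
  assumes d: "\<And>j x. j < k \<Longrightarrow> (f j has_real_derivative f (Suc j) x) (at x)" and h: "0 < h"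
    and B: "\<And>x. \<bar>f k x\<bar> \<le> B"
  shows "\<bar>Dh h k (f 0) x\<bar> \<le> B"
proof -
  have "\<bar>Dh h j (f (k - j)) x\<bar> \<le> B" if "j \<le> k" for j x
    using that
  proof (induction j arbitrary: x)
    case (Suc j)
    have "\<bar>dquot h (Dh h j (f (k - Suc j))) x\<bar> \<le> B"
    proof (rule dquot_abs_le[OF Dh_has_derivative h])
      show "(f (k - Suc j) has_real_derivative f (k - j) x) (at x)" for x
        using d[of "k - Suc j" x] Suc.prems by (simp add: Suc_diff_Suc)
      show "\<bar>Dh h j (f (k - j)) x\<bar> \<le> B" for x using Suc by simp
    qed
    then show ?case by simp
  qed (use B in simp)
  from this[of k] show ?thesis by simp
qed

lemma Dh_test_abs_le:
  assumes t: "test_function \<phi>" and h: "0 < h"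
  shows "\<bar>Dh h k (D i \<phi>) x\<bar> \<le> l2 lborel (D (Suc (i + k)) \<phi>)"
proof -
  have "\<bar>Dh h k ((\<lambda>j. D (i + j) \<phi>) 0) x\<bar> \<le> l2 lborel (D (Suc (i + k)) \<phi>)"
    by (rule Dh_abs_le[OF _ h]) (use test_D_has_derivative[OF t] test_abs_le_l2[OF t] in \<open>auto simp del: funpow.simps\<close>)
  then show ?thesis by simp
qed

text \<open>The mean value theorem trades one difference for a derivative at a point z within h of
  x. Moving z back to x costs h times a bound for one more derivative.\<close>

lemma Dh_test_approx:
  assumes t: "test_function \<phi>"
  shows "\<exists>C. \<forall>h x. 0 < h \<longrightarrow> h \<le> 1 \<longrightarrow> \<bar>Dh h k (D i \<phi>) x - D (i + k) \<phi> x\<bar> \<le> C * h"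
proof (induction k arbitrary: i)
  case 0
  show ?case by (rule exI[of _ 0]) simp
next
  case (Suc k)
  obtain C where C: "\<And>h x. 0 < h \<Longrightarrow> h \<le> 1 \<Longrightarrow> \<bar>Dh h k (D (Suc i) \<phi>) x - D (Suc i + k) \<phi> x\<bar> \<le> C * h"
    using Suc[of "Suc i"] by blast
  let ?B = "l2 lborel (D (Suc (Suc (Suc (i + k)))) \<phi>)"
  have "\<bar>Dh h (Suc k) (D i \<phi>) x - D (i + Suc k) \<phi> x\<bar> \<le> (C + ?B) * h" if h: "0 < h" "h \<le> 1" for h x
  proof -
    obtain z where z: "x < z" "z < x + h" "dquot h (Dh h k (D i \<phi>)) x = Dh h k (D (Suc i) \<phi>) z"
      using dquot_mvt[OF Dh_has_derivative[OF test_D_has_derivative[OF t]] h(1)] by blast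
    obtain y where y: "D (Suc i + k) \<phi> z - D (Suc i + k) \<phi> x = (z - x) * D (Suc (Suc i + k)) \<phi> y"
      using MVT2[OF z(1) test_D_has_derivative[OF t]] by blast
    have "\<bar>D (Suc i + k) \<phi> z - D (Suc i + k) \<phi> x\<bar> \<le> h * ?B"
      unfolding y abs_mult using z test_abs_le_l2[OF t, of "Suc (Suc i + k)" y] by (intro mult_mono) (auto simp del: funpow.simps)
    moreover have "Dh h (Suc k) (D i \<phi>) x = Dh h k (D (Suc i) \<phi>) z" using z(3) by simp
    moreover have "i + Suc k = Suc i + k" by simp
    ultimately show ?thesis using C[OF h, of z]
      unfolding distrib_right mult.commute[of h ?B] by simp
  qed
  then show ?case by blast
qed

text \<open>By Fatou's lemma pointwise convergence suffices to carry a bound to the limit, and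
  pointwise convergence passes through differences for free.\<close>

lemma l2_Fatou:
  assumes "\<And>n. Cc (f n)" "Cc g" "\<And>x. (\<lambda>n. f n x) \<longlonglongrightarrow> g x" "\<And>n. l2 lborel (f n) \<le> b n" "b \<longlonglongrightarrow> B"
  shows "l2 lborel g \<le> B"
proof -
  have m[measurable]: "f n \<in> borel_measurable borel" for n by (rule Cc_measurable[OF assms(1)])
  have nn: "(\<integral>\<^sup>+x. ennreal ((u x)\<^sup>2) \<partial>lborel) = ennreal ((l2 lborel u)\<^sup>2)" if "Cc u" for u
    unfolding l2_square by (rule nn_integral_eq_integral) (auto intro!: Cc_integrable Cc_power2 that)
  have "0 \<le> b n" for n using assms(4)[of n] l2_nonneg[of lborel "f n"] by linarith
  then have B0: "0 \<le> B" by (intro LIMSEQ_le_const[OF assms(5)]) simp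
  have "ennreal ((l2 lborel g)\<^sup>2) = (\<integral>\<^sup>+x. liminf (\<lambda>n. ennreal ((f n x)\<^sup>2)) \<partial>lborel)"
    unfolding nn[OF assms(2), symmetric]
    by (intro nn_integral_cong lim_imp_Liminf[symmetric] tendsto_ennrealI tendsto_intros assms(3)) simp
  also have "\<dots> \<le> liminf (\<lambda>n. \<integral>\<^sup>+x. ennreal ((f n x)\<^sup>2) \<partial>lborel)"
    by (rule nn_integral_liminf) simp
  also have "\<dots> \<le> liminf (\<lambda>n. ennreal ((b n)\<^sup>2))"
    unfolding nn[OF assms(1)] by (intro Liminf_mono always_eventually allI ennreal_leI power_mono assms l2_nonneg)
  also have "\<dots> = ennreal (B\<^sup>2)"
    by (intro lim_imp_Liminf tendsto_ennrealI tendsto_intros assms) simp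
  finally have "(l2 lborel g)\<^sup>2 \<le> B\<^sup>2" by (simp add: ennreal_le_iff)
  then show ?thesis using B0 by (rule power2_le_imp_le)
qed

section \<open>Differences of functions in the closure of the test functions\<close>

lemma D_zero: "D k (\<lambda>x. 0) = (\<lambda>x. 0)"
  by (induction k) auto

text \<open>The total order i + k may be the full m although only i < m classical derivatives exist:
  differences reach the top order from below.\<close>

lemma Dh_ext_l2:
  assumes f: "f \<in> sobolev0 m" "continuous_on {0..1} f" and i: "i < m" "i + k \<le> m" and h: "0 < h"
  shows "l2 lborel (Dh h k (D i (ext f))) \<le> weak_norm (i + k) f"
proof -
  obtain \<phi> where \<phi>: "approximates m f \<phi>" using ext_approximates[OF f i(1)] by blast
  note t = approximates_test[OF \<phi>]
  show ?thesis
    by (rule l2_Fatou[OF _ _ Dh_tendsto[OF approximates_tendsto[OF \<phi> i(1)]] Dh_test_l2[OF t h] approximates_l2[OF \<phi> f(1) i(2)]])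
       (auto intro: Dh_Cc test_D_Cc t ext_Cc f i)
qed

lemma Dh_ext_abs_le:
  assumes f: "f \<in> sobolev0 m" "continuous_on {0..1} f" and i: "Suc (i + k) \<le> m" and h: "0 < h"
  shows "\<bar>Dh h k (D i (ext f)) x\<bar> \<le> weak_norm (Suc (i + k)) f"
proof -
  have i': "i < m" using i by simp
  obtain \<phi> where \<phi>: "approximates m f \<phi>" using ext_approximates[OF f i'] by blast
  note t = approximates_test[OF \<phi>]
  have "(\<lambda>n. Dh h k (D i (\<phi> n)) x) \<longlonglongrightarrow> Dh h k (D i (ext f)) x"
    by (rule Dh_tendsto[OF approximates_tendsto[OF \<phi> i']])
  from tendsto_rabs[OF this] approximates_l2[OF \<phi> f(1) i] show ?thesis
    by (rule LIMSEQ_le) (use Dh_test_abs_le[OF t h] in auto)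
qed

text \<open>For m \<ge> 2 both f and its derivative vanish at 0, so the quotient tends to 0 there,
  which is also its value by the convention for division.\<close>

lemma ext_quotient_continuous:
  assumes f: "f \<in> sobolev0 m" "continuous_on {0..1} f" and m: "2 \<le> m"
  shows "continuous_on UNIV (\<lambda>x. ext f x / x)"
proof -
  have c: "continuous_on UNIV (ext f)" using ext_continuous[OF f, of 0] m by simp
  have z: "ext f 0 = 0" "D 1 (ext f) 0 = 0" using ext_zero[OF f, of 0 0] ext_zero[OF f, of 1 0] m by auto
  have "(ext f has_real_derivative 0) (at 0)"
    using ext_has_derivative[OF f, of 0 0] m z by simp
  then have "((\<lambda>x. ext f x / x) \<longlongrightarrow> 0) (at 0)"
    by (simp add: has_field_derivative_iff z)
  then have "isCont (\<lambda>x. ext f x / x) 0" by (simp add: isCont_def)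
  moreover have "isCont (\<lambda>x. ext f x / x) x" if "x \<noteq> 0" for x
    using c that by (intro continuous_intros) (auto simp: continuous_on_eq_continuous_at)
  ultimately show ?thesis by (metis continuous_at_imp_continuous_on)
qed

lemma ext_quotient_Cc:
  assumes f: "f \<in> sobolev0 m" "continuous_on {0..1} f" and m: "2 \<le> m"
  shows "Cc (\<lambda>x. ext f x / x)"
proof (rule CcI[of _ 1])
  show "ext f x / x = 0" if "1 < \<bar>x\<bar>" for x
    using ext_zero[OF f, of 0 x] that m by force
qed (rule ext_quotient_continuous[OF assms])

text \<open>For a test function, differences of the quotient are bounded by its derivatives, and
  these by Hardy's inequality; the limit keeps the factor 2. The quotient of f itself is only
  differenced, never differentiated.\<close>

lemma Dh_ext_quotient_l2:
  assumes f: "f \<in> sobolev0 m" "continuous_on {0..1} f" and m: "2 \<le> m" and k: "Suc k \<le> m" and h: "0 < h"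
  shows "l2 lborel (Dh h k (\<lambda>x. ext f x / x)) \<le> 2 * weak_norm (Suc k) f"
proof -
  have m0: "0 < m" using m by simp
  obtain \<phi> where \<phi>: "approximates m f \<phi>" using ext_approximates[OF f m0] by blast
  note t = approximates_test[OF \<phi>]
  have t': "test_function (\<lambda>x. \<phi> n x / x)" for n using test_div_power[OF t, of n 1] by simp
  have lim: "(\<lambda>n. \<phi> n x / x) \<longlonglongrightarrow> ext f x / x" for x
    using tendsto_mult_right[OF approximates_tendsto[OF \<phi> m0, of x], of "1 / x"] by simp
  have le: "l2 lborel (Dh h k (\<lambda>x. \<phi> n x / x)) \<le> 2 * l2 lborel (D (Suc k) (\<phi> n))" for n
    using Dh_test_l2[OF t' h, of k 0] test_Hardy[OF t, of k n] by (simp del: funpow.simps(2)) (meson order_trans)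
  show ?thesis
    by (rule l2_Fatou[OF _ _ Dh_tendsto[OF lim] le tendsto_mult_left[OF approximates_l2[OF \<phi> f(1) k]]])
       (auto intro!: Dh_Cc ext_quotient_Cc[OF f m] test_D_Cc[OF t', of 0, simplified])
qed

text \<open>The converse of \<open>Dh_ext_l2\<close> as h tends to 0. A test function within e/4 of
  f is put in between: replacing f by it costs e/4 for the weak derivatives and, by
  \<open>Dh_ext_l2\<close>, e/4 for the differences, while its own differences are within e/2 of its
  derivatives once h is small.\<close>

lemma weak_norm_le_Dh_ext:
  assumes f: "f \<in> sobolev0 m" "continuous_on {0..1} f" and m: "1 \<le> m" and k: "k \<le> m" and e: "0 < e"
  shows "\<exists>h0>0. \<forall>h. 0 < h \<longrightarrow> h \<le> h0 \<longrightarrow> weak_norm k f \<le> l2 lborel (Dh h k (ext f)) + e"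
proof -
  have e4: "0 < e / 4" using e by simp
  then obtain \<phi> where t: "test_function \<phi>" and \<phi>: "weak_norm k (\<lambda>x. f x - \<phi> x) < e / 4"
    using f(1) k unfolding sobolev0_weak_norm by meson
  have fs: "f \<in> sobolev m" and ts: "\<phi> \<in> sobolev m" using f(1) t sobolev0_sobolev test_sobolev by auto
  have ts0: "\<phi> \<in> sobolev0 m"
    unfolding sobolev0_weak_norm using ts t weak_norm_test[OF test_zero]
    by (auto intro!: exI[of _ \<phi>] simp: l2_def D_zero)
  have tc: "continuous_on {0..1} \<phi>"
    using continuous_on_subset[OF test_D_continuous[OF t, of 0]] by simp
  have d0: "(\<lambda>x. f x - \<phi> x) \<in> sobolev0 m" by (rule sobolev0_diff[OF f(1) ts0])
  have dc: "continuous_on {0..1} (\<lambda>x. f x - \<phi> x)" by (intro continuous_intros f tc)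
  obtain C where C: "\<And>h x. 0 < h \<Longrightarrow> h \<le> 1 \<Longrightarrow> \<bar>Dh h k \<phi> x - D k \<phi> x\<bar> \<le> C * h"
    using Dh_test_approx[OF t, of k 0] by auto
  \<comment> \<open>The root comes from the length k + 1 of the interval that supports the k-fold
    differences; adding 1 to \<bar>C\<bar> makes the divisor in \<open>h0\<close> positive.\<close>
  define C' where "C' = (\<bar>C\<bar> + 1) * sqrt (real k + 1)"
  have C': "0 < C'" unfolding C'_def by (intro mult_pos_pos) auto
  define h0 where "h0 = min 1 (e / 2 / C')"
  have "weak_norm k f \<le> l2 lborel (Dh h k (ext f)) + e" if h: "0 < h" "h \<le> h0" for h
  proof -
    have h1: "h \<le> 1" using h by (simp add: h0_def)
    have cd: "Cc (\<lambda>x. D k \<phi> x - Dh h k \<phi> x)"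
      using Dh_Cc[OF test_D_Cc[OF t, of 0]] by (intro Cc_diff test_D_Cc t) simp
    have "weak_norm k f \<le> weak_norm k \<phi> + weak_norm k (\<lambda>x. f x - \<phi> x)"
      by (rule weak_norm_triangle[OF fs ts k])
    also have "weak_norm k \<phi> = l2 lborel (D k \<phi>)" by (rule weak_norm_test[OF t])
    also have "l2 lborel (D k \<phi>) \<le> l2 lborel (Dh h k \<phi>) + l2 lborel (\<lambda>x. D k \<phi> x - Dh h k \<phi> x)"
      using Dh_Cc[OF test_D_Cc[OF t, of 0]] by (intro l2_diff_triangle Cc_sqint test_D_Cc[OF t]) simp
    also have "l2 lborel (\<lambda>x. D k \<phi> x - Dh h k \<phi> x) \<le> (\<bar>C\<bar> + 1) * h * sqrt (1 - (0 - real k))"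
    proof (rule l2_le_sup_interval[OF cd])
      show "\<bar>D k \<phi> x - Dh h k \<phi> x\<bar> \<le> (\<bar>C\<bar> + 1) * h" for x
      proof -
        have "C * h \<le> (\<bar>C\<bar> + 1) * h" using h by (intro mult_right_mono) auto
        then show ?thesis using C[OF h(1) h1, of x] by (simp add: abs_minus_commute)
      qed
      show "D k \<phi> x - Dh h k \<phi> x = 0" if "x \<notin> {0 - real k..1}" for x
      proof -
        have "\<phi> y = 0" if "y \<notin> {0..1}" for y using test_D_zero[OF t, of y 0] that by auto
        from Dh_zero[OF this h(1) h1 that] show ?thesis using test_D_zero[OF t, of x k] that by auto
      qed
    qed (use h in auto)
    also have "\<dots> = C' * h" by (simp add: C'_def add.commute)
    also have "C' * h \<le> e / 2"
      using h(2) C' unfolding h0_def by (simp add: pos_le_divide_eq mult_ac)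
    also have "l2 lborel (Dh h k \<phi>) \<le> l2 lborel (Dh h k (ext f)) + l2 lborel (\<lambda>x. Dh h k \<phi> x - Dh h k (ext f) x)"
      using Dh_Cc[OF test_D_Cc[OF t, of 0]] Dh_Cc[OF ext_Cc[OF f, of 0]] m by (intro l2_diff_triangle Cc_sqint) auto
    also have "l2 lborel (\<lambda>x. Dh h k \<phi> x - Dh h k (ext f) x) = l2 lborel (Dh h k (D 0 (ext (\<lambda>x. f x - \<phi> x))))"
      by (simp add: ext_diff ext_test[OF t] Dh_diff l2_minus_commute)
    also have "\<dots> \<le> weak_norm (0 + k) (\<lambda>x. f x - \<phi> x)"
      by (rule Dh_ext_l2[OF d0 dc _ _ h(1)]) (use m k in auto)
    finally show ?thesis using \<phi> by simp
  qed
  moreover have "0 < h0" using e C' by (simp add: h0_def)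
  ultimately show ?thesis by blast
qed

section \<open>A maximum principle\<close>

lemma continuous_on_slice:
  assumes "continuous_on (A \<times> S) (\<lambda>(t, x). F t x)" "x \<in> S"
  shows "continuous_on A (\<lambda>t. F t x)"
proof -
  have "continuous_on A (\<lambda>t. case (t, x) of (t, x) \<Rightarrow> F t x)"
    by (rule continuous_on_compose2[OF assms(1)]) (use assms(2) in \<open>auto intro!: continuous_on_Pair continuous_on_id continuous_on_const\<close>)
  then show ?thesis by simp
qed

text \<open>The contact sets are closed in a compact rectangle, so their projections to the time
  axis are compact and there is a least contact time. It is positive because the initial inequality
  is strict.\<close>

lemma first_touching_time:
  fixes g :: "'i \<Rightarrow> real \<Rightarrow> real \<Rightarrow> real" and B :: "real \<Rightarrow> real"
  assumes I: "finite I" 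
    and cg: "\<And>i. i \<in> I \<Longrightarrow> continuous_on ({0..t1} \<times> {0..1}) (\<lambda>(t, x). g i t x)"
    and cB: "continuous_on {0..t1} B"
    and init: "\<And>i x. i \<in> I \<Longrightarrow> x \<in> {0..1} \<Longrightarrow> \<bar>g i 0 x\<bar> < B 0"
    and fail: "i' \<in> I" "t' \<in> {0..t1}" "x' \<in> {0..1}" "B t' \<le> \<bar>g i' t' x'\<bar>"
  shows "\<exists>t0 i x. 0 < t0 \<and> t0 \<le> t1 \<and> i \<in> I \<and> x \<in> {0..1} \<and> \<bar>g i t0 x\<bar> = B t0 \<and>
     (\<forall>j\<in>I. \<forall>y\<in>{0..1}. \<bar>g j t0 y\<bar> \<le> B t0 \<and> (\<forall>s. 0 \<le> s \<and> s < t0 \<longrightarrow> \<bar>g j s y\<bar> < B s))"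
proof -
  define E where "E i = {p \<in> {0..t1} \<times> {0..1}. B (fst p) \<le> \<bar>g i (fst p) (snd p)\<bar>}" for i
  have cE: "compact (E i)" if "i \<in> I" for i
  proof -
    have "continuous_on ({0..t1} \<times> {0..1}) (\<lambda>p. B (fst p))"
      by (rule continuous_on_compose2[OF cB]) (auto intro!: continuous_intros)
    moreover have "continuous_on ({0..t1} \<times> {0..1}) (\<lambda>p. \<bar>g i (fst p) (snd p)\<bar>)"
      using cg[OF that] by (intro continuous_intros) (simp add: case_prod_unfold)
    ultimately have "closedin (top_of_set ({0..t1} \<times> {0..1})) (E i)"
      unfolding E_def by (rule continuous_on_closed_Collect_le[THEN closed_subset[rotated]]) (auto simp: closed_Times)
    then show ?thesis
      by (rule closedin_compact[rotated]) (auto intro!: compact_Times)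
  qed
  define S where "S = (\<Union>i\<in>I. fst ` E i)"
  have "compact S"
    unfolding S_def using I cE
    by (intro compact_UN compact_continuous_image continuous_intros) auto
  moreover have "t' \<in> S"
    unfolding S_def E_def using fail by force
  ultimately obtain t0 where t0: "t0 \<in> S" "\<And>s. s \<in> S \<Longrightarrow> t0 \<le> s"
    using compact_attains_inf[of S] by blast
  then obtain i x where ix: "i \<in> I" "x \<in> {0..1}" "t0 \<in> {0..t1}" "B t0 \<le> \<bar>g i t0 x\<bar>"
    by (auto simp: S_def E_def)
  have less: "\<bar>g j s y\<bar> < B s" if "j \<in> I" "y \<in> {0..1}" "0 \<le> s" "s < t0" for j s y
  proof (rule ccontr)
    assume "\<not> \<bar>g j s y\<bar> < B s"
    then have "s \<in> S" unfolding S_def E_def using that ix(3) by force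
    then show False using t0(2) that(4) by fastforce
  qed
  have pos: "0 < t0" using init[OF ix(1,2)] ix(3,4) by (cases "t0 = 0") auto
  \<comment> \<open>At the contact time the bound survives as a non-strict limit from the
    left.\<close>
  have le: "\<bar>g j t0 y\<bar> \<le> B t0" if "j \<in> I" "y \<in> {0..1}" for j y
  proof -
    have "continuous_on {0..t1} (\<lambda>s. \<bar>g j s y\<bar>)"
      by (intro continuous_on_rabs continuous_on_slice[OF cg] that)
    then have lim: "((\<lambda>s. \<bar>g j s y\<bar>) \<longlongrightarrow> \<bar>g j t0 y\<bar>) (at t0 within {0..<t0})" "(B \<longlongrightarrow> B t0) (at t0 within {0..<t0})"
    proof -
      assume c: "continuous_on {0..t1} (\<lambda>s. \<bar>g j s y\<bar>)"
      have sub: "{0..<t0} \<subseteq> {0..t1}" using ix(3) by auto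
      show "((\<lambda>s. \<bar>g j s y\<bar>) \<longlongrightarrow> \<bar>g j t0 y\<bar>) (at t0 within {0..<t0})"
        using c ix(3) unfolding continuous_on_def by (blast intro: tendsto_within_subset[OF _ sub])
      show "(B \<longlongrightarrow> B t0) (at t0 within {0..<t0})"
        using cB ix(3) unfolding continuous_on_def by (blast intro: tendsto_within_subset[OF _ sub])
    qed
    have nb: "at t0 within {0..<t0} \<noteq> bot"
      using pos by (simp add: at_within_eq_bot_iff)
    show ?thesis
      by (rule tendsto_le[OF nb lim(2,1)]) (auto simp: eventually_at_filter intro!: always_eventually less_imp_le less[OF that])
  qed
  have "\<bar>g i t0 x\<bar> = B t0" using le[OF ix(1,2)] ix(4) by linarith
  then show ?thesis
    by (intro exI[of _ t0] exI[of _ i] exI[of _ x]) (use pos ix le less in auto)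
qed

text \<open>At the first contact some component has an interior space extremum, so its x-derivative
  is 0, and its rate of change must be at least that of the barrier; \<open>touch\<close> excludes
  this. A finite family under one barrier is allowed because \<omega> / x and \<rho>_x / x drive
  each other and must be bounded together.\<close>

lemma maximum_principle:
  fixes g :: "'i \<Rightarrow> real \<Rightarrow> real \<Rightarrow> real" and B :: "real \<Rightarrow> real"
  assumes I: "finite I" 
    and cg: "\<And>i. i \<in> I \<Longrightarrow> continuous_on ({0..t1} \<times> {0..1}) (\<lambda>(t, x). g i t x)"
    and dB: "\<And>t. t \<in> {0..t1} \<Longrightarrow> (B has_real_derivative B' t) (at t within {0..t1})"
    and pos: "\<And>t. t \<in> {0..t1} \<Longrightarrow> 0 < B t"
    and init: "\<And>i x. i \<in> I \<Longrightarrow> x \<in> {0..1} \<Longrightarrow> \<bar>g i 0 x\<bar> < B 0"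
    and bdry: "\<And>i t. i \<in> I \<Longrightarrow> t \<in> {0..t1} \<Longrightarrow> g i t 0 = 0 \<and> g i t 1 = 0"
    and dt: "\<And>i t x. i \<in> I \<Longrightarrow> t \<in> {0..t1} \<Longrightarrow> x \<in> {0<..<1} \<Longrightarrow>
        ((\<lambda>s. g i s x) has_real_derivative gt i t x) (at t within {0..t1})"
    and dx: "\<And>i t x. i \<in> I \<Longrightarrow> t \<in> {0..t1} \<Longrightarrow> x \<in> {0<..<1} \<Longrightarrow>
        (g i t has_real_derivative gx i t x) (at x)"
    and touch: "\<And>i t x \<sigma>. i \<in> I \<Longrightarrow> t \<in> {0..t1} \<Longrightarrow> x \<in> {0<..<1} \<Longrightarrow> \<sigma> \<in> {-1, 1} \<Longrightarrow> \<sigma> * g i t x = B t \<Longrightarrow>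
        gx i t x = 0 \<Longrightarrow> (\<And>j y. j \<in> I \<Longrightarrow> y \<in> {0..1} \<Longrightarrow> \<bar>g j t y\<bar> \<le> B t) \<Longrightarrow> \<sigma> * gt i t x < B' t"
    and i: "i \<in> I" "t \<in> {0..t1}" "x \<in> {0..1}"
  shows "\<bar>g i t x\<bar> < B t"
proof (rule ccontr)
  assume "\<not> \<bar>g i t x\<bar> < B t"
  then have fail: "B t \<le> \<bar>g i t x\<bar>" by simp
  have cB: "continuous_on {0..t1} B"
    using dB by (intro DERIV_continuous_on)
  obtain t0 j y where t0: "0 < t0" "t0 \<le> t1" and j: "j \<in> I" "y \<in> {0..1}" and eq: "\<bar>g j t0 y\<bar> = B t0"
    and le: "\<And>k z. k \<in> I \<Longrightarrow> z \<in> {0..1} \<Longrightarrow> \<bar>g k t0 z\<bar> \<le> B t0"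
    and less: "\<And>k z s. k \<in> I \<Longrightarrow> z \<in> {0..1} \<Longrightarrow> 0 \<le> s \<Longrightarrow> s < t0 \<Longrightarrow> \<bar>g k s z\<bar> < B s"
    using first_touching_time[where g = g and B = B, OF I cg cB init i fail] by blast
  have t0': "t0 \<in> {0..t1}" using t0 by simp
  have "y \<noteq> 0" "y \<noteq> 1" using bdry[OF j(1) t0'] eq pos[OF t0'] by auto
  then have y: "y \<in> {0<..<1}" using j(2) by auto
  obtain \<sigma> :: real where \<sigma>: "\<sigma> \<in> {-1, 1}" "\<sigma> * g j t0 y = B t0"
    using eq by (intro that[of "if 0 \<le> g j t0 y then 1 else -1"]) auto
  have s_le: "\<sigma> * a \<le> \<bar>a\<bar>" for a using \<sigma>(1) by auto
  have "((\<lambda>z. \<sigma> * g j t0 z) has_real_derivative \<sigma> * gx j t0 y) (at y)"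
    by (intro DERIV_cmult dx j t0' y)
  then have "\<sigma> * gx j t0 y = 0"
  proof (rule DERIV_local_max)
    show "0 < min y (1 - y)" using y by auto
    show "\<forall>z. \<bar>y - z\<bar> < min y (1 - y) \<longrightarrow> \<sigma> * g j t0 z \<le> \<sigma> * g j t0 y"
    proof (intro allI impI)
      fix z assume "\<bar>y - z\<bar> < min y (1 - y)"
      then have "z \<in> {0..1}" by auto
      then show "\<sigma> * g j t0 z \<le> \<sigma> * g j t0 y"
        using le[OF j(1), of z] s_le[of "g j t0 z"] \<sigma>(2) by linarith
    qed
  qed
  then have gx: "gx j t0 y = 0" using \<sigma>(1) by auto
  \<comment> \<open>This difference is 0 at \<open>t0\<close> with negative slope, hence positive
    just before, against the minimality of \<open>t0\<close>. Looking only to the left allows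
    \<open>t0 = t1\<close>.\<close>
  have "((\<lambda>s. \<sigma> * g j s y - B s) has_real_derivative \<sigma> * gt j t0 y - B' t0) (at t0 within {0..t1})"
    by (intro DERIV_diff DERIV_cmult dt dB j t0' y)
  moreover have "\<sigma> * gt j t0 y - B' t0 < 0"
    using touch[OF j(1) t0' y \<sigma> gx le] by simp
  ultimately obtain d where d: "0 < d" "\<And>h. 0 < h \<Longrightarrow> t0 - h \<in> {0..t1} \<Longrightarrow> h < d \<Longrightarrow>
       \<sigma> * g j t0 y - B t0 < \<sigma> * g j (t0 - h) y - B (t0 - h)"
    using has_real_derivative_neg_dec_left by blast
  define h where "h = min (d / 2) t0"
  have "0 < h" "h \<le> t0" "h < d" using d(1) t0 by (auto simp: h_def)
  then have "0 < \<sigma> * g j (t0 - h) y - B (t0 - h)"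
    using d(2)[of h] t0 \<sigma>(2) by simp
  moreover have "\<bar>g j (t0 - h) y\<bar> < B (t0 - h)"
    using \<open>0 < h\<close> \<open>h \<le> t0\<close> by (intro less j) auto
  ultimately show False using s_le[of "g j (t0 - h) y"] by linarith
qed

text \<open>F is the time integral of \<open>Ft\<close>; differentiating under the integral in x,
  and the result in time by the fundamental theorem, exchanges the derivatives. This supplies the
  time derivative of \<rho>_x, which the definition of a classical solution does not
  provide.\<close>

lemma mixed_derivative:
  fixes F Ft Fx H :: "real \<Rightarrow> real \<Rightarrow> real"
  assumes dt: "\<And>t x. t \<in> {0..t1} \<Longrightarrow> x \<in> {0<..<1} \<Longrightarrow> ((\<lambda>s. F s x) has_real_derivative Ft t x) (at t within {0..t1})"
    and dx: "\<And>t x. t \<in> {0..t1} \<Longrightarrow> x \<in> {0<..<1} \<Longrightarrow> (F t has_real_derivative Fx t x) (at x)"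
    and dtx: "\<And>t x. t \<in> {0..t1} \<Longrightarrow> x \<in> {0<..<1} \<Longrightarrow> (Ft t has_real_derivative H t x) (at x)"
    and cH: "continuous_on ({0..t1} \<times> {0..1}) (\<lambda>(t, x). H t x)"
    and t: "t \<in> {0..t1}" and x: "x \<in> {0<..<1}"
  shows "((\<lambda>s. Fx s x) has_real_derivative H t x) (at t within {0..t1})"
proof -
  have hi: "(\<lambda>s. Ft s y) integrable_on {0..r}" "integral {0..r} (\<lambda>s. Ft s y) = F r y - F 0 y"
    if "r \<in> {0..t1}" "y \<in> {0<..<1}" for r y
  proof -
    have "((\<lambda>s. Ft s y) has_integral F r y - F 0 y) {0..r}"
    proof (rule fundamental_theorem_of_calculus)
      show "((\<lambda>s. F s y) has_vector_derivative Ft s y) (at s within {0..r})" if "s \<in> {0..r}" for s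
        using dt[of s y] that \<open>r \<in> {0..t1}\<close> \<open>y \<in> {0<..<1}\<close>
        by (auto simp: has_real_derivative_iff_has_vector_derivative intro: has_vector_derivative_within_subset)
    qed (use that in simp)
    then show "(\<lambda>s. Ft s y) integrable_on {0..r}" "integral {0..r} (\<lambda>s. Ft s y) = F r y - F 0 y" by auto
  qed
  have eq: "Fx r x = Fx 0 x + integral {0..r} (\<lambda>s. H s x)" if r: "r \<in> {0..t1}" for r
  proof -
    have "((\<lambda>y. integral (cbox 0 r) (\<lambda>s. Ft s y)) has_field_derivative integral (cbox 0 r) (\<lambda>s. H s x)) (at x within {0<..<1})"
    proof (rule leibniz_rule_field_derivative)
      show "((\<lambda>y. Ft s y) has_field_derivative H s y) (at y within {0<..<1})" if "y \<in> {0<..<1}" "s \<in> cbox 0 r" for y s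
        using dtx[of s y] that r by (auto intro: has_field_derivative_at_within)
      show "(\<lambda>s. Ft s y) integrable_on cbox 0 r" if "y \<in> {0<..<1}" for y using hi(1)[OF r that] by simp
      show "continuous_on ({0<..<1} \<times> cbox 0 r) (\<lambda>(y, s). H s y)"
      proof -
        have "continuous_on ({0<..<1} \<times> cbox 0 r) (\<lambda>p. case (snd p, fst p) of (t, x) \<Rightarrow> H t x)"
          by (rule continuous_on_compose2[OF cH]) (use r in \<open>auto intro!: continuous_on_Pair continuous_on_fst continuous_on_snd continuous_on_id\<close>)
        then show ?thesis by (simp add: case_prod_unfold)
      qed
    qed (use x in auto)
    then have "((\<lambda>y. integral {0..r} (\<lambda>s. Ft s y)) has_field_derivative integral {0..r} (\<lambda>s. H s x)) (at x)"
      using x by (simp add: at_within_open[OF _ open_greaterThanLessThan])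
    then have "((\<lambda>y. F r y - F 0 y) has_field_derivative integral {0..r} (\<lambda>s. H s x)) (at x)"
      by (rule has_field_derivative_transform_within_open[of _ _ _ "{0<..<1}"]) (use x hi(2)[OF r] in auto)
    moreover have "((\<lambda>y. F r y - F 0 y) has_field_derivative Fx r x - Fx 0 x) (at x)"
      using r x by (intro DERIV_diff dx) auto
    ultimately have "integral {0..r} (\<lambda>s. H s x) = Fx r x - Fx 0 x" by (rule DERIV_unique)
    then show ?thesis by simp
  qed
  have "continuous_on {0..t1} (\<lambda>s. H s x)"
    using x by (intro continuous_on_slice[OF cH]) auto
  then have "((\<lambda>r. integral {0..r} (\<lambda>s. H s x)) has_real_derivative H t x) (at t within {0..t1})"
    using t by (rule integral_has_real_derivative)
  then have "((\<lambda>r. Fx 0 x + integral {0..r} (\<lambda>s. H s x)) has_real_derivative H t x) (at t within {0..t1})"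
    by (auto intro!: derivative_eq_intros)
  then show ?thesis
  proof (rule has_field_derivative_transform_within[OF _ zero_less_one t])
    show "Fx 0 x + integral {0..s} (\<lambda>s. H s x) = Fx s x" if "s \<in> {0..t1}" for s
      by (rule eq[OF that, symmetric])
  qed
qed

text \<open>Here d is meant to be a Sobolev distance of two times: the embedding makes it a modulus
  of continuity uniform in x, and continuity in time with values in a function space becomes joint
  continuity.\<close>

lemma joint_continuity:
  fixes F :: "real \<Rightarrow> real \<Rightarrow> real"
  assumes c: "\<And>t. t \<in> J \<Longrightarrow> continuous_on S (F t)"
    and d: "\<And>s t x. s \<in> J \<Longrightarrow> t \<in> J \<Longrightarrow> x \<in> S \<Longrightarrow> \<bar>F s x - F t x\<bar> \<le> d s t"
    and lim: "\<And>t. t \<in> J \<Longrightarrow> ((\<lambda>s. d s t) \<longlongrightarrow> 0) (at t within J)"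
  shows "continuous_on (J \<times> S) (\<lambda>(t, x). F t x)"
  unfolding continuous_on_iff
proof (intro ballI allI impI)
  fix p :: "real \<times> real" and e :: real
  assume p: "p \<in> J \<times> S" and e: "0 < e"
  obtain t x where tx: "p = (t, x)" "t \<in> J" "x \<in> S" using p by auto
  have "\<forall>\<^sub>F s in at t within J. d s t < e / 2"
    using lim[OF tx(2)] e by (intro order_tendstoD) auto
  then obtain d1 where d1: "0 < d1" "\<And>s. s \<in> J \<Longrightarrow> s \<noteq> t \<Longrightarrow> dist s t < d1 \<Longrightarrow> d s t < e / 2"
    unfolding eventually_at by auto
  obtain d2 where d2: "0 < d2" "\<And>y. y \<in> S \<Longrightarrow> dist y x < d2 \<Longrightarrow> dist (F t y) (F t x) < e / 2"
    using c[OF tx(2), unfolded continuous_on_iff, rule_format, OF tx(3), of "e / 2"] e by auto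
  have "dist (case q of (t, x) \<Rightarrow> F t x) (case p of (t, x) \<Rightarrow> F t x) < e"
    if q: "q \<in> J \<times> S" "dist q p < min d1 d2" for q
  proof -
    obtain s y where sy: "q = (s, y)" "s \<in> J" "y \<in> S" using q by auto
    have ds: "dist s t < d1" "dist y x < d2"
      using q(2) dist_fst_le[of q p] dist_snd_le[of q p] by (auto simp: sy(1) tx(1))
    have "\<bar>F s y - F t y\<bar> < e / 2"
      using d[OF sy(2) tx(2) sy(3)] d1(2)[OF sy(2) _ ds(1)] e by (cases "s = t") auto
    moreover have "\<bar>F t y - F t x\<bar> < e / 2" using d2(2)[OF sy(3) ds(2)] by (simp add: dist_real_def)
    ultimately have "\<bar>F s y - F t x\<bar> < e" by linarith
    then show ?thesis by (simp add: sy(1) tx(1) dist_real_def)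
  qed
  then show "\<exists>\<delta>>0. \<forall>q\<in>J \<times> S. dist q p < \<delta> \<longrightarrow> dist (case q of (t, x) \<Rightarrow> F t x) (case p of (t, x) \<Rightarrow> F t x) < e"
    using d1(1) d2(1) by (intro exI[of _ "min d1 d2"]) auto
qed

lemma D_ext_diff:
  assumes "f \<in> sobolev0 m" "continuous_on {0..1} f" "g \<in> sobolev0 m" "continuous_on {0..1} g" "k < m"
  shows "D k (ext (\<lambda>x. f x - g x)) = (\<lambda>x. D k (ext f) x - D k (ext g) x)"
  using assms(5)
proof (induction k)
  case (Suc k)
  have "deriv (D k (ext (\<lambda>x. f x - g x))) x = D (Suc k) (ext f) x - D (Suc k) (ext g) x" for x
    using Suc ext_has_derivative[OF assms(1,2) Suc.prems] ext_has_derivative[OF assms(3,4) Suc.prems]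
    by (intro DERIV_imp_deriv) (auto intro!: DERIV_diff simp del: funpow.simps)
  then show ?case by auto
qed (simp add: ext_diff)


section \<open>Solutions\<close>

locale boussinesq =
  fixes m :: nat and J :: "real set" and Tstar :: real and \<omega> \<rho> \<omega>t \<rho>t \<omega>x \<rho>x :: "real \<Rightarrow> real \<Rightarrow> real"
  defines "J \<equiv> {0..<Tstar}"
  assumes m: "2 \<le> m" and Tstar: "0 < Tstar"
    and \<omega>_in: "t \<in> J \<Longrightarrow> \<omega> t \<in> sobolev0 m" and \<rho>_in: "t \<in> J \<Longrightarrow> \<rho> t \<in> sobolev0 (Suc m)"
    and \<omega>_cont: "t \<in> J \<Longrightarrow> ((\<lambda>s. sobolev_norm m (\<lambda>x. \<omega> s x - \<omega> t x)) \<longlongrightarrow> 0) (at t within J)"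
    and \<rho>_cont: "t \<in> J \<Longrightarrow> ((\<lambda>s. sobolev_norm (Suc m) (\<lambda>x. \<rho> s x - \<rho> t x)) \<longlongrightarrow> 0) (at t within J)"
    and \<omega>_dt: "t \<in> J \<Longrightarrow> x \<in> {0..1} \<Longrightarrow> ((\<lambda>s. \<omega> s x) has_real_derivative \<omega>t t x) (at t within J)"
    and \<omega>_dx: "t \<in> J \<Longrightarrow> x \<in> {0..1} \<Longrightarrow> (\<omega> t has_real_derivative \<omega>x t x) (at x within {0..1})"
    and \<rho>_dt: "t \<in> J \<Longrightarrow> x \<in> {0..1} \<Longrightarrow> ((\<lambda>s. \<rho> s x) has_real_derivative \<rho>t t x) (at t within J)"
    and \<rho>_dx: "t \<in> J \<Longrightarrow> x \<in> {0..1} \<Longrightarrow> (\<rho> t has_real_derivative \<rho>x t x) (at x within {0..1})"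
    and \<rho>_eq: "t \<in> J \<Longrightarrow> x \<in> {0..1} \<Longrightarrow> \<rho>t t x + velocity (\<omega> t) x * \<rho>x t x = 0"
    and \<omega>_eq: "t \<in> J \<Longrightarrow> x \<in> {0..1} \<Longrightarrow> \<omega>t t x + velocity (\<omega> t) x * \<omega>x t x = \<rho>x t x"
    and \<omega>_jc: "continuous_on (J \<times> {0..1}) (\<lambda>(t, x). \<omega> t x)" "continuous_on (J \<times> {0..1}) (\<lambda>(t, x). \<omega>t t x)"
    and \<rho>_jc: "continuous_on (J \<times> {0..1}) (\<lambda>(t, x). \<rho> t x)" "continuous_on (J \<times> {0..1}) (\<lambda>(t, x). \<rho>t t x)"
begin

text \<open>Capital letters denote the extensions by zero to the line, on which differences can be taken
  freely: \<open>W\<close> and \<open>R\<close> stand for \<open>\<omega>\<close> and \<open>\<rho>\<close>, \<open>K\<close> for \<open>\<omega> / x\<close>, \<open>Q\<close> for \<open>\<rho>\<^sub>x / x\<close>, \<open>Om\<close> for \<open>\<Omega>\<close>; a digit counts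
  \<open>x\<close>-derivatives. The velocity \<open>u\<close> is linear on the negative axis and zero to the right of 1.\<close>

definition W where "W t = ext (\<omega> t)"
definition W1 where "W1 t = D 1 (W t)"
definition R where "R t = ext (\<rho> t)"
definition R1 where "R1 t = D 1 (R t)"
definition R2 where "R2 t = D 2 (R t)"
definition K where "K t x = W t x / x"
definition Q where "Q t x = R1 t x / x"
definition Om where "Om t x = integral {-1..1} (K t) - integral {-1..x} (K t)"
definition u where "u t x = - x * Om t x"
definition u1 where "u1 t x = W t x - Om t x"
definition u2 where "u2 t x = K t x + W1 t x"

section \<open>The solution extended to the line\<close>

lemma \<omega>_c: "t \<in> J \<Longrightarrow> continuous_on {0..1} (\<omega> t)"
  using \<omega>_dx DERIV_continuous_on by blast

lemma \<rho>_c: "t \<in> J \<Longrightarrow> continuous_on {0..1} (\<rho> t)"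
  using \<rho>_dx DERIV_continuous_on by blast

lemmas \<omega>_ok = \<omega>_in \<omega>_c
lemmas \<rho>_ok = \<rho>_in \<rho>_c

lemma W_dx: "t \<in> J \<Longrightarrow> (W t has_real_derivative W1 t x) (at x)"
  using ext_has_derivative[OF \<omega>_ok, of t 0 x] m by (simp add: W_def W1_def)

lemma R_dx: "t \<in> J \<Longrightarrow> (R t has_real_derivative R1 t x) (at x)"
  using ext_has_derivative[OF \<rho>_ok, of t 0 x] m by (simp add: R_def R1_def)

lemma R1_dx: "t \<in> J \<Longrightarrow> (R1 t has_real_derivative R2 t x) (at x)"
  using ext_has_derivative[OF \<rho>_ok, of t 1 x] m by (simp add: R_def R1_def R2_def numeral_2_eq_2)

lemma W_Cc: "t \<in> J \<Longrightarrow> Cc (W t)" and W1_Cc: "t \<in> J \<Longrightarrow> Cc (W1 t)"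
  and R_Cc: "t \<in> J \<Longrightarrow> Cc (R t)" and R1_Cc: "t \<in> J \<Longrightarrow> Cc (R1 t)" and R2_Cc: "t \<in> J \<Longrightarrow> Cc (R2 t)"
  using ext_Cc[OF \<omega>_ok, of t 0] ext_Cc[OF \<omega>_ok, of t 1] ext_Cc[OF \<rho>_ok, of t 0] ext_Cc[OF \<rho>_ok, of t 1] ext_Cc[OF \<rho>_ok, of t 2] m
  by (simp_all add: W_def W1_def R_def R1_def R2_def)

lemma K_Cc: "t \<in> J \<Longrightarrow> Cc (K t)"
  using ext_quotient_Cc[OF \<omega>_ok, of t] m by (simp add: K_def[abs_def] W_def)

lemma zero_outside:
  assumes "t \<in> J" "x \<notin> {0<..<1}"
  shows "W t x = 0" "W1 t x = 0" "R t x = 0" "R1 t x = 0" "R2 t x = 0" "K t x = 0" "Q t x = 0"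
  using ext_zero[OF \<omega>_ok _ assms(2), of t 0] ext_zero[OF \<omega>_ok _ assms(2), of t 1] 
    ext_zero[OF \<rho>_ok _ assms(2), of t 0] ext_zero[OF \<rho>_ok _ assms(2), of t 1] ext_zero[OF \<rho>_ok _ assms(2), of t 2] m assms(1)
  by (simp_all add: W_def W1_def R_def R1_def R2_def K_def Q_def)

lemma abs_bounds:
  assumes "t \<in> J"
  shows "\<bar>W t x\<bar> \<le> weak_norm 1 (\<omega> t)" "\<bar>W1 t x\<bar> \<le> weak_norm 2 (\<omega> t)"
    "\<bar>R1 t x\<bar> \<le> weak_norm 2 (\<rho> t)" "\<bar>R2 t x\<bar> \<le> weak_norm 3 (\<rho> t)"
  using ext_abs_le_weak_norm[OF \<omega>_ok, of t 0 x] ext_abs_le_weak_norm[OF \<omega>_ok, of t 1 x]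
    ext_abs_le_weak_norm[OF \<rho>_ok, of t 1 x] ext_abs_le_weak_norm[OF \<rho>_ok, of t 2 x] m assms
  by (simp_all add: W_def W1_def R1_def R_def R2_def numeral_2_eq_2 numeral_3_eq_3)

lemma xK: "t \<in> J \<Longrightarrow> x * K t x = W t x"
  using zero_outside(1)[of t 0] by (cases "x = 0") (auto simp: K_def)

text \<open>The primitive starts at -1, strictly to the left of the support of \<open>K\<close>, so
  it is differentiable on the whole line and in particular two-sidedly at 0. Further left it is
  0.\<close>

lemma integral_K_derivative:
  assumes "t \<in> J"
  shows "((\<lambda>x. integral {-1..x} (K t)) has_real_derivative K t x) (at x)"
proof (cases "x \<le> -1/2")
  case True
  have "integral {-1..y} (K t) = 0" if "y < 0" for y
  proof -
    have "integral {-1..y} (K t) = integral {-1..y} (\<lambda>_. 0)"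
      by (rule Henstock_Kurzweil_Integration.integral_cong) (use zero_outside(6)[OF assms] that in auto)
    then show ?thesis by simp
  qed
  then have "((\<lambda>x. integral {-1..x} (K t)) has_real_derivative 0) (at x)"
    using True by (intro has_field_derivative_transform_within_open[OF DERIV_const[of 0], where S = "{..<0}"]) auto
  then show ?thesis using zero_outside(6)[OF assms, of x] True by simp
next
  case False
  have "((\<lambda>x. integral {-1..x} (K t)) has_real_derivative K t x) (at x within {-1..x + 1})"
    using False by (intro integral_has_real_derivative continuous_on_subset[OF Cc_cont[OF K_Cc[OF assms]]]) auto
  then show ?thesis using False by (simp add: at_within_Icc_at)
qed

text \<open>Because x \<open>K\<close> = \<open>W\<close>, the first derivative of u contains no
  quotient; division by x enters only with the second.\<close>

lemma u_derivatives:
  assumes "t \<in> J"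
  shows "(Om t has_real_derivative - K t x) (at x)"
    and "(u t has_real_derivative u1 t x) (at x)"
    and "(u1 t has_real_derivative u2 t x) (at x)"
proof -
  show Om: "(Om t has_real_derivative - K t x) (at x)" for x
    unfolding Om_def[abs_def] using integral_K_derivative[OF assms] by (auto intro!: derivative_eq_intros)
  show "(u t has_real_derivative u1 t x) (at x)"
    unfolding u_def[abs_def] u1_def using xK[OF assms, of x]
    by (auto intro!: derivative_eq_intros Om simp: algebra_simps)
  show "(u1 t has_real_derivative u2 t x) (at x)"
    unfolding u1_def[abs_def] u2_def
    by (auto intro!: derivative_eq_intros Om W_dx assms)
qed

lemma Om_eq:
  assumes "t \<in> J" "x \<in> {-1..1}"
  shows "Om t x = integral {x..1} (K t)"
proof -
  have "integral {-1..x} (K t) + integral {x..1} (K t) = integral {-1..1} (K t)"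
    using assms by (intro Henstock_Kurzweil_Integration.integral_combine integrable_continuous_real
        continuous_on_subset[OF Cc_cont[OF K_Cc]]) auto
  then show ?thesis by (simp add: Om_def)
qed

lemma Om_outside:
  assumes "t \<in> J"
  shows "x \<le> 0 \<Longrightarrow> Om t x = Om t 0" "1 \<le> x \<Longrightarrow> Om t x = 0"
proof -
  have z: "K t y = 0" if "y \<notin> {0<..<1}" for y using zero_outside[OF assms that] by simp
  show "Om t x = Om t 0" if "x \<le> 0"
  proof (cases "x = 0")
    case False
    then have "x < 0" using that by simp
    then obtain y where "x < y" "y < 0" "Om t 0 - Om t x = (0 - x) * - K t y"
      using MVT2[of x 0 "Om t" "\<lambda>y. - K t y"] u_derivatives(1)[OF assms] by auto
    then show ?thesis using z[of y] by simp
  qed simp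
  have o1: "Om t 1 = 0" by (simp add: Om_def)
  show "Om t x = 0" if "1 \<le> x"
  proof (cases "x = 1")
    case False
    then have "1 < x" using that by simp
    then obtain y where "1 < y" "y < x" "Om t x - Om t 1 = (x - 1) * - K t y"
      using MVT2[of 1 x "Om t" "\<lambda>y. - K t y"] u_derivatives(1)[OF assms] by auto
    then show ?thesis using z[of y] o1 by simp
  qed (simp add: o1)
qed

lemma velocity_eq:
  assumes "t \<in> J" "x \<in> {0..1}"
  shows "velocity (\<omega> t) x = u t x" "Omega (\<omega> t) x = Om t x"
proof -
  have m: "(\<lambda>y. indicat_real {x..1} y *\<^sub>R K t y) \<in> borel_measurable lborel"
    using Cc_measurable[OF K_Cc[OF assms(1)]] by simp
  have "Omega (\<omega> t) x = (LINT y|lebesgue. indicat_real {x..1} y *\<^sub>R K t y)"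
    unfolding Omega_def set_lebesgue_integral_def
    by (intro Bochner_Integration.integral_cong) (use assms in \<open>auto simp: K_def W_def ext_eq indicator_def\<close>)
  also have "\<dots> = (LINT y:{x..1}|lborel. K t y)"
    unfolding set_lebesgue_integral_def by (rule integral_completion[OF m])
  also have "\<dots> = integral {x..1} (K t)"
    by (intro set_borel_integral_eq_integral borel_integrable_atLeastAtMost'
          continuous_on_subset[OF Cc_cont[OF K_Cc[OF assms(1)]]]) auto
  finally show "Omega (\<omega> t) x = Om t x" using Om_eq[OF assms(1), of x] assms(2) by simp
  then show "velocity (\<omega> t) x = u t x" by (simp add: velocity_def u_def)
qed

lemma classical_dx:
  assumes "t \<in> J" "x \<in> {0..1}"
  shows "\<omega>x t x = W1 t x" "\<rho>x t x = R1 t x"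
proof -
  have nb: "at x within {0..1} \<noteq> bot"
    using assms(2) by (simp add: trivial_limit_within)
  have uniq: "a = b" if "(f has_real_derivative a) (at x within {0..1})" "(f has_real_derivative b) (at x within {0..1})"
    for f a b
    using vector_derivative_unique_within[OF nb] that by (simp add: has_real_derivative_iff_has_vector_derivative)
  have "(\<omega> t has_real_derivative W1 t x) (at x within {0..1})"
    by (rule has_field_derivative_transform_within[OF has_field_derivative_at_within[OF W_dx[OF assms(1)]], of 1])
       (use assms(2) in \<open>auto simp: W_def ext_eq\<close>)
  then show "\<omega>x t x = W1 t x" using \<omega>_dx[OF assms] uniq by blast
  have "(\<rho> t has_real_derivative R1 t x) (at x within {0..1})"
    by (rule has_field_derivative_transform_within[OF has_field_derivative_at_within[OF R_dx[OF assms(1)]], of 1])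
       (use assms(2) in \<open>auto simp: R_def ext_eq\<close>)
  then show "\<rho>x t x = R1 t x" using \<rho>_dx[OF assms] uniq by blast
qed

section \<open>The equations on the whole line\<close>

definition Wt where "Wt t x = R1 t x - u t x * W1 t x"
definition Rt where "Rt t x = - u t x * R1 t x"

text \<open>Outside (0,1) both sides vanish together with \<open>W1\<close> and \<open>R1\<close>,
  however the velocity is extended. The equations therefore hold on the line, where differences of
  them can be taken.\<close>

lemma classical_dt:
  assumes "t \<in> J" 
  shows "Wt t x = \<omega>t t (clamp x)" "Rt t x = \<rho>t t (clamp x)"
proof -
  have c: "clamp x \<in> {0..1}" by simp
  have "\<omega>t t (clamp x) = Wt t (clamp x)" "\<rho>t t (clamp x) = Rt t (clamp x)"
    using \<omega>_eq[OF assms c] \<rho>_eq[OF assms c]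
    by (simp_all add: classical_dx[OF assms c] velocity_eq[OF assms c] Wt_def Rt_def algebra_simps)
  moreover have "Wt t (clamp x) = Wt t x" "Rt t (clamp x) = Rt t x"
  proof -
    have "x = clamp x \<or> (x \<notin> {0<..<1} \<and> clamp x \<notin> {0<..<1})"
      by (auto simp: clamp_def max_def min_def)
    then show "Wt t (clamp x) = Wt t x" "Rt t (clamp x) = Rt t x"
      using zero_outside[OF assms, of x] zero_outside[OF assms, of "clamp x"] by (auto simp: Wt_def Rt_def)
  qed
  ultimately show "Wt t x = \<omega>t t (clamp x)" "Rt t x = \<rho>t t (clamp x)" by auto
qed

lemma evolution:
  assumes "t \<in> J"
  shows "((\<lambda>s. W s x) has_real_derivative Wt t x) (at t within J)"
    "((\<lambda>s. R s x) has_real_derivative Rt t x) (at t within J)"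
  unfolding classical_dt[OF assms] W_def R_def ext_def
  using \<omega>_dt[OF assms, of "clamp x"] \<rho>_dt[OF assms, of "clamp x"] by simp_all

lemma joint_continuous_clamp:
  assumes "continuous_on (J \<times> {0..1}) (\<lambda>(t, x). F t x)"
  shows "continuous_on (J \<times> UNIV) (\<lambda>(t, x). F t (clamp x))"
proof -
  have "continuous_on (J \<times> UNIV) (\<lambda>p. case (fst p, clamp (snd p)) of (t, x) \<Rightarrow> F t x)"
    by (rule continuous_on_compose2[OF assms])
       (auto intro!: continuous_on_Pair continuous_clamp continuous_on_fst continuous_on_snd continuous_on_id)
  then show ?thesis by (simp add: case_prod_unfold)
qed

lemma jc_basic:
  "continuous_on (J \<times> UNIV) (\<lambda>(t, x). W t x)" "continuous_on (J \<times> UNIV) (\<lambda>(t, x). Wt t x)"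
  "continuous_on (J \<times> UNIV) (\<lambda>(t, x). R t x)" "continuous_on (J \<times> UNIV) (\<lambda>(t, x). Rt t x)"
proof -
  show "continuous_on (J \<times> UNIV) (\<lambda>(t, x). W t x)"
    using joint_continuous_clamp[OF \<omega>_jc(1)] by (simp add: W_def ext_def)
  show "continuous_on (J \<times> UNIV) (\<lambda>(t, x). R t x)"
    using joint_continuous_clamp[OF \<rho>_jc(1)] by (simp add: R_def ext_def)
  have "continuous_on (J \<times> UNIV) (\<lambda>(t, x). Wt t x) \<longleftrightarrow> continuous_on (J \<times> UNIV) (\<lambda>(t, x). \<omega>t t (clamp x))"
    by (rule continuous_on_cong) (auto simp: classical_dt)
  then show "continuous_on (J \<times> UNIV) (\<lambda>(t, x). Wt t x)" using joint_continuous_clamp[OF \<omega>_jc(2)] by simp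
  have "continuous_on (J \<times> UNIV) (\<lambda>(t, x). Rt t x) \<longleftrightarrow> continuous_on (J \<times> UNIV) (\<lambda>(t, x). \<rho>t t (clamp x))"
    by (rule continuous_on_cong) (auto simp: classical_dt)
  then show "continuous_on (J \<times> UNIV) (\<lambda>(t, x). Rt t x)" using joint_continuous_clamp[OF \<rho>_jc(2)] by simp
qed

section \<open>Continuity in time and a priori bounds by Sobolev norms\<close>

definition d\<omega> where "d\<omega> s t = sobolev_norm m (\<lambda>x. \<omega> s x - \<omega> t x)"
definition d\<rho> where "d\<rho> s t = sobolev_norm (Suc m) (\<lambda>x. \<rho> s x - \<rho> t x)"

lemma d_lim: "t \<in> J \<Longrightarrow> ((\<lambda>s. d\<omega> s t) \<longlongrightarrow> 0) (at t within J)" "t \<in> J \<Longrightarrow> ((\<lambda>s. d\<rho> s t) \<longlongrightarrow> 0) (at t within J)"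
  using \<omega>_cont \<rho>_cont by (simp_all add: d\<omega>_def d\<rho>_def)

lemma diff_bounds:
  assumes s: "s \<in> J" and t: "t \<in> J"
  shows "\<bar>W s x - W t x\<bar> \<le> d\<omega> s t" "\<bar>W1 s x - W1 t x\<bar> \<le> d\<omega> s t"
    "\<bar>R1 s x - R1 t x\<bar> \<le> d\<rho> s t" "\<bar>R2 s x - R2 t x\<bar> \<le> d\<rho> s t"
proof -
  have \<omega>: "(\<lambda>x. \<omega> s x - \<omega> t x) \<in> sobolev0 m" "continuous_on {0..1} (\<lambda>x. \<omega> s x - \<omega> t x)"
    by (intro sobolev0_diff \<omega>_in continuous_on_diff \<omega>_c s t)+
  have \<rho>: "(\<lambda>x. \<rho> s x - \<rho> t x) \<in> sobolev0 (Suc m)" "continuous_on {0..1} (\<lambda>x. \<rho> s x - \<rho> t x)"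
    by (intro sobolev0_diff \<rho>_in continuous_on_diff \<rho>_c s t)+
  have k\<omega>: "\<bar>D k (W s) x - D k (W t) x\<bar> \<le> d\<omega> s t" if "k < m" for k
    using ext_abs_le_weak_norm[OF \<omega> that, of x] weak_norm_le_sobolev_norm[of "Suc k" m "\<lambda>x. \<omega> s x - \<omega> t x"] that
    by (simp add: D_ext_diff[OF \<omega>_in[OF s] \<omega>_c[OF s] \<omega>_in[OF t] \<omega>_c[OF t] that] W_def d\<omega>_def)
  have k\<rho>: "\<bar>D k (R s) x - D k (R t) x\<bar> \<le> d\<rho> s t" if "k < Suc m" for k
    using ext_abs_le_weak_norm[OF \<rho> that, of x] weak_norm_le_sobolev_norm[of "Suc k" "Suc m" "\<lambda>x. \<rho> s x - \<rho> t x"] that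
    by (simp add: D_ext_diff[OF \<rho>_in[OF s] \<rho>_c[OF s] \<rho>_in[OF t] \<rho>_c[OF t] that] R_def d\<rho>_def)
  show "\<bar>W s x - W t x\<bar> \<le> d\<omega> s t" "\<bar>W1 s x - W1 t x\<bar> \<le> d\<omega> s t"
    "\<bar>R1 s x - R1 t x\<bar> \<le> d\<rho> s t" "\<bar>R2 s x - R2 t x\<bar> \<le> d\<rho> s t"
    using k\<omega>[of 0] k\<omega>[of 1] k\<rho>[of 1] k\<rho>[of 2] m by (simp_all add: W1_def R1_def R2_def)
qed

text \<open>Division by \<open>x\<close> of a function that vanishes at 0 costs one derivative.\<close>

lemma quotient_le:
  assumes "\<And>x. (f has_real_derivative f' x) (at x)" "f 0 = 0" "\<And>x. \<bar>f' x\<bar> \<le> C" "0 \<le> x"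
  shows "\<bar>f x / x\<bar> \<le> C"
proof (cases "x = 0")
  case False
  then have "0 < x" using assms(4) by simp
  then obtain z where "f x - f 0 = (x - 0) * f' z"
    using MVT2[OF _ assms(1), of 0 x] by blast
  then show ?thesis using assms(2) assms(3)[of z] \<open>0 < x\<close> by simp
next
  case True
  show ?thesis using assms(3)[of 0] True by simp
qed

lemma KQ_diff:
  assumes s: "s \<in> J" and t: "t \<in> J"
  shows "\<bar>K s x - K t x\<bar> \<le> d\<omega> s t" "\<bar>Q s x - Q t x\<bar> \<le> d\<rho> s t"
proof -
  have pos: "0 \<le> d\<omega> s t" "0 \<le> d\<rho> s t" using diff_bounds[OF s t, of 0] by auto
  have "\<bar>K s x - K t x\<bar> \<le> d\<omega> s t" "\<bar>Q s x - Q t x\<bar> \<le> d\<rho> s t" if "0 \<le> x"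
  proof -
    have "\<bar>(W s x - W t x) / x\<bar> \<le> d\<omega> s t"
      by (rule quotient_le[where f' = "\<lambda>x. W1 s x - W1 t x"])
         (use s t that zero_outside[of _ 0] diff_bounds in \<open>auto intro!: DERIV_diff W_dx\<close>)
    then show "\<bar>K s x - K t x\<bar> \<le> d\<omega> s t" by (simp add: K_def diff_divide_distrib)
    have "\<bar>(R1 s x - R1 t x) / x\<bar> \<le> d\<rho> s t"
      by (rule quotient_le[where f' = "\<lambda>x. R2 s x - R2 t x"])
         (use s t that zero_outside[of _ 0] diff_bounds in \<open>auto intro!: DERIV_diff R1_dx\<close>)
    then show "\<bar>Q s x - Q t x\<bar> \<le> d\<rho> s t" by (simp add: Q_def diff_divide_distrib)
  qed
  then show "\<bar>K s x - K t x\<bar> \<le> d\<omega> s t" "\<bar>Q s x - Q t x\<bar> \<le> d\<rho> s t"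
    using zero_outside[OF s, of x] zero_outside[OF t, of x] pos by (cases "0 \<le> x"; force)+
qed

lemma KQ_bound:
  assumes t: "t \<in> J"
  shows "\<bar>K t x\<bar> \<le> weak_norm 2 (\<omega> t)" "\<bar>Q t x\<bar> \<le> weak_norm 3 (\<rho> t)"
proof -
  have "\<bar>K t x\<bar> \<le> weak_norm 2 (\<omega> t)" "\<bar>Q t x\<bar> \<le> weak_norm 3 (\<rho> t)" if "0 \<le> x"
  proof -
    show "\<bar>K t x\<bar> \<le> weak_norm 2 (\<omega> t)" unfolding K_def
      by (rule quotient_le[where f' = "W1 t"]) (use t that zero_outside[of _ 0] abs_bounds W_dx in auto)
    show "\<bar>Q t x\<bar> \<le> weak_norm 3 (\<rho> t)" unfolding Q_def
      by (rule quotient_le[where f' = "R2 t"]) (use t that zero_outside[of _ 0] abs_bounds R1_dx in auto)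
  qed
  then show "\<bar>K t x\<bar> \<le> weak_norm 2 (\<omega> t)" "\<bar>Q t x\<bar> \<le> weak_norm 3 (\<rho> t)"
    using zero_outside[OF t, of x] by (cases "0 \<le> x"; force)+
qed

lemma Q_cont: 
  assumes t: "t \<in> J" shows "continuous_on UNIV (Q t)"
proof -
  have "((\<lambda>x. R1 t x / x) \<longlongrightarrow> 0) (at 0)"
    using R1_dx[OF t, of 0] zero_outside[OF t, of 0] by (simp add: has_field_derivative_iff)
  then have "isCont (Q t) 0" by (simp add: isCont_def Q_def[abs_def])
  moreover have "isCont (Q t) x" if "x \<noteq> 0" for x
    unfolding Q_def[abs_def] using Cc_cont[OF R1_Cc[OF t]] that
    by (intro continuous_intros) (auto simp: continuous_on_eq_continuous_at)
  ultimately show ?thesis by (metis continuous_at_imp_continuous_on)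
qed

lemma Om_diff:
  assumes s: "s \<in> J" and t: "t \<in> J" and x: "x \<in> {0..1}"
  shows "\<bar>Om s x - Om t x\<bar> \<le> d\<omega> s t"
proof -
  have c: "continuous_on {x..1} (K r)" if "r \<in> J" for r
    by (rule continuous_on_subset[OF Cc_cont[OF K_Cc[OF that]]]) simp
  have "Om s x - Om t x = integral {x..1} (\<lambda>y. K s y - K t y)"
    using Om_eq[OF s, of x] Om_eq[OF t, of x] x c[OF s] c[OF t]
    by (subst Henstock_Kurzweil_Integration.integral_diff) (auto intro: integrable_continuous_real)
  also have "norm \<dots> \<le> d\<omega> s t * (1 - x)"
    by (rule integral_bound) (use x c s t KQ_diff in \<open>auto intro!: continuous_on_diff\<close>)
  also have "\<dots> \<le> d\<omega> s t" using x diff_bounds(1)[OF s t, of 0] by (intro mult_left_le) auto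
  finally show ?thesis by simp
qed

lemma Om_bound:
  assumes t: "t \<in> J"
  shows "\<bar>Om t x\<bar> \<le> weak_norm 2 (\<omega> t)"
proof -
  have "\<bar>Om t x\<bar> \<le> weak_norm 2 (\<omega> t)" if x: "x \<in> {0..1}" for x
  proof -
    have "norm (integral {x..1} (K t)) \<le> weak_norm 2 (\<omega> t) * (1 - x)"
      by (rule integral_bound) (use x t KQ_bound in \<open>auto intro!: continuous_on_subset[OF Cc_cont[OF K_Cc]]\<close>)
    also have "\<dots> \<le> weak_norm 2 (\<omega> t)" using x by (intro mult_left_le) auto
    finally show ?thesis using Om_eq[OF t, of x] x by simp
  qed
  from this[of 0] this[of x] show ?thesis
    using Om_outside[OF t, of x] by (cases "x < 0"; cases "1 < x") auto
qed

lemma jc_more: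
  "continuous_on (J \<times> UNIV) (\<lambda>(t, x). W1 t x)" "continuous_on (J \<times> UNIV) (\<lambda>(t, x). R1 t x)"
  "continuous_on (J \<times> UNIV) (\<lambda>(t, x). R2 t x)" "continuous_on (J \<times> UNIV) (\<lambda>(t, x). K t x)"
  "continuous_on (J \<times> UNIV) (\<lambda>(t, x). Q t x)" "continuous_on (J \<times> {0..1}) (\<lambda>(t, x). Om t x)"
proof -
  show "continuous_on (J \<times> UNIV) (\<lambda>(t, x). W1 t x)" 
    by (rule joint_continuity[OF Cc_cont[OF W1_Cc] diff_bounds(2) d_lim(1)])
  show "continuous_on (J \<times> UNIV) (\<lambda>(t, x). R1 t x)" 
    by (rule joint_continuity[OF Cc_cont[OF R1_Cc] diff_bounds(3) d_lim(2)])
  show "continuous_on (J \<times> UNIV) (\<lambda>(t, x). R2 t x)" 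
    by (rule joint_continuity[OF Cc_cont[OF R2_Cc] diff_bounds(4) d_lim(2)])
  show "continuous_on (J \<times> UNIV) (\<lambda>(t, x). K t x)" 
    by (rule joint_continuity[OF Cc_cont[OF K_Cc] KQ_diff(1) d_lim(1)])
  show "continuous_on (J \<times> UNIV) (\<lambda>(t, x). Q t x)" 
    by (rule joint_continuity[OF Q_cont KQ_diff(2) d_lim(2)])
  show "continuous_on (J \<times> {0..1}) (\<lambda>(t, x). Om t x)" 
    by (rule joint_continuity[OF continuous_on_subset[OF differentiable_imp_continuous_UNIV[OF u_derivatives(1)]] Om_diff d_lim(1)]) auto
qed

end

text \<open>With \<bar>\<Omega>\<bar> \<le> 1 + a y, the left sides are the largest growth rates of
  \<omega> / x and \<rho>_x / x relative to a barrier exp y, and the right side is y' for the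
  barrier of \<open>KQ_growth\<close>. The factor 3 makes both comparisons strict.\<close>

lemma growth_rate:
  fixes a y :: real
  assumes "0 \<le> a" "0 \<le> y"
  shows "2 + a * y < (1 + y) * (3 * (1 + a))" "2 + 2 * (a * y) + a < (1 + y) * (3 * (1 + a))"
proof -
  have "(1 + y) * (3 * (1 + a)) = 3 + 3 * y + 3 * a + 3 * (a * y)" by (simp add: algebra_simps)
  moreover have "0 \<le> a * y" using assms by simp
  ultimately show "2 + a * y < (1 + y) * (3 * (1 + a))" "2 + 2 * (a * y) + a < (1 + y) * (3 * (1 + a))"
    using assms by linarith+
qed

context boussinesq
begin

section \<open>Pointwise bounds from barriers\<close>

lemma sub_J: "t1 \<in> J \<Longrightarrow> {0..t1} \<subseteq> J" "t1 \<in> J \<Longrightarrow> t \<in> {0..t1} \<Longrightarrow> t \<in> J" "t1 \<in> J \<Longrightarrow> 0 \<le> t1"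
  by (auto simp: J_def)

lemma jc_sub:
  assumes "continuous_on (J \<times> UNIV) (\<lambda>(t, x). F t x)" "t1 \<in> J"
  shows "continuous_on ({0..t1} \<times> {0..1}) (\<lambda>(t, x). F t x)"
  by (rule continuous_on_subset[OF assms(1)]) (use sub_J[OF assms(2)] in auto)

lemma primitive:
  assumes "continuous_on J a" "t1 \<in> J" "t \<in> {0..t1}"
  shows "((\<lambda>s. integral {0..s} a) has_real_derivative a t) (at t within {0..t1})"
  by (rule integral_has_real_derivative[OF continuous_on_subset[OF assms(1) sub_J(1)[OF assms(2)]] assms(3)])

lemma evolution_sub:
  assumes "t1 \<in> J" "t \<in> {0..t1}"
  shows "((\<lambda>s. W s x) has_real_derivative Wt t x) (at t within {0..t1})"
    "((\<lambda>s. R s x) has_real_derivative Rt t x) (at t within {0..t1})"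
  using evolution[OF sub_J(2)[OF assms]] sub_J(1)[OF assms(1)] by (blast intro: DERIV_subset)+

text \<open>At a contact point the transport term drops out and \<open>Wt\<close> is just
  \<open>R1\<close>. The summands 1 and t of the barrier provide the strict inequalities at time 0
  and for the slopes.\<close>

lemma W_bound:
  assumes r: "continuous_on J r" "\<And>t x. t \<in> J \<Longrightarrow> x \<in> {0..1} \<Longrightarrow> \<bar>R1 t x\<bar> \<le> r t"
    and t: "t \<in> J" and x: "x \<in> {0..1}"
  shows "\<bar>W t x\<bar> \<le> weak_norm 1 (\<omega> 0) + 1 + t + integral {0..t} r"
proof -
  have z: "0 \<in> J" using Tstar by (simp add: J_def)
  let ?B = "\<lambda>s. weak_norm 1 (\<omega> 0) + 1 + s + integral {0..s} r"
  have rp: "0 \<le> r s" if "s \<in> J" for s using r(2)[OF that, of 0] by simp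
  have ip: "0 \<le> integral {0..s} r" if "s \<in> {0..t}" for s
    using rp sub_J[OF t] that by (intro integral_nonneg integrable_continuous_real continuous_on_subset[OF r(1)]) auto
  have "\<bar>W t x\<bar> < ?B t"
  proof (rule maximum_principle[where g = "\<lambda>_. W" and B = ?B and i = "()" and I = "{()}" and ?t1.0 = t and gt = "\<lambda>_. Wt" and gx = "\<lambda>_. W1" and B' = "\<lambda>s. 1 + r s"])
    show "continuous_on ({0..t} \<times> {0..1}) (\<lambda>(t, x). W t x)" by (rule jc_sub[OF jc_basic(1) t])
    show "(?B has_real_derivative 1 + r s) (at s within {0..t})" if "s \<in> {0..t}" for s
      using primitive[OF r(1) t that] by (auto intro!: derivative_eq_intros)
    show "0 < ?B s" if "s \<in> {0..t}" for s using ip[OF that] that weak_norm_nonneg[of 1 "\<omega> 0"] unfolding atLeastAtMost_iff by linarith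
    show "\<bar>W 0 y\<bar> < ?B 0" for y using abs_bounds(1)[OF z, of y] by simp
    show "W s 0 = 0 \<and> W s 1 = 0" if "s \<in> {0..t}" for s
      using zero_outside(1)[OF sub_J(2)[OF t that]] by simp
    show "((\<lambda>s. W s y) has_real_derivative Wt s y) (at s within {0..t})" if "s \<in> {0..t}" for s y
      by (rule evolution_sub[OF t that])
    show "(W s has_real_derivative W1 s y) (at y)" if "s \<in> {0..t}" for s y
      by (rule W_dx[OF sub_J(2)[OF t that]])
    show "\<sigma> * Wt s y < 1 + r s" if "s \<in> {0..t}" "y \<in> {0<..<1}" "\<sigma> \<in> {-1, 1}" "W1 s y = 0" for s y \<sigma>
      using r(2)[OF sub_J(2)[OF t that(1)], of y] that by (auto simp: Wt_def)
  qed (use t x sub_J(3)[OF t] in auto)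
  then show ?thesis by simp
qed

text \<open>The right side is the x-derivative of \<open>Rt\<close>. It is continuous because order
  m + 1 \<ge> 3 makes \<rho> twice continuously differentiable.\<close>

lemma R1_dt:
  assumes t1: "t1 \<in> J" and t: "t \<in> {0..t1}" and x: "x \<in> {0<..<1}"
  shows "((\<lambda>s. R1 s x) has_real_derivative - (u1 t x * R1 t x + u t x * R2 t x)) (at t within {0..t1})"
proof (rule mixed_derivative[where F = R and Ft = Rt and H = "\<lambda>t x. - (u1 t x * R1 t x + u t x * R2 t x)"])
  have cO: "continuous_on ({0..t1} \<times> {0..1}) (\<lambda>(t, x). Om t x)"
    by (rule continuous_on_subset[OF jc_more(6)]) (use sub_J[OF t1] in auto)
  show "continuous_on ({0..t1} \<times> {0..1}) (\<lambda>(t, x). - (u1 t x * R1 t x + u t x * R2 t x))"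
    using cO jc_sub[OF jc_basic(1) t1] jc_sub[OF jc_more(2) t1] jc_sub[OF jc_more(3) t1]
    unfolding u1_def u_def case_prod_unfold by (intro continuous_intros) auto
  show "(Rt s has_real_derivative - (u1 s y * R1 s y + u s y * R2 s y)) (at y)" if "s \<in> {0..t1}" for s y
    unfolding Rt_def[abs_def] using u_derivatives(2)[OF sub_J(2)[OF t1 that], of y] R1_dx[OF sub_J(2)[OF t1 that], of y]
    by (auto intro!: derivative_eq_intros)
qed (use evolution_sub[OF t1] R_dx sub_J(2)[OF t1] t x in auto)

text \<open>At a contact point \<open>R1\<close> changes at relative rate \<open>- u1\<close>, so
  the barrier is an exponential with rate U; the extra t in the exponent raises the rate by 1 and
  makes the comparison strict.\<close>

lemma R1_bound:
  assumes U: "continuous_on J U" "\<And>t x. t \<in> J \<Longrightarrow> x \<in> {0<..<1} \<Longrightarrow> \<bar>u1 t x\<bar> \<le> U t"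
    and t: "t \<in> J" and x: "x \<in> {0..1}"
  shows "\<bar>R1 t x\<bar> \<le> (weak_norm 2 (\<rho> 0) + 1) * exp (t + integral {0..t} U)"
proof -
  have z: "0 \<in> J" using Tstar by (simp add: J_def)
  let ?B = "\<lambda>s. (weak_norm 2 (\<rho> 0) + 1) * exp (s + integral {0..s} U)"
  have weak_norm: "0 < weak_norm 2 (\<rho> 0) + 1" using weak_norm_nonneg[of 2 "\<rho> 0"] by linarith
  have Bp: "0 < ?B s" for s by (intro mult_pos_pos weak_norm) simp
  have "\<bar>R1 t x\<bar> < ?B t"
  proof (rule maximum_principle[where g = "\<lambda>_. R1" and B = ?B and i = "()" and I = "{()}" and ?t1.0 = t and gt = "\<lambda>_ t x. - (u1 t x * R1 t x + u t x * R2 t x)"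
         and gx = "\<lambda>_. R2" and B' = "\<lambda>s. ?B s * (1 + U s)"])
    show "continuous_on ({0..t} \<times> {0..1}) (\<lambda>(t, x). R1 t x)" by (rule jc_sub[OF jc_more(2) t])
    show "(?B has_real_derivative ?B s * (1 + U s)) (at s within {0..t})" if "s \<in> {0..t}" for s
      using primitive[OF U(1) t that] by (auto intro!: derivative_eq_intros)
    show "0 < ?B s" for s by (rule Bp)
    show "\<bar>R1 0 y\<bar> < ?B 0" for y using abs_bounds(3)[OF z, of y] by simp
    show "R1 s 0 = 0 \<and> R1 s 1 = 0" if "s \<in> {0..t}" for s
      using zero_outside(4)[OF sub_J(2)[OF t that]] by simp
    show "((\<lambda>s. R1 s y) has_real_derivative - (u1 s y * R1 s y + u s y * R2 s y)) (at s within {0..t})"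
      if "s \<in> {0..t}" "y \<in> {0<..<1}" for s y
      by (rule R1_dt[OF t that])
    show "(R1 s has_real_derivative R2 s y) (at y)" if "s \<in> {0..t}" for s y
      by (rule R1_dx[OF sub_J(2)[OF t that]])
    show "\<sigma> * - (u1 s y * R1 s y + u s y * R2 s y) < ?B s * (1 + U s)"
      if *: "s \<in> {0..t}" "y \<in> {0<..<1}" "\<sigma> * R1 s y = ?B s" "R2 s y = 0" for s y \<sigma>
    proof -
      have "\<sigma> * - (u1 s y * R1 s y + u s y * R2 s y) = ?B s * (- u1 s y)"
        unfolding *(3)[symmetric] *(4) by simp
      also have "\<dots> < ?B s * (1 + U s)"
        using U(2)[OF sub_J(2)[OF t *(1)] *(2)] by (intro mult_strict_left_mono Bp) linarith
      finally show ?thesis .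
    qed
  qed (use t x sub_J(3)[OF t] in auto)
  then show ?thesis by simp
qed

text \<open>The integral of \<open>K\<close> is split at 1 / B, or at x if that is larger. Below,
  \<bar>K\<bar> \<le> B acts on a length of at most 1 / B and contributes 1; above, \<bar>K\<bar>
  \<le> a / y integrates to the logarithm.\<close>

lemma Om_log_bound:
  assumes t: "t \<in> J" and x: "x \<in> {0..1}" and B: "1 \<le> B" "\<And>y. y \<in> {0..1} \<Longrightarrow> \<bar>K t y\<bar> \<le> B"
    and a: "\<And>y. y \<in> {0..1} \<Longrightarrow> \<bar>W t y\<bar> \<le> a"
  shows "\<bar>Om t x\<bar> \<le> 1 + a * ln B"
proof -
  define c where "c = max x (1 / B)"
  have c: "0 < c" "c \<le> 1" "x \<le> c" "1 / B \<le> c" "c - x \<le> 1 / B"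
  proof -
    have "0 < 1 / B" "1 / B \<le> 1" using B(1) by auto
    then show "0 < c" "c \<le> 1" "x \<le> c" "1 / B \<le> c" "c - x \<le> 1 / B"
      using x by (auto simp: c_def less_max_iff_disj) (auto simp: max_def)
  qed
  have cK: "continuous_on S (K t)" for S by (rule continuous_on_subset[OF Cc_cont[OF K_Cc[OF t]]]) simp
  have "norm (integral {x..c} (K t)) \<le> B * (c - x)"
    by (rule integral_bound) (use c x B cK in auto)
  also have "\<dots> \<le> B * (1 / B)" using c B by (intro mult_left_mono) auto
  finally have 1: "\<bar>integral {x..c} (K t)\<bar> \<le> 1" using B by simp
  have i: "((\<lambda>y. a / y) has_integral a * ln 1 - a * ln c) {c..1}"
    by (rule fundamental_theorem_of_calculus)
       (use c in \<open>auto intro!: derivative_eq_intros simp: has_real_derivative_iff_has_vector_derivative[symmetric]\<close>)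
  have "norm (integral {c..1} (K t)) \<le> integral {c..1} (\<lambda>y. a / y)"
  proof (rule integral_norm_bound_integral)
    show "norm (K t y) \<le> a / y" if "y \<in> {c..1}" for y
      using a[of y] that c by (auto simp: K_def abs_divide intro!: divide_right_mono)
  qed (use i cK in \<open>auto intro: integrable_continuous_real\<close>)
  also have "\<dots> = a * - ln c" using i by (simp add: integral_unique)
  also have "\<dots> \<le> a * ln B"
  proof (rule mult_left_mono)
    have "ln (1 / B) \<le> ln c" using c B by (subst ln_le_cancel_iff) auto
    then show "- ln c \<le> ln B" using B by (simp add: ln_div)
    show "0 \<le> a" using a[of 0] by simp
  qed
  finally have 2: "\<bar>integral {c..1} (K t)\<bar> \<le> a * ln B" by simp
  have "integral {x..c} (K t) + integral {c..1} (K t) = integral {x..1} (K t)"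
    using c by (intro Henstock_Kurzweil_Integration.integral_combine integrable_continuous_real cK) auto
  then show ?thesis using 1 2 Om_eq[OF t, of x] x by simp
qed

text \<open>The quotients \<open>\<omega> / x\<close> and \<open>\<rho>\<^sub>x / x\<close> satisfy transport equations whose coefficients grow at most
  like the logarithm of these quotients, hence the double exponential.\<close>

lemma KQ_growth:
  assumes a: "continuous_on J a" "\<And>t x. t \<in> J \<Longrightarrow> x \<in> {0..1} \<Longrightarrow> \<bar>W t x\<bar> \<le> a t"
    and t: "t \<in> J" and x: "x \<in> {0..1}"
  defines "y0 \<equiv> ln (1 + weak_norm 2 (\<omega> 0) + weak_norm 3 (\<rho> 0))"
  shows "\<bar>K t x\<bar> \<le> exp ((1 + y0) * exp (3 * (t + integral {0..t} a)) - 1)"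
    "\<bar>Q t x\<bar> \<le> exp ((1 + y0) * exp (3 * (t + integral {0..t} a)) - 1)"
proof -
  have z: "0 \<in> J" using Tstar by (simp add: J_def)
  \<comment> \<open>The solution of y' = 3 (1 + a) (1 + y) with y(0) = \<open>y0\<close>; exp
    \<open>y0\<close> exceeds the initial bounds of both quotients strictly.\<close>
  let ?y = "\<lambda>s. (1 + y0) * exp (3 * (s + integral {0..s} a)) - 1"
  let ?B = "\<lambda>s. exp (?y s)"
  let ?g = "\<lambda>i::bool. if i then K else Q"
  let ?gt = "\<lambda>i::bool. \<lambda>t x. if i then Wt t x / x else - (u1 t x * R1 t x + u t x * R2 t x) / x"
  let ?gx = "\<lambda>i::bool. \<lambda>t x. if i then (W1 t x * x - W t x) / (x * x) else (R2 t x * x - R1 t x) / (x * x)"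
  have weak_norm: "0 \<le> weak_norm 2 (\<omega> 0) + weak_norm 3 (\<rho> 0)" by simp
  then have y0: "0 \<le> y0" "exp y0 = 1 + weak_norm 2 (\<omega> 0) + weak_norm 3 (\<rho> 0)"
    unfolding y0_def by (auto simp del: weak_norm_nonneg intro!: exp_ln)
  have ap: "0 \<le> a s" if "s \<in> J" for s using a(2)[OF that, of 0] by simp
  have ip: "0 \<le> integral {0..s} a" if "s \<in> {0..t}" for s
    using ap sub_J[OF t] that by (intro integral_nonneg integrable_continuous_real continuous_on_subset[OF a(1)]) auto
  have yp: "0 \<le> ?y s" if "s \<in> {0..t}" for s
  proof -
    have "1 * 1 \<le> (1 + y0) * exp (3 * (s + integral {0..s} a))"
      using y0(1) ip[OF that] that by (intro mult_mono) auto
    then show ?thesis by simp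
  qed
  have "\<bar>?g i t x\<bar> < ?B t" for i
  proof (rule maximum_principle[where g = ?g and B = ?B and i = i and I = UNIV and ?t1.0 = t and gt = ?gt and gx = ?gx
        and B' = "\<lambda>s. ?B s * ((1 + ?y s) * (3 * (1 + a s)))"])
    show "continuous_on ({0..t} \<times> {0..1}) (\<lambda>(t, x). ?g i t x)" for i
      using jc_sub[OF jc_more(4) t] jc_sub[OF jc_more(5) t] by (cases i) auto
    show "(?B has_real_derivative ?B s * ((1 + ?y s) * (3 * (1 + a s)))) (at s within {0..t})" if "s \<in> {0..t}" for s
      using primitive[OF a(1) t that] by (auto intro!: derivative_eq_intros simp: algebra_simps)
    show "\<bar>?g i 0 x\<bar> < ?B 0" for i x
      using KQ_bound[OF z, of x] weak_norm_nonneg[of 2 "\<omega> 0"] weak_norm_nonneg[of 3 "\<rho> 0"] by (auto simp: y0(2))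
    show "?g i s 0 = 0 \<and> ?g i s 1 = 0" if "s \<in> {0..t}" for i s
      using zero_outside(6,7)[OF sub_J(2)[OF t that]] by simp
    show "((\<lambda>s. ?g i s y) has_real_derivative ?gt i s y) (at s within {0..t})" if "s \<in> {0..t}" "y \<in> {0<..<1}" for i s y
      using DERIV_cdivide[OF evolution_sub(1)[OF t that(1), of y], of y] DERIV_cdivide[OF R1_dt[OF t that], of y]
      by (cases i) (simp_all add: K_def Q_def)
    show "(?g i s has_real_derivative ?gx i s y) (at y)" if "s \<in> {0..t}" "y \<in> {0<..<1}" for i s y
      using DERIV_divide[OF W_dx[OF sub_J(2)[OF t that(1)]] DERIV_ident, of y] DERIV_divide[OF R1_dx[OF sub_J(2)[OF t that(1)]] DERIV_ident, of y] that(2)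
      by (cases i) (simp_all add: K_def[abs_def] Q_def[abs_def])
    show "\<sigma> * ?gt i s y < ?B s * ((1 + ?y s) * (3 * (1 + a s)))"
      if s: "s \<in> {0..t}" and y: "y \<in> {0<..<1}" and \<sigma>: "\<sigma> \<in> {-1, 1}" and eq: "\<sigma> * ?g i s y = ?B s" and gx: "?gx i s y = 0"
        and le: "\<And>j z. j \<in> UNIV \<Longrightarrow> z \<in> {0..1} \<Longrightarrow> \<bar>?g j s z\<bar> \<le> ?B s" for i s y \<sigma>
    proof -
      have sJ: "s \<in> J" using sub_J(2)[OF t s] .
      have Kb: "\<bar>K s z\<bar> \<le> ?B s" if "z \<in> {0..1}" for z using le[of True z] that by simp
      have Qb: "\<bar>Q s z\<bar> \<le> ?B s" if "z \<in> {0..1}" for z using le[of False z] that by simp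
      have y': "y \<in> {0..1}" "0 < y" using y by auto
      have Om: "\<bar>Om s y\<bar> \<le> 1 + a s * ?y s"
        using Om_log_bound[OF sJ y'(1), of "?B s" "a s"] yp[OF s] Kb a(2)[OF sJ] by simp
      have W: "\<bar>W s y\<bar> \<le> a s" by (rule a(2)[OF sJ y'(1)])
      have ap': "0 \<le> a s" "0 \<le> ?y s" using ap[OF sJ] yp[OF s] by auto
      show ?thesis
      proof (cases i)
        case True
        \<comment> \<open>At a critical point of \<open>W\<close> / x the quotient rule gives
          \<open>W1\<close> = \<open>W\<close> / x, so the transport term divided by x is
          \<open>Om\<close> times \<open>K\<close>.\<close>
        then have W1: "W1 s y = K s y" using gx y' by (simp add: K_def field_simps)
        have "\<sigma> * ?gt i s y = \<sigma> * Q s y + Om s y * (\<sigma> * K s y)"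
          using True y' by (simp add: Wt_def W1 u_def Q_def field_simps)
        also have "\<dots> \<le> ?B s + (1 + a s * ?y s) * ?B s"
        proof (rule add_mono)
          show "\<sigma> * Q s y \<le> ?B s" using Qb[OF y'(1)] \<sigma> by auto
          show "Om s y * (\<sigma> * K s y) \<le> (1 + a s * ?y s) * ?B s"
            using eq True Om by (auto intro!: mult_right_mono)
        qed
        also have "\<dots> = ?B s * (2 + a s * ?y s)" by (simp add: algebra_simps)
        also have "\<dots> < ?B s * ((1 + ?y s) * (3 * (1 + a s)))"
        proof (rule mult_strict_left_mono)
          show "2 + a s * ?y s < (1 + ?y s) * (3 * (1 + a s))" by (rule growth_rate(1)[OF ap'])
        qed simp
        finally show ?thesis .
      next
        case False
        \<comment> \<open>Likewise \<open>R2\<close> = \<open>R1\<close> / x, and the two terms of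
          the equation combine to (2 \<open>Om\<close> - \<open>W\<close>) times
          \<open>Q\<close>.\<close>
        then have R2: "R2 s y = Q s y" using gx y' by (simp add: Q_def field_simps)
        have "\<sigma> * ?gt i s y = (2 * Om s y - W s y) * (\<sigma> * Q s y)"
          using False y' by (simp add: R2 u_def u1_def Q_def field_simps)
        also have "\<dots> \<le> (2 * (1 + a s * ?y s) + a s) * ?B s"
          using eq False Om W by (simp only: if_False) (intro mult_right_mono; simp)
        also have "\<dots> = ?B s * (2 + 2 * (a s * ?y s) + a s)" by (simp add: algebra_simps)
        also have "\<dots> < ?B s * ((1 + ?y s) * (3 * (1 + a s)))"
        proof (rule mult_strict_left_mono)
          show "2 + 2 * (a s * ?y s) + a s < (1 + ?y s) * (3 * (1 + a s))" by (rule growth_rate(2)[OF ap'])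
        qed simp
        finally show ?thesis .
      qed
    qed
  qed (use t x sub_J(3)[OF t] in auto)
  from this[of True] this[of False] show "\<bar>K t x\<bar> \<le> ?B t" "\<bar>Q t x\<bar> \<le> ?B t" by simp_all
qed

end

section \<open>Energy estimates for difference quotients\<close>

lemma l2_mult_bounded:
  assumes f: "Cc f" and d: "continuous_on UNIV d" "\<And>x. \<bar>d x\<bar> \<le> B"
  shows "l2 lborel (\<lambda>x. d x * f x) \<le> B * l2 lborel f"
proof -
  have B: "0 \<le> B" using d(2)[of 0] by simp
  have c: "Cc (\<lambda>x. d x * f x)" by (rule Cc_mult2[OF f d(1)])
  have "(d x * f x)\<^sup>2 \<le> B\<^sup>2 * (f x)\<^sup>2" for x
    unfolding power_mult_distrib using power_mono[OF d(2)[of x], of 2] by (intro mult_right_mono) auto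
  then have "(LINT x|lborel. (d x * f x)\<^sup>2) \<le> (LINT x|lborel. B\<^sup>2 * (f x)\<^sup>2)"
    by (intro integral_mono Cc_integrable Cc_power2 c Cc_cmult f)
  also have "\<dots> = (B * l2 lborel f)\<^sup>2" by (simp add: power_mult_distrib l2_square)
  finally show ?thesis unfolding l2_def[of lborel "\<lambda>x. d x * f x"] using B by (intro real_le_lsqrt) auto
qed

lemma Dh_const_zero: "Dh h k (\<lambda>x. 0) = (\<lambda>x. 0)"
  by (induction k) (auto simp: dquot_def)

text \<open>Three kinds of Leibniz summands: j = 0 by parts, j = 1 with the sup bound for v', and j
  \<ge> 2 with the differences of v in L2 and those of g' in sup norm. The bounds b and c stay
  parameters because the equations for \<omega> and \<rho> distribute the top order differently; E
  is a common bound of all summands, and the binomial coefficients sum to the factor 2 ^ n.\<close>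

lemma transport_energy:
  assumes g: "\<And>x. (g has_real_derivative g' x) (at x)" "Cc g" "Cc g'"
    and v: "\<And>x. (v has_real_derivative v' x) (at x)" "continuous_on UNIV v'" "\<And>x. \<bar>v' x\<bar> \<le> U"
    and h: "0 < h" and n: "1 \<le> n" and a: "l2 lborel (Dh h n g) \<le> a" "l2 lborel (Dh h (n - 1) g') \<le> a"
    and b: "\<And>j. 2 \<le> j \<Longrightarrow> j \<le> n \<Longrightarrow> Cc (Dh h j v)" "\<And>j. 2 \<le> j \<Longrightarrow> j \<le> n \<Longrightarrow> l2 lborel (Dh h j v) \<le> b j"
    and c: "\<And>j x. 2 \<le> j \<Longrightarrow> j \<le> n \<Longrightarrow> \<bar>Dh h (n - j) g' x\<bar> \<le> c j"
    and E: "U * a\<^sup>2 \<le> E" "\<And>j. 2 \<le> j \<Longrightarrow> j \<le> n \<Longrightarrow> a * (c j * b j) \<le> E"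
  shows "\<bar>LINT x|lborel. Dh h n g x * Dh h n (\<lambda>x. v x * g' x) x\<bar> \<le> 2 ^ n * E"
proof -
  have vc: "continuous_on UNIV v" by (rule differentiable_imp_continuous_UNIV[OF v(1)])
  have U0: "0 \<le> U" using v(3)[of 0] by simp
  have a0: "0 \<le> a" using a(1) l2_nonneg by (rule order_trans[rotated])
  define G where "G j x = Dh h j v x * Dh h (n - j) g' (x + real j * h)" for j x
  have csG: "Cc (G j)" for j
    unfolding G_def[abs_def] by (intro Cc_mult2 Cc_shift Dh_Cc g Dh_continuous vc)
  have csg: "Cc (Dh h n g)" by (intro Dh_Cc g)
  define I where "I j = (LINT x|lborel. Dh h n g x * G j x)" for j
  have Ib: "\<bar>I j\<bar> \<le> a * l2 lborel (G j)" for j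
  proof -
    have "\<bar>I j\<bar> \<le> l2 lborel (Dh h n g) * l2 lborel (G j)"
      unfolding I_def by (intro l2_Cauchy_Schwarz Cc_sqint csg csG)
    also have "\<dots> \<le> a * l2 lborel (G j)" by (intro mult_right_mono a) simp
    finally show ?thesis .
  qed
  have Ij: "\<bar>I j\<bar> \<le> E" if "j \<le> n" for j
  proof -
    consider "j = 0" | "j = 1" | "2 \<le> j" by linarith
    then show ?thesis
    proof cases
      case 1
      \<comment> \<open>The summand j = 0 carries no shift, so twice its integrand is exactly v
        times the derivative of the square of the n-th difference.\<close>
      have "(LINT x|lborel. v' x * (Dh h n g x)\<^sup>2 + 2 * (Dh h n g x * G 0 x)) = 0"
      proof (rule integral_deriv_Cc)
        show "((\<lambda>x. v x * (Dh h n g x)\<^sup>2) has_real_derivative v' x * (Dh h n g x)\<^sup>2 + 2 * (Dh h n g x * G 0 x)) (at x)" for x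
          unfolding G_def using v(1)[of x] Dh_has_derivative[OF g(1), where h = h and k = n and x = x]
          by (auto intro!: derivative_eq_intros simp: algebra_simps power2_eq_square)
        show "continuous_on UNIV (\<lambda>x. v' x * (Dh h n g x)\<^sup>2 + 2 * (Dh h n g x * G 0 x))"
          by (intro continuous_intros v Cc_cont csg csG)
        show "Cc (\<lambda>x. v x * (Dh h n g x)\<^sup>2)" by (intro Cc_mult2 Cc_power2 csg vc)
      qed
      moreover have i: "integrable lborel (\<lambda>x. v' x * (Dh h n g x)\<^sup>2)" "integrable lborel (\<lambda>x. Dh h n g x * G 0 x)"
        by (intro Cc_integrable Cc_mult2 Cc_power2 csg v Cc_mult Cc_cont csG)+
      ultimately have "2 * I 0 = - (LINT x|lborel. v' x * (Dh h n g x)\<^sup>2)" by (simp add: I_def)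
      moreover have "\<bar>LINT x|lborel. v' x * (Dh h n g x)\<^sup>2\<bar> \<le> U * a\<^sup>2"
      proof -
        have "\<bar>LINT x|lborel. v' x * (Dh h n g x)\<^sup>2\<bar> \<le> (LINT x|lborel. \<bar>v' x * (Dh h n g x)\<^sup>2\<bar>)"
          by (rule integral_abs_bound)
        also have "\<dots> \<le> (LINT x|lborel. U * (Dh h n g x)\<^sup>2)"
          using v(3) by (intro integral_mono integrable_abs i(1) Cc_integrable Cc_cmult Cc_power2 csg)
             (auto simp: abs_mult intro!: mult_right_mono)
        also have "\<dots> = U * (l2 lborel (Dh h n g))\<^sup>2" by (simp add: l2_square)
        also have "\<dots> \<le> U * a\<^sup>2" by (intro mult_left_mono power_mono a U0) simp
        finally show ?thesis .
      qed
      ultimately have "2 * \<bar>I 0\<bar> \<le> U * a\<^sup>2" by linarith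
      moreover have "0 \<le> \<bar>I 0\<bar>" by simp
      ultimately have "\<bar>I 0\<bar> \<le> E" using E(1) by linarith
      then show ?thesis using 1 by simp
    next
      case 2
      have "l2 lborel (G 1) \<le> U * l2 lborel (\<lambda>x. Dh h (n - 1) g' (x + real 1 * h))"
        unfolding G_def
      proof (rule l2_mult_bounded)
        show "Cc (\<lambda>x. Dh h (n - 1) g' (x + real 1 * h))" by (intro Cc_shift Dh_Cc g)
        show "\<bar>Dh h 1 v x\<bar> \<le> U" for x using dquot_abs_le[OF v(1) h v(3)] by simp
      qed (intro Dh_continuous vc)
      also have "\<dots> \<le> U * a" unfolding l2_shift by (intro mult_left_mono a U0)
      finally have "a * l2 lborel (G 1) \<le> a * (U * a)" using a0 by (rule mult_left_mono)
      then show ?thesis using Ib[of 1] E(1) 2 by (simp add: power2_eq_square mult_ac)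
    next
      case 3
      have "l2 lborel (G j) = l2 lborel (\<lambda>x. Dh h (n - j) g' (x + real j * h) * Dh h j v x)"
        unfolding G_def by (simp only: mult.commute[of "Dh h j v _"])
      also have "\<dots> \<le> c j * l2 lborel (Dh h j v)"
        by (rule l2_mult_bounded) (use 3 that c b in \<open>auto intro!: Cc_cont[OF Cc_shift] Dh_Cc g\<close>)
      also have "\<dots> \<le> c j * b j"
        using c[OF 3 that, of 0] by (intro mult_left_mono b 3 that) linarith
      finally have "a * l2 lborel (G j) \<le> a * (c j * b j)" using a0 by (rule mult_left_mono)
      then show ?thesis using Ib[of j] E(2)[OF 3 that] by linarith
    qed
  qed
  have "(LINT x|lborel. Dh h n g x * Dh h n (\<lambda>x. v x * g' x) x)
      = (LINT x|lborel. (\<Sum>j\<le>n. real (n choose j) * (Dh h n g x * G j x)))"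
    unfolding Dh_mult G_def sum_distrib_left by (intro Bochner_Integration.integral_cong sum.cong) auto
  also have "\<dots> = (\<Sum>j\<le>n. real (n choose j) * I j)"
    unfolding I_def
    by (subst Bochner_Integration.integral_sum) (auto intro!: Cc_integrable Cc_mult csg Cc_cont csG)
  finally have "\<bar>LINT x|lborel. Dh h n g x * Dh h n (\<lambda>x. v x * g' x) x\<bar> \<le> (\<Sum>j\<le>n. \<bar>real (n choose j) * I j\<bar>)"
    by (simp only: sum_abs)
  also have "\<dots> \<le> (\<Sum>j\<le>n. real (n choose j) * E)"
    using Ij by (intro sum_mono) (auto simp: abs_mult intro!: mult_left_mono)
  also have "\<dots> = real (\<Sum>j\<le>n. n choose j) * E" by (simp add: sum_distrib_right)
  also have "\<dots> = 2 ^ n * E" by (simp only: choose_row_sum of_nat_power of_nat_numeral)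
  finally show ?thesis .
qed

section \<open>The discrete energy as a function of time\<close>

lemma integral_lborel_interval:
  assumes "Cc f" "\<And>x. x \<notin> {a..b} \<Longrightarrow> f x = 0"
  shows "(LINT x|lborel. f x) = integral {a..b} f"
proof -
  have "(LINT x|lborel. f x) = (LINT x:{a..b}|lborel. f x)"
    unfolding set_lebesgue_integral_def using assms(2)
    by (intro Bochner_Integration.integral_cong) (auto simp: indicator_def)
  also have "\<dots> = integral {a..b} f"
    by (intro set_borel_integral_eq_integral borel_integrable_atLeastAtMost'
          continuous_on_subset[OF Cc_cont[OF assms(1)]]) auto
  finally show ?thesis .
qed

lemma Dh_joint_continuous:
  assumes "continuous_on (S \<times> UNIV) (\<lambda>(t, x). F t x)"
  shows "continuous_on (S \<times> UNIV) (\<lambda>(t, x). Dh h k (F t) x)"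
proof (induction k)
  case (Suc k)
  have "continuous_on (S \<times> UNIV) (\<lambda>p. case (fst p, snd p + h) of (t, x) \<Rightarrow> Dh h k (F t) x)"
    by (rule continuous_on_compose2[OF Suc])
       (auto intro!: continuous_on_Pair continuous_on_fst continuous_on_snd continuous_on_id continuous_on_add continuous_on_const)
  then have "continuous_on (S \<times> UNIV) (\<lambda>p. (Dh h k (F (fst p)) (snd p + h) - Dh h k (F (fst p)) (snd p)) * (1 / h))"
    using Suc by (intro continuous_intros) (simp_all add: case_prod_unfold)
  then show ?case by (simp add: case_prod_unfold dquot_def[of h "Dh h k _"])
qed (use assms in simp)

lemma Dh_time_derivative:
  assumes "\<And>x. ((\<lambda>s. F s x) has_real_derivative Ft x) (at t within S)"
  shows "((\<lambda>s. Dh h k (F s) x) has_real_derivative Dh h k Ft x) (at t within S)"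
proof (induction k arbitrary: x)
  case (Suc k)
  have "((\<lambda>s. (Dh h k (F s) (x + h) - Dh h k (F s) x) / h) has_real_derivative (Dh h k Ft (x + h) - Dh h k Ft x) / h) (at t within S)"
    by (intro DERIV_cdivide DERIV_diff Suc)
  then show ?case by (simp add: dquot_def[of h "Dh h k _"])
qed (use assms in simp)

text \<open>All differences live on the fixed interval [-k, 1], so one may differentiate under a
  compact integral. Joint continuity of F and \<open>Ft\<close> is enough, since a difference in x
  commutes with the time derivative for trivial reasons.\<close>

lemma energy_derivative:
  fixes F Ft :: "real \<Rightarrow> real \<Rightarrow> real"
  assumes c: "continuous_on ({0..t1} \<times> UNIV) (\<lambda>(t, x). F t x)" "continuous_on ({0..t1} \<times> UNIV) (\<lambda>(t, x). Ft t x)"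
    and d: "\<And>t x. t \<in> {0..t1} \<Longrightarrow> ((\<lambda>s. F s x) has_real_derivative Ft t x) (at t within {0..t1})"
    and z: "\<And>t x. t \<in> {0..t1} \<Longrightarrow> x \<notin> {0..1} \<Longrightarrow> F t x = 0" "\<And>t x. t \<in> {0..t1} \<Longrightarrow> x \<notin> {0..1} \<Longrightarrow> Ft t x = 0"
    and h: "0 < h" "h \<le> 1" and t: "t \<in> {0..t1}"
  shows "((\<lambda>s. (l2 lborel (Dh h k (F s)))\<^sup>2) has_real_derivative 2 * (LINT x|lborel. Dh h k (F t) x * Dh h k (Ft t) x)) (at t within {0..t1})"
proof -
  have sl: "continuous_on UNIV (f s)" if "continuous_on ({0..t1} \<times> UNIV) (\<lambda>(t, x). f t x)" "s \<in> {0..t1}" for f :: "real \<Rightarrow> real \<Rightarrow> real" and s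
  proof -
    have "continuous_on UNIV (\<lambda>x. case (s, x) of (t, x) \<Rightarrow> f t x)"
      by (rule continuous_on_compose2[OF that(1)]) (use that(2) in \<open>auto intro!: continuous_on_Pair continuous_on_id continuous_on_const\<close>)
    then show ?thesis by simp
  qed
  have Cc: "Cc (F s)" "Cc (Ft s)" if "s \<in> {0..t1}" for s
    by (rule CcI[of _ 1], rule sl[OF c(1) that], rule z(1)[OF that], force)
       (rule CcI[of _ 1], rule sl[OF c(2) that], rule z(2)[OF that], force)
  have eq: "(l2 lborel (Dh h k (F s)))\<^sup>2 = integral (cbox (- real k) 1) (\<lambda>x. (Dh h k (F s) x)\<^sup>2)" if "s \<in> {0..t1}" for s
    unfolding l2_square
    using integral_lborel_interval[of "\<lambda>x. (Dh h k (F s) x)\<^sup>2" "- real k" 1]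
      Dh_zero[of 0 1 "F s" h _ k, OF z(1)[OF that] h] Cc_power2[OF Dh_Cc[OF Cc(1)[OF that]]] by simp
  have eq2: "2 * (LINT x|lborel. Dh h k (F t) x * Dh h k (Ft t) x) = integral (cbox (- real k) 1) (\<lambda>x. 2 * Dh h k (F t) x * Dh h k (Ft t) x)"
  proof -
    have "Cc (\<lambda>x. 2 * Dh h k (F t) x * Dh h k (Ft t) x)"
      unfolding mult.assoc by (intro Cc_cmult Cc_mult Cc_cont Dh_Cc Cc t)
    then show ?thesis
      using integral_lborel_interval[of "\<lambda>x. 2 * Dh h k (F t) x * Dh h k (Ft t) x" "- real k" 1]
        Dh_zero[of 0 1 "F t" h _ k, OF z(1)[OF t] h] by (simp add: mult.assoc)
  qed
  have "((\<lambda>s. integral (cbox (- real k) 1) (\<lambda>x. (Dh h k (F s) x)\<^sup>2)) has_field_derivative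
      integral (cbox (- real k) 1) (\<lambda>x. 2 * Dh h k (F t) x * Dh h k (Ft t) x)) (at t within {0..t1})"
  proof (rule leibniz_rule_field_derivative)
    show "((\<lambda>s. (Dh h k (F s) x)\<^sup>2) has_field_derivative 2 * Dh h k (F s) x * Dh h k (Ft s) x) (at s within {0..t1})"
      if "s \<in> {0..t1}" for s x
      using Dh_time_derivative[OF d[OF that], where h = h and k = k and x = x] by (auto intro!: derivative_eq_intros)
    show "(\<lambda>x. (Dh h k (F s) x)\<^sup>2) integrable_on cbox (- real k) 1" if "s \<in> {0..t1}" for s
      by (intro integrable_continuous continuous_on_subset[OF Cc_cont[OF Cc_power2[OF Dh_Cc[OF Cc(1)[OF that]]]]]) auto
    show "continuous_on ({0..t1} \<times> cbox (- real k) 1) (\<lambda>(s, x). 2 * Dh h k (F s) x * Dh h k (Ft s) x)"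
      using Dh_joint_continuous[OF c(1), where h = h and k = k] Dh_joint_continuous[OF c(2), where h = h and k = k]
      unfolding case_prod_unfold by (intro continuous_intros) (auto intro: continuous_on_subset)
  qed (use t in auto)
  then show ?thesis unfolding eq2
    by (rule has_field_derivative_transform_within[OF _ zero_less_one t]) (simp add: eq)
qed

text \<open>The integral form suits the weak norms, for which only continuity in time is known. The
  function \<open>?H\<close> is decreasing because its derivative has the sign of the assumed
  inequality.\<close>

lemma Gronwall_integral:
  fixes G :: "real \<Rightarrow> real"
  assumes c: "continuous_on {0..t1} G" and M: "0 \<le> M" and t1: "0 \<le> t1"
    and le: "\<And>t. t \<in> {0..t1} \<Longrightarrow> G t \<le> A + M * integral {0..t} G"
  shows "G t1 \<le> A * exp (M * t1)"
proof -
  let ?H = "\<lambda>t. exp (- M * t) * (A + M * integral {0..t} G)"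
  have "((\<lambda>s. integral {0..s} G) has_real_derivative G t) (at t within {0..t1})" if "t \<in> {0..t1}" for t
    by (rule integral_has_real_derivative[OF c that])
  then have d: "(?H has_real_derivative exp (- M * t) * M * (G t - (A + M * integral {0..t} G))) (at t within {0..t1})"
    if "t \<in> {0..t1}" for t
    using that by (auto intro!: derivative_eq_intros simp: algebra_simps)
  have "?H t1 \<le> ?H 0"
  proof (rule DERIV_nonpos_imp_decreasing_open[OF t1])
    show "\<exists>y. (?H has_real_derivative y) (at t) \<and> y \<le> 0" if "0 < t" "t < t1" for t
    proof (intro exI conjI)
      show "(?H has_real_derivative exp (- M * t) * M * (G t - (A + M * integral {0..t} G))) (at t)"
        using d[of t] that by (simp add: at_within_Icc_at)
      show "exp (- M * t) * M * (G t - (A + M * integral {0..t} G)) \<le> 0"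
        using le[of t] that M by (intro mult_nonneg_nonpos) auto
    qed
    show "continuous_on {0..t1} ?H" using d by (rule DERIV_continuous_on)
  qed
  then have "exp (M * t1) * ?H t1 \<le> exp (M * t1) * A" by (intro mult_left_mono) auto
  then have "A + M * integral {0..t1} G \<le> A * exp (M * t1)"
    by (simp add: mult.assoc[symmetric] exp_add[symmetric] mult.commute)
  then show ?thesis using le[of t1] t1 by simp
qed

context boussinesq
begin

text \<open>Two differences are traded for derivatives, which turns u into \<open>K\<close> +
  \<open>W1\<close>: Hardy contributes 2 and \<open>W1\<close> contributes 1 to the factor 3. So j
  differences of the velocity cost only j - 1 derivatives of \<omega>. For j < 2 there need not be
  compact support, as u is linear on the negative axis.\<close>

lemma Dh_u:
  assumes t: "t \<in> J" and h: "0 < h" and j: "2 \<le> j" "j \<le> Suc m"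
  shows "Cc (Dh h j (u t))" "l2 lborel (Dh h j (u t)) \<le> 3 * weak_norm (j - 1) (\<omega> t)"
proof -
  have "j = Suc (Suc (j - 2))" using j(1) by simp
  then obtain i where i: "j = Suc (Suc i)" ..
  then have im: "Suc i \<le> m" using j by simp
  have d: "(Dh h (Suc i) (u t) has_real_derivative Dh h (Suc i) (u1 t) x) (at x)" for x
    by (rule Dh_has_derivative[OF u_derivatives(2)[OF t]])
  have d1: "(Dh h i (u1 t) has_real_derivative Dh h i (u2 t) x) (at x)" for x
    by (rule Dh_has_derivative[OF u_derivatives(3)[OF t]])
  have c2: "Cc (Dh h i (u2 t))"
    unfolding u2_def[abs_def] by (intro Dh_Cc Cc_add K_Cc W1_Cc t)
  have c1: "Cc (Dh h (Suc i) (u1 t))" using dquot_Cc_of_deriv[OF d1 h c2] by simp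
  show "Cc (Dh h j (u t))" using dquot_Cc_of_deriv[OF d h c1] i by simp
  have "l2 lborel (Dh h j (u t)) \<le> l2 lborel (Dh h (Suc i) (u1 t))"
    using l2_dquot_le[OF d h c1] i by simp
  also have "\<dots> \<le> l2 lborel (Dh h i (u2 t))"
    using l2_dquot_le[OF d1 h c2] by simp
  also have "\<dots> \<le> l2 lborel (Dh h i (K t)) + l2 lborel (Dh h i (W1 t))"
    unfolding u2_def[abs_def] Dh_add by (intro l2_triangle Cc_sqint Dh_Cc K_Cc W1_Cc t)
  also have "\<dots> \<le> 2 * weak_norm (Suc i) (\<omega> t) + weak_norm (Suc i) (\<omega> t)"
    using Dh_ext_quotient_l2[OF \<omega>_ok m im h, OF t t] Dh_ext_l2[OF \<omega>_ok _ _ h, of t 1 i] im m t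
    by (intro add_mono) (simp_all add: K_def[abs_def] W1_def W_def)
  finally show "l2 lborel (Dh h j (u t)) \<le> 3 * weak_norm (j - 1) (\<omega> t)" using i by simp
qed

text \<open>In the Leibniz expansion of the transport term the zeroth summand is integrated by parts and the
  others contain at most the top-order norms; only for \<open>j = Suc k\<close> in the equation for \<open>\<rho>\<close> does the top
  order fall on \<open>u\<close>, which is why a pointwise bound for \<open>\<rho>\<^sub>x\<close> is needed.\<close>

lemma energy_rate:
  assumes t: "t \<in> J" and k: "1 \<le> k" "k \<le> m" and h: "0 < h"
    and C: "\<And>x. \<bar>u1 t x\<bar> \<le> C" "\<And>x. \<bar>R1 t x\<bar> \<le> C" "weak_norm (k - 1) (\<omega> t) \<le> C"
  defines "G \<equiv> (weak_norm k (\<omega> t))\<^sup>2 + (weak_norm (Suc k) (\<rho> t))\<^sup>2"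
  shows "2 * (LINT x|lborel. Dh h k (W t) x * Dh h k (Wt t) x)
     + 2 * (LINT x|lborel. Dh h (Suc k) (R t) x * Dh h (Suc k) (Rt t) x) \<le> (2 + 18 * 2 ^ k * C) * G"
proof -
  define a where "a = weak_norm k (\<omega> t)"
  define b where "b = weak_norm (Suc k) (\<rho> t)"
  have C0: "0 \<le> C" using C(1)[of 0] by simp
  have ab: "0 \<le> a" "0 \<le> b" by (simp_all add: a_def b_def)
  have G: "G = a\<^sup>2 + b\<^sup>2" by (simp add: G_def a_def b_def)
  have abG: "a * b \<le> G" "a\<^sup>2 \<le> G" "b\<^sup>2 \<le> G"
  proof -
    have "2 * (a * b) \<le> G" using sum_squares_bound[of a b] by (simp add: G)
    moreover have "0 \<le> a * b" using ab by simp
    ultimately show "a * b \<le> G" by linarith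
  qed (simp_all add: G)
  have uc: "continuous_on UNIV (u1 t)" by (rule differentiable_imp_continuous_UNIV[OF u_derivatives(3)[OF t]])
  have weak_norm\<omega>: "weak_norm i (\<omega> t) \<le> weak_norm j (\<omega> t)" if "i \<le> j" "j \<le> m" for i j
    by (rule weak_norm_mono_le[OF \<omega>_ok that, OF t t])
  have weak_norm\<rho>: "weak_norm i (\<rho> t) \<le> weak_norm j (\<rho> t)" if "i \<le> j" "j \<le> Suc m" for i j
    by (rule weak_norm_mono_le[OF \<rho>_ok that, OF t t])
  have lW: "l2 lborel (Dh h k (W t)) \<le> a"
    using Dh_ext_l2[OF \<omega>_ok _ _ h, of t 0 k] t k m by (simp add: a_def W_def)
  have lW1: "l2 lborel (Dh h (k - 1) (W1 t)) \<le> a"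
    using Dh_ext_l2[OF \<omega>_ok _ _ h, of t 1 "k - 1"] t k m by (simp add: a_def W1_def W_def)
  have lR: "l2 lborel (Dh h (Suc k) (R t)) \<le> b"
    using Dh_ext_l2[OF \<rho>_ok _ _ h, of t 0 "Suc k"] t k m by (simp add: b_def R_def)
  have lR1: "l2 lborel (Dh h k (R1 t)) \<le> b"
    using Dh_ext_l2[OF \<rho>_ok _ _ h, of t 1 k] t k m by (simp add: b_def R1_def R_def)
  have cu: "Cc (\<lambda>x. u t x * W1 t x)"
    by (intro Cc_mult2 W1_Cc t differentiable_imp_continuous_UNIV[OF u_derivatives(2)[OF t]])
  have i1: "(LINT x|lborel. Dh h k (W t) x * Dh h k (Wt t) x)
      = (LINT x|lborel. Dh h k (W t) x * Dh h k (R1 t) x) - (LINT x|lborel. Dh h k (W t) x * Dh h k (\<lambda>x. u t x * W1 t x) x)"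
    unfolding Wt_def[abs_def] Dh_diff right_diff_distrib
    by (intro Bochner_Integration.integral_diff Cc_integrable Cc_mult Cc_cont Dh_Cc W_Cc R1_Cc t cu)
  have "(\<lambda>x. Rt t x) = (\<lambda>x. 0 - u t x * R1 t x)" by (simp add: Rt_def)
  then have "Dh h (Suc k) (Rt t) = (\<lambda>x. - Dh h (Suc k) (\<lambda>x. u t x * R1 t x) x)"
    using Dh_diff[where h = h and k = "Suc k" and f = "\<lambda>x. 0" and g = "\<lambda>x. u t x * R1 t x"]
    by (simp only: Dh_const_zero diff_0)
  then have i2: "(LINT x|lborel. Dh h (Suc k) (R t) x * Dh h (Suc k) (Rt t) x)
      = - (LINT x|lborel. Dh h (Suc k) (R t) x * Dh h (Suc k) (\<lambda>x. u t x * R1 t x) x)"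
    by (simp del: funpow.simps)
  have "\<bar>LINT x|lborel. Dh h k (W t) x * Dh h k (R1 t) x\<bar> \<le> l2 lborel (Dh h k (W t)) * l2 lborel (Dh h k (R1 t))"
    by (intro l2_Cauchy_Schwarz Cc_sqint Dh_Cc W_Cc R1_Cc t)
  also have "\<dots> \<le> a * b" by (intro mult_mono lW lR1 ab) simp
  finally have e1: "\<bar>LINT x|lborel. Dh h k (W t) x * Dh h k (R1 t) x\<bar> \<le> G" using abG by linarith
  have e2: "\<bar>LINT x|lborel. Dh h k (W t) x * Dh h k (\<lambda>x. u t x * W1 t x) x\<bar> \<le> 2 ^ k * (3 * C * G)"
  proof (rule transport_energy[OF W_dx W_Cc W1_Cc u_derivatives(2) uc C(1) h k(1) lW lW1 Dh_u(1), OF t t t t t h])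
    show "l2 lborel (Dh h j (u t)) \<le> 3 * weak_norm (j - 1) (\<omega> t)" if "2 \<le> j" "j \<le> k" for j
      using that k by (intro Dh_u t h) auto
    show "\<bar>Dh h (k - j) (W1 t) x\<bar> \<le> weak_norm (k - j + 2) (\<omega> t)" if "2 \<le> j" "j \<le> k" for j x
      using Dh_ext_abs_le[OF \<omega>_ok _ h, of t 1 "k - j" x] that k t by (simp add: W1_def W_def)
    have "C * a\<^sup>2 \<le> 3 * C * G" using abG C0 by (intro mult_mono) auto
    then show "C * a\<^sup>2 \<le> 3 * C * G" .
    \<comment> \<open>The sup norm raises the order of one factor to k - j + 2 \<le> k, while the
      other has order j - 1 \<le> k - 1 and is bounded by C, the constant known from the previous
      order.\<close>
    show "a * (weak_norm (k - j + 2) (\<omega> t) * (3 * weak_norm (j - 1) (\<omega> t))) \<le> 3 * C * G" if j: "2 \<le> j" "j \<le> k" for j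
    proof -
      have "weak_norm (k - j + 2) (\<omega> t) \<le> a" unfolding a_def using j k by (intro weak_norm\<omega>) auto
      moreover have "weak_norm (j - 1) (\<omega> t) \<le> C" 
        using j k by (intro order_trans[OF weak_norm\<omega>[of "j - 1" "k - 1"] C(3)]) auto
      ultimately have "a * (weak_norm (k - j + 2) (\<omega> t) * (3 * weak_norm (j - 1) (\<omega> t))) \<le> a * (a * (3 * C))"
        using ab by (intro mult_left_mono mult_mono) auto
      also have "\<dots> = 3 * C * a\<^sup>2" by (simp add: power2_eq_square)
      also have "\<dots> \<le> 3 * C * G" using abG C0 by (intro mult_left_mono) auto
      finally show ?thesis .
    qed
  qed (use k in auto)
  have e3: "\<bar>LINT x|lborel. Dh h (Suc k) (R t) x * Dh h (Suc k) (\<lambda>x. u t x * R1 t x) x\<bar> \<le> 2 ^ (Suc k) * (3 * C * G)"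
  proof (rule transport_energy[OF R_dx R_Cc R1_Cc u_derivatives(2) uc C(1) h _ lR _ Dh_u(1), OF t t t t _ _ t h])
    show "l2 lborel (Dh h j (u t)) \<le> 3 * weak_norm (j - 1) (\<omega> t)" if "2 \<le> j" "j \<le> Suc k" for j
      using that k by (intro Dh_u t h) auto
    show "\<bar>Dh h (Suc k - j) (R1 t) x\<bar> \<le> (if j = Suc k then C else weak_norm (Suc k - j + 2) (\<rho> t))" if "2 \<le> j" "j \<le> Suc k" for j x
    proof (cases "j = Suc k")
      case False
      then show ?thesis
        using Dh_ext_abs_le[OF \<rho>_ok _ h, of t 1 "Suc k - j" x] that k t by (simp add: R1_def R_def)
    qed (use C(2) in simp)
    show "C * b\<^sup>2 \<le> 3 * C * G" using abG C0 by (intro mult_mono) auto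
    show "b * ((if j = Suc k then C else weak_norm (Suc k - j + 2) (\<rho> t)) * (3 * weak_norm (j - 1) (\<omega> t))) \<le> 3 * C * G" if j: "2 \<le> j" "j \<le> Suc k" for j
    proof (cases "j = Suc k")
      case True
      have "b * (C * (3 * a)) = 3 * C * (a * b)" by simp
      also have "\<dots> \<le> 3 * C * G" using abG C0 by (intro mult_left_mono) auto
      finally show ?thesis using True by (simp add: a_def)
    next
      case False
      have "weak_norm (Suc k - j + 2) (\<rho> t) \<le> b" unfolding b_def using j k False by (intro weak_norm\<rho>) auto
      moreover have "weak_norm (j - 1) (\<omega> t) \<le> C" 
        using j k False by (intro order_trans[OF weak_norm\<omega>[of "j - 1" "k - 1"] C(3)]) auto
      ultimately have "b * (weak_norm (Suc k - j + 2) (\<rho> t) * (3 * weak_norm (j - 1) (\<omega> t))) \<le> b * (b * (3 * C))"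
        using ab by (intro mult_left_mono mult_mono) auto
      also have "\<dots> = 3 * C * b\<^sup>2" by (simp add: power2_eq_square)
      also have "\<dots> \<le> 3 * C * G" using abG C0 by (intro mult_left_mono) auto
      finally show ?thesis using False by simp
    qed
  qed (use k lR1 in auto)
  \<comment> \<open>The constant collects 2 from the source term, 2 * 3 * 2 ^ k from \<omega> and 2
    * 3 * 2 ^ (k + 1) from \<rho>.\<close>
  have eq: "(2 + 18 * 2 ^ k * C) * G = 2 * G + 2 * (2 ^ k * (3 * C * G)) + 2 * (2 ^ (Suc k) * (3 * C * G))"
    by (simp add: algebra_simps)
  have arith: "2 * (p - q) + 2 * - r \<le> 2 * G + 2 * Y + 2 * Z" if "\<bar>p\<bar> \<le> G" "\<bar>q\<bar> \<le> Y" "\<bar>r\<bar> \<le> Z" for p q r Y Z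
    using abs_le_D1[OF that(1)] abs_le_D2[OF that(2)] abs_le_D2[OF that(3)] by simp
  show ?thesis unfolding i1 i2 eq by (rule arith[OF e1 e2 e3])
qed


section \<open>From the discrete energy to the Sobolev norms\<close>

lemma Wt_Rt_zero: "t \<in> J \<Longrightarrow> x \<notin> {0..1} \<Longrightarrow> Wt t x = 0" "t \<in> J \<Longrightarrow> x \<notin> {0..1} \<Longrightarrow> Rt t x = 0"
  using zero_outside[of t x] by (auto simp: Wt_def Rt_def)

lemma weak_norm_diff:
  assumes s: "s \<in> J" and t: "t \<in> J"
  shows "k \<le> m \<Longrightarrow> \<bar>weak_norm k (\<omega> s) - weak_norm k (\<omega> t)\<bar> \<le> d\<omega> s t"
    "k \<le> Suc m \<Longrightarrow> \<bar>weak_norm k (\<rho> s) - weak_norm k (\<rho> t)\<bar> \<le> d\<rho> s t"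
proof -
  have \<omega>: "\<omega> s \<in> sobolev m" "\<omega> t \<in> sobolev m" and \<rho>: "\<rho> s \<in> sobolev (Suc m)" "\<rho> t \<in> sobolev (Suc m)"
    using \<omega>_in \<rho>_in s t sobolev0_sobolev by auto
  show "\<bar>weak_norm k (\<omega> s) - weak_norm k (\<omega> t)\<bar> \<le> d\<omega> s t" if k: "k \<le> m"
    using weak_norm_triangle[OF \<omega> k] weak_norm_triangle[OF \<omega>(2,1) k] weak_norm_minus_commute[OF \<omega> k]
      weak_norm_le_sobolev_norm[OF k, of "\<lambda>x. \<omega> s x - \<omega> t x"] by (simp add: d\<omega>_def abs_le_iff)
  show "\<bar>weak_norm k (\<rho> s) - weak_norm k (\<rho> t)\<bar> \<le> d\<rho> s t" if k: "k \<le> Suc m"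
    using weak_norm_triangle[OF \<rho> k] weak_norm_triangle[OF \<rho>(2,1) k] weak_norm_minus_commute[OF \<rho> k]
      weak_norm_le_sobolev_norm[OF k, of "\<lambda>x. \<rho> s x - \<rho> t x"] by (simp add: d\<rho>_def abs_le_iff)
qed

lemma continuous_of_diff:
  fixes q :: "real \<Rightarrow> real"
  assumes "\<And>s t. s \<in> J \<Longrightarrow> t \<in> J \<Longrightarrow> \<bar>q s - q t\<bar> \<le> d s t" "\<And>t. t \<in> J \<Longrightarrow> ((\<lambda>s. d s t) \<longlongrightarrow> 0) (at t within J)"
  shows "continuous_on J q"
  unfolding continuous_on_def
proof (intro ballI)
  fix t assume t: "t \<in> J"
  have "\<forall>\<^sub>F s in at t within J. norm (q s - q t) \<le> d s t"
    using assms(1)[OF _ t] by (auto simp: eventually_at_filter)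
  then show "(q \<longlongrightarrow> q t) (at t within J)"
    by (rule LIM_zero_cancel[OF Lim_null_comparison[OF _ assms(2)[OF t]]])
qed

lemma weak_norm_continuous:
  "k \<le> m \<Longrightarrow> continuous_on J (\<lambda>t. weak_norm k (\<omega> t))" "k \<le> Suc m \<Longrightarrow> continuous_on J (\<lambda>t. weak_norm k (\<rho> t))"
  by (rule continuous_of_diff[OF weak_norm_diff(1) d_lim(1)]; assumption)
     (rule continuous_of_diff[OF weak_norm_diff(2) d_lim(2)]; assumption)

text \<open>The full norms appear on the right because \<open>energy_rate\<close> bounds the growth
  of the differences by them; this makes the estimate uniform in h. At time 0 the differences are
  below the full norms as well.\<close>

lemma energy_integral_bound:
  assumes k: "1 \<le> k" "k \<le> m" and t1: "t1 \<in> J" and h: "0 < h" "h \<le> 1"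
    and C: "\<And>t x. t \<in> J \<Longrightarrow> \<bar>u1 t x\<bar> \<le> C" "\<And>t x. t \<in> J \<Longrightarrow> \<bar>R1 t x\<bar> \<le> C" "\<And>t. t \<in> J \<Longrightarrow> weak_norm (k - 1) (\<omega> t) \<le> C"
  defines "G \<equiv> \<lambda>t. (weak_norm k (\<omega> t))\<^sup>2 + (weak_norm (Suc k) (\<rho> t))\<^sup>2"
  shows "(l2 lborel (Dh h k (W t1)))\<^sup>2 + (l2 lborel (Dh h (Suc k) (R t1)))\<^sup>2
     \<le> G 0 + (2 + 18 * 2 ^ k * C) * integral {0..t1} G"
proof -
  let ?M = "2 + 18 * 2 ^ k * C"
  let ?E = "\<lambda>t. (l2 lborel (Dh h k (W t)))\<^sup>2 + (l2 lborel (Dh h (Suc k) (R t)))\<^sup>2"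
  let ?e = "\<lambda>t. 2 * (LINT x|lborel. Dh h k (W t) x * Dh h k (Wt t) x)
     + 2 * (LINT x|lborel. Dh h (Suc k) (R t) x * Dh h (Suc k) (Rt t) x)"
  have z: "0 \<in> J" using Tstar by (simp add: J_def)
  have sub: "t \<in> J" if "t \<in> {0..t1}" for t using sub_J(2)[OF t1 that] .
  have jc: "continuous_on ({0..t1} \<times> UNIV) (\<lambda>(t, x). F t x)" if "continuous_on (J \<times> UNIV) (\<lambda>(t, x). F t x)" for F :: "real \<Rightarrow> real \<Rightarrow> real"
    by (rule continuous_on_subset[OF that]) (use sub in auto)
  have dE: "(?E has_real_derivative ?e t) (at t within {0..t1})" if t: "t \<in> {0..t1}" for t
  proof -
    have z: "W t x = 0" "R t x = 0" "Wt t x = 0" "Rt t x = 0" if "t \<in> {0..t1}" "x \<notin> {0..1}" for t x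
      using zero_outside[OF sub[OF that(1)], of x] Wt_Rt_zero[OF sub[OF that(1)] that(2)] that(2) by auto
    show ?thesis
      by (rule DERIV_add[OF
            energy_derivative[OF jc[OF jc_basic(1)] jc[OF jc_basic(2)] evolution_sub(1)[OF t1] z(1,3) h t]
            energy_derivative[OF jc[OF jc_basic(3)] jc[OF jc_basic(4)] evolution_sub(2)[OF t1] z(2,4) h t]])
  qed
  have cG: "continuous_on J G"
    unfolding G_def using k by (intro continuous_intros weak_norm_continuous) auto
  have dI: "((\<lambda>s. integral {0..s} G) has_real_derivative G t) (at t within {0..t1})" if "t \<in> {0..t1}" for t
    by (rule primitive[OF cG t1 that])
  let ?H = "\<lambda>t. ?E t - ?M * integral {0..t} G"
  have dH: "(?H has_real_derivative ?e t - ?M * G t) (at t within {0..t1})" if "t \<in> {0..t1}" for t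
    by (intro DERIV_diff dE DERIV_cmult dI that)
  have "?H t1 \<le> ?H 0"
  proof (rule DERIV_nonpos_imp_decreasing_open[OF sub_J(3)[OF t1]])
    show "\<exists>y. (?H has_real_derivative y) (at t) \<and> y \<le> 0" if "0 < t" "t < t1" for t
    proof (intro exI conjI)
      have t: "t \<in> {0..t1}" using that by simp
      show "(?H has_real_derivative ?e t - ?M * G t) (at t)"
        using dH[OF t] that by (simp add: at_within_Icc_at)
      show "?e t - ?M * G t \<le> 0"
        using energy_rate[OF sub[OF t] k h(1) C(1)[OF sub[OF t]] C(2)[OF sub[OF t]] C(3)[OF sub[OF t]]]
        by (simp add: G_def del: funpow.simps)
    qed
    show "continuous_on {0..t1} ?H" using dH by (rule DERIV_continuous_on)
  qed
  moreover have "?E 0 \<le> G 0"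
  proof -
    have "l2 lborel (Dh h k (W 0)) \<le> weak_norm k (\<omega> 0)"
      using Dh_ext_l2[OF \<omega>_ok _ _ h(1), of 0 0 k] k m z by (simp add: W_def)
    moreover have "l2 lborel (Dh h (Suc k) (R 0)) \<le> weak_norm (Suc k) (\<rho> 0)"
      using Dh_ext_l2[OF \<rho>_ok _ _ h(1), of 0 0 "Suc k"] k m z by (simp add: R_def)
    ultimately show ?thesis unfolding G_def by (intro add_mono power_mono) auto
  qed
  ultimately show ?thesis by simp
qed

text \<open>For small h the differences recover the full norms up to e, so the estimate becomes an
  integral inequality for \<open>G\<close> alone as e tends to 0. How small h must be may depend on
  t, which does no harm since the limit is taken at each fixed time.\<close>

lemma energy_growth:
  assumes k: "1 \<le> k" "k \<le> m" and t1: "t1 \<in> J"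
    and C: "\<And>t x. t \<in> J \<Longrightarrow> \<bar>u1 t x\<bar> \<le> C" "\<And>t x. t \<in> J \<Longrightarrow> \<bar>R1 t x\<bar> \<le> C" "\<And>t. t \<in> J \<Longrightarrow> weak_norm (k - 1) (\<omega> t) \<le> C"
  defines "G \<equiv> \<lambda>t. (weak_norm k (\<omega> t))\<^sup>2 + (weak_norm (Suc k) (\<rho> t))\<^sup>2"
  shows "G t1 \<le> G 0 * exp ((2 + 18 * 2 ^ k * C) * Tstar)"
proof -
  let ?M = "2 + 18 * 2 ^ k * C"
  have z: "0 \<in> J" using Tstar by (simp add: J_def)
  have C0: "0 \<le> C" using C(1)[OF z, of 0] by simp
  have M: "0 \<le> ?M" using C0 by simp
  have le: "G t \<le> G 0 + ?M * integral {0..t} G" if t: "t \<in> J" for t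
  proof -
    define a where "a = weak_norm k (\<omega> t)"
    define b where "b = weak_norm (Suc k) (\<rho> t)"
    have ab: "0 \<le> a" "0 \<le> b" by (simp_all add: a_def b_def)
    have "a\<^sup>2 + b\<^sup>2 - 2 * (a + b) * e \<le> G 0 + ?M * integral {0..t} G" if e: "0 < e" for e
    proof -
      obtain h1 where h1: "0 < h1" "\<And>h. 0 < h \<Longrightarrow> h \<le> h1 \<Longrightarrow> a \<le> l2 lborel (Dh h k (W t)) + e"
        using weak_norm_le_Dh_ext[OF \<omega>_ok _ _ e, of t k] t k m unfolding a_def W_def by auto
      obtain h2 where h2: "0 < h2" "\<And>h. 0 < h \<Longrightarrow> h \<le> h2 \<Longrightarrow> b \<le> l2 lborel (Dh h (Suc k) (R t)) + e"
        using weak_norm_le_Dh_ext[OF \<rho>_ok _ _ e, of t "Suc k"] t k m unfolding b_def R_def by auto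
      define h where "h = min 1 (min h1 h2)"
      have h: "0 < h" "h \<le> 1" "h \<le> h1" "h \<le> h2" using h1(1) h2(1) by (auto simp: h_def)
      \<comment> \<open>For a > e this is \<open>(a - e)\<^sup>2 \<le> l\<^sup>2\<close> with the
        term \<open>e\<^sup>2\<close> dropped; for a \<le> e the left side is at most 0.\<close>
      have sq: "a\<^sup>2 - 2 * a * e \<le> l\<^sup>2" if "0 \<le> a" "a \<le> l + e" "0 \<le> l" for a l :: real
      proof (cases "a \<le> e")
        case True
        have "a\<^sup>2 \<le> a * e" unfolding power2_eq_square by (intro mult_left_mono True that)
        moreover have "0 \<le> a * e" using that e by simp
        moreover have "0 \<le> l\<^sup>2" by simp
        ultimately show ?thesis by linarith
      next
        case False
        have "(a - e)\<^sup>2 \<le> l\<^sup>2" using False that by (intro power_mono) auto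
        moreover have "(a - e)\<^sup>2 = a\<^sup>2 - 2 * a * e + e\<^sup>2" by (simp add: power2_diff)
        moreover have "0 \<le> e\<^sup>2" by simp
        ultimately show ?thesis by linarith
      qed
      have "a\<^sup>2 - 2 * a * e \<le> (l2 lborel (Dh h k (W t)))\<^sup>2"
        by (intro sq ab h1 h) simp
      moreover have "b\<^sup>2 - 2 * b * e \<le> (l2 lborel (Dh h (Suc k) (R t)))\<^sup>2"
        by (intro sq ab h2 h) simp
      moreover have "(l2 lborel (Dh h k (W t)))\<^sup>2 + (l2 lborel (Dh h (Suc k) (R t)))\<^sup>2 \<le> G 0 + ?M * integral {0..t} G"
        unfolding G_def by (rule energy_integral_bound[OF k t h(1,2) C])
      moreover have "2 * (a + b) * e = 2 * a * e + 2 * b * e" by (simp add: algebra_simps)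
      ultimately show ?thesis by linarith
    qed
    note eps = this
    have "((\<lambda>e. a\<^sup>2 + b\<^sup>2 - 2 * (a + b) * e) \<longlongrightarrow> a\<^sup>2 + b\<^sup>2 - 2 * (a + b) * 0) (at_right 0)"
      by (intro tendsto_intros)
    then have "a\<^sup>2 + b\<^sup>2 - 2 * (a + b) * 0 \<le> G 0 + ?M * integral {0..t} G"
    proof (rule tendsto_upperbound)
      show "\<forall>\<^sub>F e in at_right 0. a\<^sup>2 + b\<^sup>2 - 2 * (a + b) * e \<le> G 0 + ?M * integral {0..t} G"
      proof (rule eventually_at_rightI[of 0 1])
        fix e :: real assume "e \<in> {0<..<1}"
        then have "0 < e" by simp
        then show "a\<^sup>2 + b\<^sup>2 - 2 * (a + b) * e \<le> G 0 + ?M * integral {0..t} G" by (rule eps)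
      qed simp
    qed simp
    then show ?thesis by (simp add: G_def a_def b_def)
  qed
  have cG: "continuous_on {0..t1} G"
    unfolding G_def using k
    by (intro continuous_intros continuous_on_subset[OF weak_norm_continuous(1) sub_J(1)[OF t1]]
          continuous_on_subset[OF weak_norm_continuous(2) sub_J(1)[OF t1]]) auto
  have "G t1 \<le> G 0 * exp (?M * t1)"
    by (rule Gronwall_integral[OF cG M sub_J(3)[OF t1]]) (rule le[OF sub_J(2)[OF t1]])
  also have "\<dots> \<le> G 0 * exp (?M * Tstar)"
    using t1 M by (intro mult_left_mono) (auto simp: J_def G_def intro!: mult_left_mono)
  finally show ?thesis .
qed

text \<open>The pair at order 0 consists of \<omega> and \<rho>_x and follows from the sup bounds,
  as the interval has length 1. In the step, the bound for \<omega> at the previous order enters the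
  constant of the energy estimate.\<close>

lemma weak_norm_bounded:
  assumes C: "\<And>t x. t \<in> J \<Longrightarrow> \<bar>u1 t x\<bar> \<le> C" "\<And>t x. t \<in> J \<Longrightarrow> \<bar>R1 t x\<bar> \<le> C" "\<And>t x. t \<in> J \<Longrightarrow> \<bar>W t x\<bar> \<le> C"
  shows "k \<le> m \<Longrightarrow> \<exists>B. \<forall>t\<in>J. weak_norm k (\<omega> t) \<le> B \<and> weak_norm (Suc k) (\<rho> t) \<le> B"
proof (induction k)
  case 0
  have z: "0 \<in> J" using Tstar by (simp add: J_def)
  have C0: "0 \<le> C" using C(1)[OF z, of 0] by simp
  have "weak_norm 0 (\<omega> t) \<le> C + 1 \<and> weak_norm (Suc 0) (\<rho> t) \<le> C + 1" if t: "t \<in> J" for t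
  proof
    obtain h1 where h1: "0 < h1" "\<And>h. 0 < h \<Longrightarrow> h \<le> h1 \<Longrightarrow> weak_norm 0 (\<omega> t) \<le> l2 lborel (Dh h 0 (W t)) + 1"
      using weak_norm_le_Dh_ext[OF \<omega>_ok _ _ zero_less_one, of t 0] t m unfolding W_def by auto
    have "l2 lborel (W t) \<le> C"
      by (rule l2_le_sup[OF W_Cc[OF t] C(3)[OF t] zero_outside(1)[OF t] C0])
    then show "weak_norm 0 (\<omega> t) \<le> C + 1" using h1(2)[OF h1(1)] by simp
    obtain h2 where h2: "0 < h2" "\<And>h. 0 < h \<Longrightarrow> h \<le> h2 \<Longrightarrow> weak_norm 1 (\<rho> t) \<le> l2 lborel (Dh h 1 (R t)) + 1"
      using weak_norm_le_Dh_ext[OF \<rho>_ok _ _ zero_less_one, of t 1] t m unfolding R_def by auto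
    have "l2 lborel (R1 t) \<le> C"
      by (rule l2_le_sup[OF R1_Cc[OF t] C(2)[OF t] zero_outside(4)[OF t] C0])
    moreover have "l2 lborel (Dh h2 1 (R t)) \<le> l2 lborel (R1 t)"
      using l2_dquot_le[OF R_dx[OF t] h2(1) R1_Cc[OF t]] by simp
    ultimately show "weak_norm (Suc 0) (\<rho> t) \<le> C + 1" using h2(2)[OF h2(1)] by simp
  qed
  then show ?case by blast
next
  case (Suc k)
  then obtain B where B: "\<And>t. t \<in> J \<Longrightarrow> weak_norm k (\<omega> t) \<le> B" by auto
  let ?C = "max B C"
  let ?G = "\<lambda>t. (weak_norm (Suc k) (\<omega> t))\<^sup>2 + (weak_norm (Suc (Suc k)) (\<rho> t))\<^sup>2"
  let ?A = "?G 0 * exp ((2 + 18 * 2 ^ Suc k * ?C) * Tstar)"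
  have "weak_norm (Suc k) (\<omega> t) \<le> sqrt ?A \<and> weak_norm (Suc (Suc k)) (\<rho> t) \<le> sqrt ?A" if t: "t \<in> J" for t
  proof -
    have "?G t \<le> ?A"
    proof (rule energy_growth[OF _ Suc.prems t])
      show "\<bar>u1 t x\<bar> \<le> ?C" "\<bar>R1 t x\<bar> \<le> ?C" if "t \<in> J" for t x
        using C(1,2)[OF that, of x] by auto
      show "weak_norm (Suc k - 1) (\<omega> t) \<le> ?C" if "t \<in> J" for t using B[OF that] by simp
    qed simp
    then have "(weak_norm (Suc k) (\<omega> t))\<^sup>2 \<le> ?A" "(weak_norm (Suc (Suc k)) (\<rho> t))\<^sup>2 \<le> ?A"
      using zero_le_power2[of "weak_norm (Suc k) (\<omega> t)"] zero_le_power2[of "weak_norm (Suc (Suc k)) (\<rho> t)"] by linarith+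
    then show ?thesis by (intro conjI real_le_rsqrt)
  qed
  then show ?case by blast
qed

lemma sobolev_bounded:
  assumes C: "\<And>t x. t \<in> J \<Longrightarrow> \<bar>u1 t x\<bar> \<le> C" "\<And>t x. t \<in> J \<Longrightarrow> \<bar>R1 t x\<bar> \<le> C" "\<And>t x. t \<in> J \<Longrightarrow> \<bar>W t x\<bar> \<le> C"
  shows "\<exists>B. \<forall>t\<in>J. sobolev_norm m (\<omega> t) + sobolev_norm (Suc m) (\<rho> t) \<le> B"
proof -
  obtain B where B: "\<And>t. t \<in> J \<Longrightarrow> weak_norm m (\<omega> t) \<le> B \<and> weak_norm (Suc m) (\<rho> t) \<le> B"
    using weak_norm_bounded[OF C order_refl] by blast
  have "sobolev_norm m (\<omega> t) + sobolev_norm (Suc m) (\<rho> t) \<le> (\<Sum>k\<le>m. B) + (\<Sum>k\<le>Suc m. B)" if t: "t \<in> J" for t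
  proof (rule add_mono)
    have "sobolev_norm m (\<omega> t) \<le> (\<Sum>k\<le>m. weak_norm k (\<omega> t))" by (rule sobolev_norm_le_sum)
    also have "\<dots> \<le> (\<Sum>k\<le>m. B)"
      using weak_norm_mono_le[OF \<omega>_in[OF t] \<omega>_c[OF t] _ order_refl] B[OF t] by (intro sum_mono) (auto intro: order_trans)
    finally show "sobolev_norm m (\<omega> t) \<le> (\<Sum>k\<le>m. B)" .
    have "sobolev_norm (Suc m) (\<rho> t) \<le> (\<Sum>k\<le>Suc m. weak_norm k (\<rho> t))" by (rule sobolev_norm_le_sum)
    also have "\<dots> \<le> (\<Sum>k\<le>Suc m. B)"
      using weak_norm_mono_le[OF \<rho>_in[OF t] \<rho>_c[OF t] _ order_refl] B[OF t] by (intro sum_mono) (auto intro: order_trans)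
    finally show "sobolev_norm (Suc m) (\<rho> t) \<le> (\<Sum>k\<le>Suc m. B)" .
  qed
  then show ?thesis by blast
qed

end

section \<open>The equivalence\<close>

text \<open>For a function with a continuous version the essential supremum is a pointwise bound: a
  closed sublevel set with full measure in the open interval contains it entirely.\<close>

lemma Linf_norm_bounds:
  assumes g: "continuous_on UNIV g" and f: "\<And>x. x \<in> {0<..<1} \<Longrightarrow> f x = g x"
  shows "x \<in> {0<..<1} \<Longrightarrow> ennreal \<bar>g x\<bar> \<le> Linf_norm f"
    and "(\<And>x. x \<in> {0<..<1} \<Longrightarrow> \<bar>g x\<bar> \<le> M) \<Longrightarrow> Linf_norm f \<le> ennreal M"
proof -
  have "g \<in> borel_measurable unit_measure"
    by (intro measurable_unit_measure borel_measurable_continuous_onI g)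
  then have gm: "(\<lambda>x. ennreal \<bar>g x\<bar>) \<in> borel_measurable unit_measure" by simp
  have "(\<lambda>x. ennreal \<bar>f x\<bar>) \<in> borel_measurable unit_measure \<longleftrightarrow> (\<lambda>x. ennreal \<bar>g x\<bar>) \<in> borel_measurable unit_measure"
    by (rule measurable_cong) (simp add: f)
  with gm have fm: "(\<lambda>x. ennreal \<bar>f x\<bar>) \<in> borel_measurable unit_measure" by simp
  show "Linf_norm f \<le> ennreal M" if "\<And>x. x \<in> {0<..<1} \<Longrightarrow> \<bar>g x\<bar> \<le> M"
    unfolding Linf_norm_def by (rule esssup_I[OF fm]) (use that f in \<open>auto intro!: AE_I2 ennreal_leI\<close>)
  show "ennreal \<bar>g x\<bar> \<le> Linf_norm f" if x: "x \<in> {0<..<1}"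
  proof (cases "Linf_norm f")
    case (real L)
    have "AE y in unit_measure. ennreal \<bar>f y\<bar> \<le> ennreal L"
      using esssup_AE[of "\<lambda>x. ennreal \<bar>f x\<bar>" unit_measure] real by (simp add: Linf_norm_def)
    then have "AE y in unit_measure. ennreal \<bar>f y\<bar> \<le> ennreal L \<and> y \<in> {0<..<1}"
      using AE_space[of unit_measure] by (auto elim!: eventually_elim2)
    then have "AE y in unit_measure. y \<in> {y. \<bar>g y\<bar> \<le> L}"
      by (rule eventually_mono) (use real(1) f in \<open>auto simp: ennreal_le_iff\<close>)
    then have ae: "AE y\<in>{0<..<1} in lebesgue. y \<in> {y. \<bar>g y\<bar> \<le> L}"
      by (subst (asm) AE_restrict_space_iff) auto
    have "closed {y. \<bar>g y\<bar> \<le> L}"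
      by (intro closed_Collect_le continuous_intros g)
    from mem_closed_if_AE_lebesgue_open[OF open_greaterThanLessThan this ae x]
    show ?thesis using real by (simp add: ennreal_leI)
  qed simp
qed

section \<open>Integrals in time and continuous majorants\<close>

lemma nn_integral_interval:
  fixes a :: "real \<Rightarrow> real"
  assumes "continuous_on {0..t} a" "\<And>s. s \<in> {0..t} \<Longrightarrow> 0 \<le> a s"
  shows "(\<integral>\<^sup>+s\<in>{0..t}. ennreal (a s) \<partial>lborel) = ennreal (integral {0..t} a)"
proof -
  have i: "set_integrable lborel {0..t} a" by (rule borel_integrable_atLeastAtMost'[OF assms(1)])
  have "(\<integral>\<^sup>+s\<in>{0..t}. ennreal (a s) \<partial>lborel) = (\<integral>\<^sup>+s. ennreal (indicator {0..t} s *\<^sub>R a s) \<partial>lborel)"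
    by (intro nn_integral_cong) (auto simp: indicator_def)
  also have "\<dots> = ennreal (LINT s:{0..t}|lborel. a s)"
    unfolding set_lebesgue_integral_def
    by (rule nn_integral_eq_integral) (use i assms(2) in \<open>auto simp: set_integrable_def indicator_def\<close>)
  also have "(LINT s:{0..t}|lborel. a s) = integral {0..t} a"
    by (rule set_borel_integral_eq_integral[OF i])
  finally show ?thesis .
qed

context boussinesq
begin

lemma finite_if_bounded:
  assumes "\<And>t. t \<in> J \<Longrightarrow> F t \<le> ennreal M"
  shows "(\<integral>\<^sup>+t\<in>{0..<Tstar}. F t \<partial>lborel) < \<infinity>"
proof -
  have "(\<integral>\<^sup>+t\<in>{0..<Tstar}. F t \<partial>lborel) \<le> (\<integral>\<^sup>+t. ennreal M * indicator {0..<Tstar} t \<partial>lborel)"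
    using assms by (intro nn_integral_mono) (auto simp: indicator_def J_def)
  also have "\<dots> = ennreal M * ennreal Tstar"
    using Tstar by (subst nn_integral_cmult_indicator) auto
  also have "\<dots> < \<infinity>" by (simp add: ennreal_mult_less_top)
  finally show ?thesis .
qed

text \<open>The extended-valued F is traded for a continuous real majorant of \<bar>q\<bar>, so that
  its primitive is differentiable and can enter a barrier. The supremum over x is continuous in time
  because d does not depend on x, and it lies below F, so the integral of F bounds all its
  primitives.\<close>

lemma finite_imp_sup:
  fixes q :: "real \<Rightarrow> real \<Rightarrow> real"
  assumes fin: "(\<integral>\<^sup>+t\<in>{0..<Tstar}. F t \<partial>lborel) < \<infinity>"
    and F: "\<And>t x. t \<in> J \<Longrightarrow> x \<in> {0<..<1} \<Longrightarrow> ennreal \<bar>q t x\<bar> \<le> F t"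
    and bd: "\<And>t x. t \<in> J \<Longrightarrow> x \<in> {0<..<1} \<Longrightarrow> \<bar>q t x\<bar> \<le> b t"
    and diff: "\<And>s t x. s \<in> J \<Longrightarrow> t \<in> J \<Longrightarrow> x \<in> {0<..<1} \<Longrightarrow> \<bar>q s x - q t x\<bar> \<le> d s t"
    and d: "\<And>t. t \<in> J \<Longrightarrow> ((\<lambda>s. d s t) \<longlongrightarrow> 0) (at t within J)"
  shows "\<exists>a A. continuous_on J a \<and> (\<forall>t\<in>J. \<forall>x\<in>{0<..<1}. \<bar>q t x\<bar> \<le> a t) \<and> (\<forall>t\<in>J. integral {0..t} a \<le> A)"
proof -
  define a where "a t = (SUP x\<in>{0<..<1}. \<bar>q t x\<bar>)" for t
  have ne: "{0<..<1::real} \<noteq> {}" by auto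
  have bdd: "bdd_above ((\<lambda>x. \<bar>q t x\<bar>) ` {0<..<1})" if "t \<in> J" for t
    using bd[OF that] by (intro bdd_aboveI2)
  have up: "\<bar>q t x\<bar> \<le> a t" if "t \<in> J" "x \<in> {0<..<1}" for t x
    unfolding a_def by (rule cSUP_upper[OF that(2) bdd[OF that(1)]])
  have least: "a t \<le> M" if "\<And>x. x \<in> {0<..<1} \<Longrightarrow> \<bar>q t x\<bar> \<le> M" for t M
    unfolding a_def by (rule cSUP_least[OF ne that])
  have a0: "0 \<le> a t" if "t \<in> J" for t
    using up[OF that, of "1/2"] by auto
  have "\<bar>a s - a t\<bar> \<le> d s t" if "s \<in> J" "t \<in> J" for s t
  proof -
    have "\<bar>q s x\<bar> \<le> a t + d s t" "\<bar>q t x\<bar> \<le> a s + d s t" if x: "x \<in> {0<..<1}" for x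
      using up[OF \<open>t \<in> J\<close> x] up[OF \<open>s \<in> J\<close> x] diff[OF \<open>s \<in> J\<close> \<open>t \<in> J\<close> x] by linarith+
    then have "a s \<le> a t + d s t" "a t \<le> a s + d s t" by (auto intro: least)
    then show ?thesis by linarith
  qed
  then have ca: "continuous_on J a" using d by (rule continuous_of_diff)
  have aF: "ennreal (a t) \<le> F t" if t: "t \<in> J" for t
  proof (cases "F t")
    case (real r)
    have "a t \<le> r"
      by (rule least) (use F[OF t] real in \<open>auto simp: ennreal_le_iff\<close>)
    then show ?thesis using real by (simp add: ennreal_leI)
  qed simp
  let ?I = "\<integral>\<^sup>+t\<in>{0..<Tstar}. F t \<partial>lborel"
  have "integral {0..t} a \<le> enn2real ?I" if t: "t \<in> J" for t
  proof -
    have "ennreal (integral {0..t} a) = (\<integral>\<^sup>+s\<in>{0..t}. ennreal (a s) \<partial>lborel)"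
      using a0 sub_J[OF t] by (intro nn_integral_interval[symmetric] continuous_on_subset[OF ca]) auto
    also have "\<dots> \<le> ?I"
      using aF sub_J(2)[OF t] by (intro nn_integral_mono) (auto simp: indicator_def J_def)
    also have "?I = ennreal (enn2real ?I)" using fin by simp
    finally show ?thesis by (simp add: ennreal_le_iff)
  qed
  with ca up show ?thesis by blast
qed

lemma Linf_pointwise:
  assumes t: "t \<in> J"
  shows "x \<in> {0<..<1} \<Longrightarrow> ennreal \<bar>W t x\<bar> \<le> Linf_norm (\<omega> t)"
    "x \<in> {0<..<1} \<Longrightarrow> ennreal \<bar>R1 t x\<bar> \<le> Linf_norm (deriv (\<rho> t))"
    "x \<in> {0<..<1} \<Longrightarrow> ennreal \<bar>u1 t x\<bar> \<le> Linf_norm (deriv (velocity (\<omega> t)))"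
    "(\<And>x. \<bar>W t x\<bar> \<le> M) \<Longrightarrow> Linf_norm (\<omega> t) \<le> ennreal M"
    "(\<And>x. \<bar>R1 t x\<bar> \<le> M) \<Longrightarrow> Linf_norm (deriv (\<rho> t)) \<le> ennreal M"
    "(\<And>x. \<bar>u1 t x\<bar> \<le> M) \<Longrightarrow> Linf_norm (deriv (velocity (\<omega> t))) \<le> ennreal M"
proof -
  have c: "continuous_on UNIV (W t)" "continuous_on UNIV (R1 t)" "continuous_on UNIV (u1 t)"
    using W_Cc[OF t] R1_Cc[OF t] differentiable_imp_continuous_UNIV[OF u_derivatives(3)[OF t]] by (auto intro: Cc_cont)
  have e1: "\<omega> t x = W t x" if "x \<in> {0<..<1}" for x using that by (simp add: W_def ext_eq)
  have e2: "deriv (\<rho> t) x = R1 t x" if "x \<in> {0<..<1}" for x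
    by (rule DERIV_imp_deriv, rule has_field_derivative_transform_within_open[OF R_dx[OF t] open_greaterThanLessThan that])
       (simp add: R_def ext_eq)
  have e3: "deriv (velocity (\<omega> t)) x = u1 t x" if "x \<in> {0<..<1}" for x
    by (rule DERIV_imp_deriv, rule has_field_derivative_transform_within_open[OF u_derivatives(2)[OF t] open_greaterThanLessThan that])
       (simp add: velocity_eq[OF t])
  note b1 = Linf_norm_bounds[OF c(1) e1] and b2 = Linf_norm_bounds[OF c(2) e2] and b3 = Linf_norm_bounds[OF c(3) e3]
  show "x \<in> {0<..<1} \<Longrightarrow> ennreal \<bar>W t x\<bar> \<le> Linf_norm (\<omega> t)"
    "x \<in> {0<..<1} \<Longrightarrow> ennreal \<bar>R1 t x\<bar> \<le> Linf_norm (deriv (\<rho> t))"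
    "x \<in> {0<..<1} \<Longrightarrow> ennreal \<bar>u1 t x\<bar> \<le> Linf_norm (deriv (velocity (\<omega> t)))"
    by (rule b1(1) b2(1) b3(1); assumption)+
  show "Linf_norm (\<omega> t) \<le> ennreal M" if "\<And>x. \<bar>W t x\<bar> \<le> M" by (rule b1(2), assumption) (rule that)
  show "Linf_norm (deriv (\<rho> t)) \<le> ennreal M" if "\<And>x. \<bar>R1 t x\<bar> \<le> M" by (rule b2(2), assumption) (rule that)
  show "Linf_norm (deriv (velocity (\<omega> t))) \<le> ennreal M" if "\<And>x. \<bar>u1 t x\<bar> \<le> M" by (rule b3(2), assumption) (rule that)
qed

text \<open>The energy estimate integrates over the line, and differences reach to the left of 0.
  Outside [0,1] u is linear or zero, so \<open>u1\<close> keeps its value from the nearest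
  endpoint.\<close>

lemma u1_bound_outside:
  assumes t: "t \<in> J" and C: "\<And>x. x \<in> {0..1} \<Longrightarrow> \<bar>u1 t x\<bar> \<le> C"
  shows "\<bar>u1 t x\<bar> \<le> C"
proof -
  have "u1 t x = u1 t (clamp x)"
  proof -
    consider "x < 0" | "x \<in> {0..1}" | "1 < x" by force
    then show ?thesis
    proof cases
      case 1
      then show ?thesis using Om_outside(1)[OF t, of x] zero_outside(1)[OF t, of x] zero_outside(1)[OF t, of 0]
        by (simp add: u1_def clamp_def)
    next
      case 3
      then show ?thesis using Om_outside(2)[OF t, of x] Om_outside(2)[OF t, of 1] zero_outside(1)[OF t, of x] zero_outside(1)[OF t, of 1]
        by (simp add: u1_def clamp_def)
    qed simp
  qed
  then show ?thesis using C[of "clamp x"] by simp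
qed

abbreviation "total_norm t \<equiv> sobolev_norm m (\<omega> t) + sobolev_norm (Suc m) (\<rho> t)"

lemma sup_finite_iff: "(SUP t\<in>{0..<Tstar}. ereal (total_norm t)) < \<infinity> \<longleftrightarrow> (\<exists>B. \<forall>t\<in>J. total_norm t \<le> B)"
proof
  assume fin: "(SUP t\<in>{0..<Tstar}. ereal (total_norm t)) < \<infinity>"
  have up: "ereal (total_norm t) \<le> (SUP t\<in>{0..<Tstar}. ereal (total_norm t))" if "t \<in> J" for t
    using that unfolding J_def by (rule SUP_upper)
  have "0 \<in> J" using Tstar by (simp add: J_def)
  with up fin obtain r where "(SUP t\<in>{0..<Tstar}. ereal (total_norm t)) = ereal r"
    by (cases "SUP t\<in>{0..<Tstar}. ereal (total_norm t)") auto
  then have "total_norm t \<le> r" if "t \<in> J" for t using up[OF that] by simp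
  then show "\<exists>B. \<forall>t\<in>J. total_norm t \<le> B" by blast
next
  assume "\<exists>B. \<forall>t\<in>J. total_norm t \<le> B"
  then obtain B where "\<And>t. t \<in> J \<Longrightarrow> total_norm t \<le> B" by blast
  then have "(SUP t\<in>{0..<Tstar}. ereal (total_norm t)) \<le> ereal B"
    by (intro SUP_least) (auto simp: J_def)
  then show "(SUP t\<in>{0..<Tstar}. ereal (total_norm t)) < \<infinity>" by (rule le_less_trans) simp
qed

lemma interior_bound:
  fixes f :: "real \<Rightarrow> real"
  assumes "continuous_on UNIV f" "\<And>x. x \<in> {0<..<1} \<Longrightarrow> \<bar>f x\<bar> \<le> C" "x \<in> {0..1}"
  shows "\<bar>f x\<bar> \<le> C"
proof -
  have "closed {x. \<bar>f x\<bar> \<le> C}" by (intro closed_Collect_le continuous_intros assms)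
  then have "closure {0<..<1::real} \<subseteq> {x. \<bar>f x\<bar> \<le> C}" using assms(2) by (intro closure_minimal) auto
  then show ?thesis using assms(3) by auto
qed

section \<open>The implications\<close>

lemma bounded_imp_finite:
  assumes B: "\<And>t. t \<in> J \<Longrightarrow> total_norm t \<le> B"
  shows "(\<integral>\<^sup>+t\<in>{0..<Tstar}. Linf_norm (deriv (velocity (\<omega> t))) \<partial>lborel) < \<infinity>"
proof -
  have nn: "0 \<le> sobolev_norm j f" for j f by (simp add: sobolev_norm_weak_norm sum_nonneg)
  have "\<bar>u1 t x\<bar> \<le> B + B" if t: "t \<in> J" for t x
  proof -
    have "weak_norm 1 (\<omega> t) \<le> B" "weak_norm 2 (\<omega> t) \<le> B"
      using weak_norm_le_sobolev_norm[of 1 m "\<omega> t"] weak_norm_le_sobolev_norm[of 2 m "\<omega> t"] B[OF t] nn[of "Suc m" "\<rho> t"] m by auto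
    then show ?thesis
      using abs_bounds(1)[OF t, of x] Om_bound[OF t, of x] unfolding u1_def by linarith
  qed
  then show ?thesis by (intro finite_if_bounded[of _ "B + B"] Linf_pointwise(6))
qed

lemma deriv_u_imp_deriv_rho:
  assumes fin: "(\<integral>\<^sup>+t\<in>{0..<Tstar}. Linf_norm (deriv (velocity (\<omega> t))) \<partial>lborel) < \<infinity>"
  shows "(\<integral>\<^sup>+t\<in>{0..<Tstar}. Linf_norm (deriv (\<rho> t)) \<partial>lborel) < \<infinity>"
proof -
  have bd: "\<bar>u1 t x\<bar> \<le> weak_norm 1 (\<omega> t) + weak_norm 2 (\<omega> t)" if "t \<in> J" for t x
    using abs_bounds(1)[OF that, of x] Om_bound[OF that, of x] unfolding u1_def by linarith
  have diff: "\<bar>u1 s x - u1 t x\<bar> \<le> 2 * d\<omega> s t" if "s \<in> J" "t \<in> J" "x \<in> {0<..<1}" for s t x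
    using diff_bounds(1)[OF that(1,2), of x] Om_diff[OF that(1,2), of x] that(3) unfolding u1_def by auto
  have lim: "((\<lambda>s. 2 * d\<omega> s t) \<longlongrightarrow> 0) (at t within J)" if "t \<in> J" for t
    using tendsto_mult_right_zero[OF d_lim(1)[OF that], of 2] by simp
  obtain U A where U: "continuous_on J U" "\<And>t x. t \<in> J \<Longrightarrow> x \<in> {0<..<1} \<Longrightarrow> \<bar>u1 t x\<bar> \<le> U t"
    and A: "\<And>t. t \<in> J \<Longrightarrow> integral {0..t} U \<le> A"
    using finite_imp_sup[where q = u1, OF fin Linf_pointwise(3) bd diff lim] by blast
  let ?M = "(weak_norm 2 (\<rho> 0) + 1) * exp (Tstar + A)"
  have N1: "0 \<le> weak_norm 2 (\<rho> 0) + 1" using weak_norm_nonneg[of 2 "\<rho> 0"] by linarith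
  have "\<bar>R1 t x\<bar> \<le> ?M" if t: "t \<in> J" for t x
  proof (cases "x \<in> {0..1}")
    case True
    have "\<bar>R1 t x\<bar> \<le> (weak_norm 2 (\<rho> 0) + 1) * exp (t + integral {0..t} U)"
      by (rule R1_bound[OF U t True])
    also have "\<dots> \<le> ?M"
      using A[OF t] t N1 by (intro mult_left_mono) (auto simp: J_def)
    finally show ?thesis .
  next
    case False
    then have "x \<notin> {0<..<1}" by auto
    then show ?thesis using zero_outside(4)[OF t] N1 by simp
  qed
  then show ?thesis by (intro finite_if_bounded[of _ ?M] Linf_pointwise(5))
qed

lemma deriv_rho_imp_omega:
  assumes fin: "(\<integral>\<^sup>+t\<in>{0..<Tstar}. Linf_norm (deriv (\<rho> t)) \<partial>lborel) < \<infinity>"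
  shows "(\<integral>\<^sup>+t\<in>{0..<Tstar}. Linf_norm (\<omega> t) \<partial>lborel) < \<infinity>"
proof -
  obtain r A where r: "continuous_on J r" "\<And>t x. t \<in> J \<Longrightarrow> x \<in> {0<..<1} \<Longrightarrow> \<bar>R1 t x\<bar> \<le> r t"
    and A: "\<And>t. t \<in> J \<Longrightarrow> integral {0..t} r \<le> A"
    using finite_imp_sup[where q = R1, OF fin Linf_pointwise(2) abs_bounds(3) diff_bounds(3) d_lim(2)] by blast
  have r': "\<bar>R1 t x\<bar> \<le> r t" if "t \<in> J" "x \<in> {0..1}" for t x
    by (rule interior_bound[OF Cc_cont[OF R1_Cc[OF that(1)]] r(2)[OF that(1)] that(2)])
  let ?M = "weak_norm 1 (\<omega> 0) + 1 + Tstar + \<bar>A\<bar>"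
  have "\<bar>W t x\<bar> \<le> ?M" if t: "t \<in> J" for t x
  proof (cases "x \<in> {0..1}")
    case True
    have "\<bar>W t x\<bar> \<le> weak_norm 1 (\<omega> 0) + 1 + t + integral {0..t} r"
      by (rule W_bound[OF r(1) r' t True])
    also have "\<dots> \<le> ?M" using A[OF t] t by (auto simp: J_def)
    finally show ?thesis .
  next
    case False
    then have "x \<notin> {0<..<1}" by auto
    then show ?thesis using zero_outside(1)[OF t] Tstar weak_norm_nonneg[of 1 "\<omega> 0"] by simp
  qed
  then show ?thesis by (intro finite_if_bounded[of _ ?M] Linf_pointwise(4))
qed

text \<open>The double exponential at the final time is one constant for both quotients by x.
  Multiplication by x \<le> 1 passes it to \<omega> and \<rho>_x, and integration of
  \<open>K\<close> over [x,1] to \<Omega>.\<close>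

lemma omega_imp_bounded:
  assumes fin: "(\<integral>\<^sup>+t\<in>{0..<Tstar}. Linf_norm (\<omega> t) \<partial>lborel) < \<infinity>"
  shows "\<exists>B. \<forall>t\<in>J. total_norm t \<le> B"
proof -
  obtain a A where a: "continuous_on J a" "\<And>t x. t \<in> J \<Longrightarrow> x \<in> {0<..<1} \<Longrightarrow> \<bar>W t x\<bar> \<le> a t"
    and A: "\<And>t. t \<in> J \<Longrightarrow> integral {0..t} a \<le> A"
    using finite_imp_sup[where q = W, OF fin Linf_pointwise(1) abs_bounds(1) diff_bounds(1) d_lim(1)] by blast
  have a': "\<bar>W t x\<bar> \<le> a t" if "t \<in> J" "x \<in> {0..1}" for t x
    by (rule interior_bound[OF Cc_cont[OF W_Cc[OF that(1)]] a(2)[OF that(1)] that(2)])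
  define y0 where "y0 = ln (1 + weak_norm 2 (\<omega> 0) + weak_norm 3 (\<rho> 0))"
  have y0: "0 \<le> y0" unfolding y0_def by simp
  define C where "C = exp ((1 + y0) * exp (3 * (Tstar + A)) - 1)"
  have C0: "0 \<le> C" by (simp add: C_def)
  have KQ: "\<bar>K t x\<bar> \<le> C" "\<bar>Q t x\<bar> \<le> C" if t: "t \<in> J" and x: "x \<in> {0..1}" for t x
  proof -
    have "exp ((1 + y0) * exp (3 * (t + integral {0..t} a)) - 1) \<le> C"
      unfolding C_def using A[OF t] t y0 by (auto simp: J_def intro!: mult_left_mono)
    then show "\<bar>K t x\<bar> \<le> C" "\<bar>Q t x\<bar> \<le> C"
      using KQ_growth[OF a(1) a' t x, folded y0_def] by linarith+
  qed
  \<comment> \<open>Undoes the division by x, which only increased absolute values since x <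
    1.\<close>
  have quot: "\<bar>f\<bar> \<le> C" if "\<bar>f / x\<bar> \<le> C" "x \<in> {0<..<1}" for f x :: real
  proof -
    have "\<bar>f\<bar> = \<bar>f / x\<bar> * x" using that(2) by simp
    also have "\<dots> \<le> C * 1" using that C0 by (intro mult_mono) auto
    finally show ?thesis by simp
  qed
  have WR: "\<bar>W t x\<bar> \<le> C" "\<bar>R1 t x\<bar> \<le> C" if t: "t \<in> J" for t x
  proof -
    have "\<bar>W t x\<bar> \<le> C \<and> \<bar>R1 t x\<bar> \<le> C"
    proof (cases "x \<in> {0<..<1}")
      case True
      then have x: "x \<in> {0..1}" by auto
      show ?thesis using KQ[OF t x] quot[OF _ True] by (simp add: K_def Q_def)
    next
      case False
      then show ?thesis using zero_outside[OF t False] C0 by simp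
    qed
    then show "\<bar>W t x\<bar> \<le> C" "\<bar>R1 t x\<bar> \<le> C" by auto
  qed
  have u1: "\<bar>u1 t x\<bar> \<le> 2 * C" if t: "t \<in> J" for t x
  proof (rule u1_bound_outside[OF t])
    fix x :: real assume x: "x \<in> {0..1}"
    have "norm (integral {x..1} (K t)) \<le> C * (1 - x)"
      by (rule integral_bound) (use x t KQ in \<open>auto intro!: continuous_on_subset[OF Cc_cont[OF K_Cc]]\<close>)
    also have "\<dots> \<le> C" using x C0 by (intro mult_left_le) auto
    finally have "\<bar>Om t x\<bar> \<le> C" using Om_eq[OF t, of x] x by simp
    then show "\<bar>u1 t x\<bar> \<le> 2 * C" using WR(1)[OF t, of x] unfolding u1_def by linarith
  qed
  show ?thesis
  proof (rule sobolev_bounded)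
    show "\<bar>u1 t x\<bar> \<le> 2 * C" if "t \<in> J" for t x by (rule u1[OF that])
    show "\<bar>R1 t x\<bar> \<le> 2 * C" "\<bar>W t x\<bar> \<le> 2 * C" if "t \<in> J" for t x
      using WR[OF that, of x] C0 by linarith+
  qed
qed

text \<open>The implications form the cycle from bounded norms to u_x, to \<rho>_x, to \<omega> and
  back to bounded norms.\<close>

lemma blow_up_criteria:
  "((SUP t\<in>{0..<Tstar}. ereal (total_norm t)) < \<infinity>
        \<longleftrightarrow> (\<integral>\<^sup>+t\<in>{0..<Tstar}. Linf_norm (deriv (velocity (\<omega> t))) \<partial>lborel) < \<infinity>) \<and>
   ((\<integral>\<^sup>+t\<in>{0..<Tstar}. Linf_norm (deriv (velocity (\<omega> t))) \<partial>lborel) < \<infinity>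
        \<longleftrightarrow> (\<integral>\<^sup>+t\<in>{0..<Tstar}. Linf_norm (\<omega> t) \<partial>lborel) < \<infinity>) \<and>
   ((\<integral>\<^sup>+t\<in>{0..<Tstar}. Linf_norm (\<omega> t) \<partial>lborel) < \<infinity>
        \<longleftrightarrow> (\<integral>\<^sup>+t\<in>{0..<Tstar}. Linf_norm (deriv (\<rho> t)) \<partial>lborel) < \<infinity>)"
  using sup_finite_iff bounded_imp_finite deriv_u_imp_deriv_rho deriv_rho_imp_omega omega_imp_bounded by blast

end

theorem proposition3p1:
  fixes m :: nat and T :: ereal and Tstar :: real
    and \<omega>0 \<rho>0 :: "real \<Rightarrow> real" and \<omega> \<rho> :: "real \<Rightarrow> real \<Rightarrow> real"
  assumes "2 \<le> m"
    and "\<omega>0 \<in> sobolev0 m" and "\<rho>0 \<in> sobolev0 (m + 1)"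
    and "0 < T"
    and "continuous_into_sobolev0 T m \<omega>" and "continuous_into_sobolev0 T (m + 1) \<rho>"
    and "classical_solution T \<omega>0 \<rho>0 \<omega> \<rho>"
    and "0 < Tstar" and "ereal Tstar \<le> T"
  shows
    "((SUP t\<in>{0..<Tstar}. ereal (sobolev_norm m (\<omega> t) + sobolev_norm (m + 1) (\<rho> t))) < \<infinity>
        \<longleftrightarrow> (\<integral>\<^sup>+t\<in>{0..<Tstar}. Linf_norm (deriv (velocity (\<omega> t))) \<partial>lborel) < \<infinity>) \<and>
     ((\<integral>\<^sup>+t\<in>{0..<Tstar}. Linf_norm (deriv (velocity (\<omega> t))) \<partial>lborel) < \<infinity>
        \<longleftrightarrow> (\<integral>\<^sup>+t\<in>{0..<Tstar}. Linf_norm (\<omega> t) \<partial>lborel) < \<infinity>) \<and>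
     ((\<integral>\<^sup>+t\<in>{0..<Tstar}. Linf_norm (\<omega> t) \<partial>lborel) < \<infinity>
        \<longleftrightarrow> (\<integral>\<^sup>+t\<in>{0..<Tstar}. Linf_norm (deriv (\<rho> t)) \<partial>lborel) < \<infinity>)"
proof -
  let ?I = "time_interval T" and ?J = "{0..<Tstar}"
  have sub: "?J \<subseteq> ?I"
    using assms(9) by (auto simp: time_interval_def intro: less_le_trans[of "ereal _" "ereal Tstar"])
  then have I: "t \<in> ?I" if "t \<in> ?J" for t using that by blast
  obtain \<omega>t \<omega>x \<rho>t \<rho>x where
    eqs: "\<forall>t\<in>?I. \<forall>x\<in>{0..1}.
           ((\<lambda>s. \<omega> s x) has_real_derivative \<omega>t t x) (at t within ?I) \<and>
           (\<omega> t has_real_derivative \<omega>x t x) (at x within {0..1}) \<and>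
           ((\<lambda>s. \<rho> s x) has_real_derivative \<rho>t t x) (at t within ?I) \<and>
           (\<rho> t has_real_derivative \<rho>x t x) (at x within {0..1}) \<and>
           \<rho>t t x + velocity (\<omega> t) x * \<rho>x t x = 0 \<and>
           \<omega>t t x + velocity (\<omega> t) x * \<omega>x t x = \<rho>x t x"
    and jc: "\<forall>f\<in>{\<omega>, \<rho>, \<omega>t, \<omega>x, \<rho>t, \<rho>x, \<lambda>t. velocity (\<omega> t)}. continuous_on (?I \<times> {0..1}) (\<lambda>(t, x). f t x)"
    using assms(7) unfolding classical_solution_def by blast
  have jcJ: "continuous_on (?J \<times> {0..1}) (\<lambda>(t, x). f t x)" if "f \<in> {\<omega>, \<rho>, \<omega>t, \<rho>t}" for f
    by (rule continuous_on_subset[of "?I \<times> {0..1}"]) (use jc that sub in auto)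
  interpret boussinesq m ?J Tstar \<omega> \<rho> \<omega>t \<rho>t \<omega>x \<rho>x
  proof unfold_locales
    show "\<omega> t \<in> sobolev0 m" "\<rho> t \<in> sobolev0 (Suc m)" if "t \<in> ?J" for t
      using assms(5,6) I[OF that] by (auto simp: continuous_into_sobolev0_def)
    show "((\<lambda>s. sobolev_norm m (\<lambda>x. \<omega> s x - \<omega> t x)) \<longlongrightarrow> 0) (at t within ?J)"
      "((\<lambda>s. sobolev_norm (Suc m) (\<lambda>x. \<rho> s x - \<rho> t x)) \<longlongrightarrow> 0) (at t within ?J)" if "t \<in> ?J" for t
      using assms(5,6) I[OF that] sub by (auto simp: continuous_into_sobolev0_def intro: tendsto_within_subset)
    show "((\<lambda>s. \<omega> s x) has_real_derivative \<omega>t t x) (at t within ?J)"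
      "((\<lambda>s. \<rho> s x) has_real_derivative \<rho>t t x) (at t within ?J)" if "t \<in> ?J" "x \<in> {0..1}" for t x
      using eqs I[OF that(1)] that(2) by (blast intro: DERIV_subset[OF _ sub])+
    show "(\<omega> t has_real_derivative \<omega>x t x) (at x within {0..1})" "(\<rho> t has_real_derivative \<rho>x t x) (at x within {0..1})"
      "\<rho>t t x + velocity (\<omega> t) x * \<rho>x t x = 0" "\<omega>t t x + velocity (\<omega> t) x * \<omega>x t x = \<rho>x t x"
      if "t \<in> ?J" "x \<in> {0..1}" for t x
      using eqs I[OF that(1)] that(2) by blast+
  qed (use assms(1,8) jcJ in auto)
  show ?thesis using blow_up_criteria by simp
qed

end
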